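(* Let $p\geq2$ and $n_1,\dots,n_l\geq1$ be integers with $\sum_{j=1}^l p^{-n_j}=1$, and let $T_p$ be the map satisfying Condition 1 with slopes $\Lambda_j=p^{n_j}$, i.e. $T_p(x)=p^{n_j}x \bmod 1$ for $x\in I_j$, $j=1,\dots,l$. Let $U_\Bbbk$, $\Bbbk=1,2,\dots$, be a sequence of tensorial quantizations of $T_p$, and for each $\Bbbk$ let $\psi_\Bbbk$ be a normalized eigenvector of $U_\Bbbk$. Then every semiclassical measure $\mu$ of the sequence $(\psi_\Bbbk)$ satisfies $$H_{\mathrm{KS}}(T_p,\mu)\geq\frac12\sum_{j=1}^l\mu(I_j)\log\Lambda_j .$$
   Context: Condition 1: $I=[0,1]$ is divided into consecutive intervals $I_1,\dots,I_l$ (left to right) with $|I_j|=\Lambda_j^{-1}$, and on each $I_j$ the map is affine with slope $\Lambda_j$ mapping $I_j$ onto $I$. Write points of $I$ in base $p$, $x=0.\mathrm x_1\mathrm x_2\dots$, $\mathrm x_i\in\{0,\dots,p-1\}$; for a finite word $\mathrm x=\mathrm x_1\dots\mathrm x_m$ the cylinder $[\![\mathrm x]\!]$ is the closed interval of points whose first $m$ base-$p$ digits are $\mathrm x_1,\dots,\mathrm x_m$. Let $n_{\max}=\max_j n_j$. For $\Bbbk\geq n_{\max}$, let $\mathcal H_\Bbbk=(\mathbb C^p)^{\otimes\Bbbk}$ with orthonormal basis $|\mathrm x\rangle=|\mathrm x_1\rangle\otimes\cdots\otimes|\mathrm x_\Bbbk\rangle$ indexed by words of length $\Bbbk$ (corresponding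 to the partition of $I$ into the $p^\Bbbk$ cylinders of length $\Bbbk$); each such cylinder lies in exactly one $I_j$. A tensorial quantization is given by $p\times p$ unitary matrices $\mathbf U_1,\dots,\mathbf U_{n_{\max}}$ all of whose entries have modulus $p^{-1/2}$, via $U_\Bbbk|\mathrm x\rangle=|\mathrm x_{n_j+1}\rangle\otimes\cdots\otimes|\mathrm x_\Bbbk\rangle\otimes\mathbf U_{n_j}|\mathrm x_{n_j}\rangle\otimes\mathbf U_{n_j-1}|\mathrm x_{n_j-1}\rangle\otimes\cdots\otimes\mathbf U_1|\mathrm x_1\rangle$ whenever $[\![\mathrm x]\!]\subseteq I_j$. For $f\in L^2(I)$, $\mathrm{Op}_\Bbbk(f)$ is diagonal in this basis with entry at $|\mathrm x\rangle$ equal to the average of $f$ over $[\![\mathrm x]\!]$. For a normalized eigenvector $\psi_\Bbbk$, $\mu_\Bbbk$ is the probability measure with $\int f\,d\mu_\Bbbk=\langle\psi_\Bbbk,\mathrm{Op}_\Bbbk(f)\psi_\Bbbk\rangle$; a semiclassical measure is a weak-* limit of $(\mu_\Bbbk)$ along a subsequence. $H_{\mathrm{KS}}$ is Kolmogorov–Sinai entropy.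
   Formalization: It is assumed that p^{n_j} times the left endpoint of I_j is an integer for each j; otherwise (e.g. p=2, n=(2,1,2)) the map of Condition 1 is not p^{n_j}x mod 1 and the stated U_k is not unitary. *)

theory Defs
  imports "HOL-Probability.Probability"
begin

definition is_fpart :: "'a measure \<Rightarrow> 'a set set \<Rightarrow> bool" where
  "is_fpart M P \<longleftrightarrow> finite P \<and> P \<subseteq> sets M \<and> disjoint P \<and> \<Union>P = space M"

definition dynref :: "'a measure \<Rightarrow> ('a \<Rightarrow> 'a) \<Rightarrow> 'a set set \<Rightarrow> nat \<Rightarrow> 'a set set" where
  "dynref M T P m = {A. A \<noteq> {} \<and> (\<exists>f. (\<forall>i<m. f i \<in> P) \<and>
                         A = space M \<inter> (\<Inter>i<m. (T ^^ i) -` f i))}"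

definition part_entropy :: "'a measure \<Rightarrow> 'a set set \<Rightarrow> real" where
  "part_entropy M Q = - (\<Sum>A\<in>Q. measure M A * ln (measure M A))"

definition ent_rate :: "'a measure \<Rightarrow> ('a \<Rightarrow> 'a) \<Rightarrow> 'a set set \<Rightarrow> ereal" where
  "ent_rate M T P = limsup (\<lambda>m. ereal (part_entropy M (dynref M T P (Suc m)) / real (Suc m)))"

definition ks_entropy :: "'a measure \<Rightarrow> ('a \<Rightarrow> 'a) \<Rightarrow> ereal" where
  "ks_entropy M T = (SUP P\<in>{P. is_fpart M P}. ent_rate M T P)"

text \<open>Intervals are indexed j = 0..l-1; aL j is the left endpoint of I_j.\<close>
definition aL :: "nat \<Rightarrow> (nat \<Rightarrow> nat) \<Rightarrow> nat \<Rightarrow> real" where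
  "aL p n j = (\<Sum>i<j. 1 / real p ^ n i)"

definition Ipart :: "nat \<Rightarrow> nat \<Rightarrow> (nat \<Rightarrow> nat) \<Rightarrow> nat \<Rightarrow> real set" where
  "Ipart p l n j = (if j = l - 1 then {aL p n j .. 1} else {aL p n j ..< aL p n (Suc j)})"

definition jidx :: "nat \<Rightarrow> nat \<Rightarrow> (nat \<Rightarrow> nat) \<Rightarrow> real \<Rightarrow> nat" where
  "jidx p l n x = (THE j. j < l \<and> x \<in> Ipart p l n j)"

definition Tmap :: "nat \<Rightarrow> nat \<Rightarrow> (nat \<Rightarrow> nat) \<Rightarrow> real \<Rightarrow> real" where
  "Tmap p l n x = frac (real p ^ n (jidx p l n x) * x)"

definition words :: "nat \<Rightarrow> nat \<Rightarrow> nat list set" where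
  "words p k = {w. length w = k \<and> (\<forall>d\<in>set w. d < p)}"

definition cval :: "nat \<Rightarrow> nat list \<Rightarrow> real" where
  "cval p w = (\<Sum>i<length w. real (w ! i) / real p ^ Suc i)"

text \<open>The closed cylinder [[w]]: points whose first |w| base-p digits are w.\<close>
definition cyl :: "nat \<Rightarrow> nat list \<Rightarrow> real set" where
  "cyl p w = {cval p w .. cval p w + 1 / real p ^ length w}"

text \<open>Average of f over [[w]] (the diagonal entry of Op_k(f)).\<close>
definition cavg :: "nat \<Rightarrow> nat list \<Rightarrow> (real \<Rightarrow> real) \<Rightarrow> real" where
  "cavg p w f = real p ^ length w * integral (cyl p w) f"

text \<open>< psi, Op_k(f) psi >\<close>
definition qexp :: "nat \<Rightarrow> nat \<Rightarrow> (nat list \<Rightarrow> complex) \<Rightarrow> (real \<Rightarrow> real) \<Rightarrow> real" where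
  "qexp p k \<psi> f = (\<Sum>w\<in>words p k. (cmod (\<psi> w))\<^sup>2 * cavg p w f)"

definition widx :: "nat \<Rightarrow> nat \<Rightarrow> (nat \<Rightarrow> nat) \<Rightarrow> nat list \<Rightarrow> nat" where
  "widx p l n w = (THE j. j < l \<and> cyl p w \<subseteq> {aL p n j .. aL p n (Suc j)})"

text \<open>Matrices: M i a b is the (a,b) entry (a = row, b = column, 0-based) of the
  p x p matrix U_i, i = 1..n_max.\<close>
definition tensorial_mats :: "nat \<Rightarrow> nat \<Rightarrow> (nat \<Rightarrow> nat \<Rightarrow> nat \<Rightarrow> complex) \<Rightarrow> bool" where
  "tensorial_mats p nmax M \<longleftrightarrow> (\<forall>i\<in>{1..nmax}.
      (\<forall>a<p. \<forall>b<p. cmod (M i a b) = 1 / sqrt (real p)) \<and>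
      (\<forall>a<p. \<forall>b<p. (\<Sum>c<p. cnj (M i c a) * M i c b) = (if a = b then 1 else 0)))"

text \<open>Matrix element <y| U_k |x> of the tensorial quantization, k = length x:
  U_k|x> = |x_{m+1}..x_k> (x) U_m|x_m> (x) ... (x) U_1|x_1>, m = n_j, [[x]] in I_j.\<close>
definition amp :: "nat \<Rightarrow> nat \<Rightarrow> (nat \<Rightarrow> nat) \<Rightarrow> (nat \<Rightarrow> nat \<Rightarrow> nat \<Rightarrow> complex)
                    \<Rightarrow> nat list \<Rightarrow> nat list \<Rightarrow> complex" where
  "amp p l n M y x = (let k = length x; m = n (widx p l n x) in
     if take (k - m) y = drop m x
     then (\<Prod>i<m. M (Suc i) (y ! (k - 1 - i)) (x ! i)) else 0)"

definition Uapply :: "nat \<Rightarrow> nat \<Rightarrow> (nat \<Rightarrow> nat) \<Rightarrow> (nat \<Rightarrow> nat \<Rightarrow> nat \<Rightarrow> complex)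
                    \<Rightarrow> (nat list \<Rightarrow> complex) \<Rightarrow> nat list \<Rightarrow> complex" where
  "Uapply p l n M \<psi> y = (\<Sum>x\<in>words p (length y). amp p l n M y x * \<psi> x)"

definition semiclassical :: "nat \<Rightarrow> (nat \<Rightarrow> nat list \<Rightarrow> complex) \<Rightarrow> real measure \<Rightarrow> bool" where
  "semiclassical p \<psi> \<mu> \<longleftrightarrow> prob_space \<mu> \<and> sets \<mu> = sets (restrict_space borel {0..1::real}) \<and>
     (\<exists>r. strict_mono r \<and> (\<forall>f. continuous_on {0..1} f \<longrightarrow>
          (\<lambda>i. qexp p (r i) (\<psi> (r i)) f) \<longlonglongrightarrow> integral\<^sup>L \<mu> f))"

end

theory Submission
  imports Defs "HOL-Complex_Analysis.Complex_Analysis"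
begin

text \<open>The branch intervals are the cylinders of a complete prefix code, and \<open>T\<close> acts on digit words by
  deleting the first codeword. Let \<open>L x\<close> be the total length of the first \<open>m\<close> codewords of \<open>x\<close> and put
  \<open>\<pi> = |\<psi>|\<^sup>2\<close>. Lift \<open>\<psi>\<close> to the tower over \<open>T\<^sup>m\<close> with roof \<open>L\<close>: there every basis vector loses one
  digit per unit of time, so the \<open>s\<close>-th power of the unitary tower map, with \<open>s\<close> close to \<open>k\<close>, has all
  entries \<open>O(p\<^bsup>-s/2\<^esup>)\<close>. The uncertainty principle yields
  \<open>\<Sum> L \<pi> (- ln \<pi>) \<ge> (s/2) ln p \<Sum> L \<pi> - O(1)\<close>.

  Conversely, for any distribution \<open>q\<close> on codewords, Gibbs' inequality bounds the left side by the
  mean of \<open>L x\<close> times the sum of \<open>- ln q\<close> over the blocks of \<open>x\<close>, and by invariance of \<open>\<pi>\<close> this is at most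
  \<open>s \<Sum> \<pi> (- ln q) + O(1)\<close>. Dividing by \<open>s\<close>, letting \<open>k\<close> tend to infinity and taking for \<open>q\<close> the limiting
  cylinder measures gives \<open>(ln p / 2) \<integral> L d\<mu> \<le> H\<^sub>m(\<mu>)\<close>, and \<open>\<integral> L d\<mu>\<close> is linear in \<open>m\<close>. Passing to the
  weak limit on half-open cells is possible since no mass accumulates at their right endpoints.\<close>

section \<open>The uncertainty principle\<close>

text \<open>The obstacle is that the branches expand at different rates: after a fixed number of
  steps some words have lost far more digits than others, so no single power of the quantization
  brings all words close to the end of their digits at once. The tower measures time in digits
  instead of steps. The price is the weight \<open>L x\<close>, the height of the fibre over
  \<open>x\<close>; it is repaid when block sums are added over all times up to \<open>s\<close>,
  since delaying the time by \<open>L x\<close> leaves \<open>L x\<close> boundary terms.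

  The factor 1/2 is that of the uncertainty principle: the eigenvector is its own image up to a
  phase, so the two entropies occurring there coincide, and entries of size \<open>p\<close> to the
  power \<open>-s/2\<close> yield half of the largest possible rate.

  The argument is run for \<open>T^m\<close> itself, with errors that depend on \<open>m\<close>,
  \<open>p\<close> and \<open>q\<close> but not on \<open>k\<close>. Hence \<open>k\<close> tends to
  infinity for fixed \<open>m\<close>, and the entropy of the refinement of each order
  \<open>m\<close> is bounded separately.\<close>

lemma three_lines:
  fixes F :: "complex \<Rightarrow> complex"
  assumes holo: "F holomorphic_on UNIV"
    and bd: "\<And>z. 0 \<le> Re z \<Longrightarrow> Re z \<le> 1 \<Longrightarrow> cmod (F z) \<le> B"
    and left: "\<And>z. Re z = 0 \<Longrightarrow> cmod (F z) \<le> 1"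
    and right: "\<And>z. Re z = 1 \<Longrightarrow> cmod (F z) \<le> exp b"
    and \<theta>: "0 \<le> \<theta>" "\<theta> \<le> 1"
  shows "cmod (F (of_real \<theta>)) \<le> exp (\<theta> * b)"
proof -
  have B0: "B \<ge> 0" using order_trans[OF norm_ge_zero bd[of 0]] by simp
  \<comment> \<open>Bound on the strip after multiplication by \<open>exp (- (z * b))\<close>, a
    factor of modulus at most \<open>exp |b|\<close>.\<close>
  define B' where "B' = B * exp \<bar>b\<bar>"
  have main: "cmod (F \<theta>) \<le> exp (\<theta> * b) * exp e" if e: "e > 0" for e :: real
  proof -
    \<comment> \<open>The second factor levels the bound on the right edge to 1. The third makes
      \<open>G\<close> decay for large \<open>Im z\<close>, so that a rectangle suffices; its
      \<open>- 1\<close> keeps its modulus at most 1 on the whole strip, and it disappears as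
      \<open>e\<close> tends to 0.\<close>
    define G where "G z = F z * exp (- (z * of_real b)) * exp (of_real e * (z\<^sup>2 - 1))" for z
    have nG: "cmod (G z) = cmod (F z) * exp (- (Re z * b)) * exp (e * ((Re z)\<^sup>2 - (Im z)\<^sup>2 - 1))" for z
      by (simp add: G_def norm_mult norm_exp_eq_Re power2_eq_square)
    \<comment> \<open>Chosen so that \<open>e * R^2\<close> is at least \<open>B'\<close>; with
      \<open>t \<le> exp t\<close> this pushes \<open>G\<close> below 1 on the horizontal
      edges.\<close>
    define R where "R = 1 + B' / e"
    have R1: "R \<ge> 1" using B0 e by (simp add: R_def B'_def)
    have BR: "B' * exp (- e * R\<^sup>2) \<le> 1"
    proof -
      have "B' \<le> e * R" using e by (simp add: R_def field_simps)
      also have "\<dots> \<le> e * R\<^sup>2" using e R1 by (simp add: power2_eq_square)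
      also have "\<dots> \<le> exp (e * R\<^sup>2)" using exp_ge_add_one_self[of "e * R\<^sup>2"] by linarith
      finally show ?thesis by (simp add: exp_minus field_simps)
    qed
    let ?S = "cbox (Complex 0 (-R)) (Complex 1 R)"
    have inS: "z \<in> ?S \<longleftrightarrow> 0 \<le> Re z \<and> Re z \<le> 1 \<and> -R \<le> Im z \<and> Im z \<le> R" for z
      by (simp add: in_cbox_complex_iff)
    have "cmod (G \<theta>) \<le> 1"
    proof (rule maximum_modulus_frontier[of G ?S])
      have hG: "G holomorphic_on UNIV" unfolding G_def using holo by (intro holomorphic_intros)
      then show "G holomorphic_on interior ?S" "continuous_on (closure ?S) G"
        by (auto intro: holomorphic_on_subset holomorphic_on_imp_continuous_on)
      show "bounded ?S" by simp
      show "of_real \<theta> \<in> ?S" using \<theta> R1 by (simp add: inS)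
      fix z assume z: "z \<in> frontier ?S"
      have zS: "z \<in> ?S" using z by (simp add: frontier_def)
      have zb: "z \<notin> box (Complex 0 (-R)) (Complex 1 R)" using z by (simp add: frontier_def interior_cbox)
      then consider "Re z = 0" | "Re z = 1" | "\<bar>Im z\<bar> = R"
        using zS unfolding inS in_box_complex_iff by force
      then show "cmod (G z) \<le> 1"
      proof cases
        case 1
        then have "(Re z)\<^sup>2 - (Im z)\<^sup>2 - 1 \<le> 0" using order_trans[OF _ zero_le_power2[of "Im z"], of "-1"] by simp
        then have "exp (e * ((Re z)\<^sup>2 - (Im z)\<^sup>2 - 1)) \<le> 1" using e by (simp add: mult_nonneg_nonpos)
        then have "cmod (F z) * exp (e * ((Re z)\<^sup>2 - (Im z)\<^sup>2 - 1)) \<le> 1 * 1"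
          using left[OF 1] by (intro mult_mono) auto
        then show ?thesis using 1 by (simp add: nG)
      next
        case 2
        then have a: "exp (e * ((Re z)\<^sup>2 - (Im z)\<^sup>2 - 1)) \<le> 1" using e by simp
        have "cmod (F z) * exp (- (Re z * b)) \<le> exp b * exp (- (Re z * b))"
          using right[OF 2] by (intro mult_right_mono) auto
        also have "\<dots> = 1" using 2 by (simp add: exp_minus)
        finally have "(cmod (F z) * exp (- (Re z * b))) * exp (e * ((Re z)\<^sup>2 - (Im z)\<^sup>2 - 1)) \<le> 1 * 1"
          using a by - (rule mult_mono, auto)
        then show ?thesis by (simp add: nG)
      next
        case 3
        then have I: "(Im z)\<^sup>2 = R\<^sup>2" by (metis power2_abs)
        have "(Re z)\<^sup>2 \<le> 1" using zS by (simp add: inS power_le_one)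
        then have a: "exp (e * ((Re z)\<^sup>2 - (Im z)\<^sup>2 - 1)) \<le> exp (- e * R\<^sup>2)"
          using e I by (simp add: field_simps)
        have b: "\<bar>Re z * b\<bar> \<le> \<bar>b\<bar>"
          using zS unfolding inS abs_mult by (intro mult_left_le_one_le) auto
        have "cmod (F z) * exp (- (Re z * b)) \<le> B * exp \<bar>b\<bar>"
          using bd[of z] zS B0 b unfolding inS by (intro mult_mono) auto
        then have "(cmod (F z) * exp (- (Re z * b))) * exp (e * ((Re z)\<^sup>2 - (Im z)\<^sup>2 - 1)) \<le> B' * exp (- e * R\<^sup>2)"
          using a B0 unfolding B'_def by - (rule mult_mono, auto)
        then show ?thesis using BR by (simp add: nG)
      qed
    qed
    then have h: "cmod (F \<theta>) * exp (- (\<theta> * b)) * exp (e * (\<theta>\<^sup>2 - 1)) \<le> 1" by (simp add: nG)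
    have "cmod (F \<theta>) = (cmod (F \<theta>) * exp (- (\<theta> * b)) * exp (e * (\<theta>\<^sup>2 - 1))) * (exp (\<theta> * b) * exp (e * (1 - \<theta>\<^sup>2)))"
      by (simp add: exp_minus exp_diff right_diff_distrib)
    also have "\<dots> \<le> 1 * (exp (\<theta> * b) * exp (e * (1 - \<theta>\<^sup>2)))" using h by (intro mult_right_mono) auto
    also have "\<dots> \<le> exp (\<theta> * b) * exp e" using e by simp
    finally show ?thesis .
  qed
  have "((\<lambda>e. exp (\<theta> * b) * exp e) \<longlongrightarrow> exp (\<theta> * b) * exp 0) (at_right 0)"
    by (intro tendsto_intros)
  then have "cmod (F \<theta>) \<le> exp (\<theta> * b) * exp 0"
    by (rule tendsto_lowerbound) (auto simp: eventually_at_right_less eventually_at_filter main)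
  then show ?thesis by simp
qed

section \<open>Isometric matrices on a finite index set\<close>

definition mapp :: "'a set \<Rightarrow> ('a \<Rightarrow> 'a \<Rightarrow> complex) \<Rightarrow> ('a \<Rightarrow> complex) \<Rightarrow> 'a \<Rightarrow> complex" where
  "mapp A V u b = (\<Sum>a\<in>A. V b a * u a)"

definition mcomp :: "'a set \<Rightarrow> ('a \<Rightarrow> 'a \<Rightarrow> complex) \<Rightarrow> ('a \<Rightarrow> 'a \<Rightarrow> complex) \<Rightarrow> 'a \<Rightarrow> 'a \<Rightarrow> complex" where
  "mcomp A V W b a = mapp A V (\<lambda>c. W c a) b"

definition miso :: "'a set \<Rightarrow> ('a \<Rightarrow> 'a \<Rightarrow> complex) \<Rightarrow> bool" where
  "miso A V \<longleftrightarrow> (\<forall>a\<in>A. \<forall>a'\<in>A. (\<Sum>b\<in>A. cnj (V b a) * V b a') = (if a = a' then 1 else 0))"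

lemma mapp_mcomp: "mapp A (mcomp A V W) u b = mapp A V (mapp A W u) b"
  unfolding mapp_def mcomp_def sum_distrib_left sum_distrib_right
  by (subst sum.swap) (simp add: mult.assoc)

lemma mapp_cong: "(\<And>a. a \<in> A \<Longrightarrow> u a = v a) \<Longrightarrow> mapp A V u b = mapp A V v b"
  unfolding mapp_def by (intro sum.cong) auto

lemma miso_inner:
  assumes "finite A" "miso A V"
  shows "(\<Sum>b\<in>A. cnj (mapp A V u b) * mapp A V v b) = (\<Sum>a\<in>A. cnj (u a) * v a)"
proof -
  have "(\<Sum>b\<in>A. cnj (mapp A V u b) * mapp A V v b)
      = (\<Sum>b\<in>A. \<Sum>a\<in>A. \<Sum>a'\<in>A. cnj (u a) * v a' * (cnj (V b a) * V b a'))"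
    unfolding mapp_def cnj_sum sum_product
    by (intro sum.cong refl) (simp add: mult_ac)
  also have "\<dots> = (\<Sum>a\<in>A. \<Sum>b\<in>A. \<Sum>a'\<in>A. cnj (u a) * v a' * (cnj (V b a) * V b a'))"
    by (rule sum.swap)
  also have "\<dots> = (\<Sum>a\<in>A. \<Sum>a'\<in>A. \<Sum>b\<in>A. cnj (u a) * v a' * (cnj (V b a) * V b a'))"
    by (intro sum.cong refl sum.swap)
  also have "\<dots> = (\<Sum>a\<in>A. \<Sum>a'\<in>A. cnj (u a) * v a' * (if a = a' then 1 else 0))"
    using assms(2) unfolding miso_def sum_distrib_left[symmetric]
    by (intro sum.cong refl) auto
  also have "\<dots> = (\<Sum>a\<in>A. cnj (u a) * v a)"
    using assms(1) by (simp add: if_distrib sum.If_cases mult_ac cong: if_cong)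
  finally show ?thesis .
qed

lemma miso_mcomp:
  assumes "finite A" "miso A V" "miso A W"
  shows "miso A (mcomp A V W)"
  using miso_inner[OF assms(1,2)] assms(3) unfolding miso_def mcomp_def by simp

lemma cmod_sq: "complex_of_real ((cmod z)\<^sup>2) = cnj z * z"
  by (metis complex_norm_square mult.commute of_real_power)

lemma miso_norm:
  assumes "finite A" "miso A V"
  shows "(\<Sum>b\<in>A. (cmod (mapp A V u b))\<^sup>2) = (\<Sum>a\<in>A. (cmod (u a))\<^sup>2)"
proof -
  have "complex_of_real (\<Sum>b\<in>A. (cmod (mapp A V u b))\<^sup>2) = of_real (\<Sum>a\<in>A. (cmod (u a))\<^sup>2)"
    unfolding of_real_sum cmod_sq by (rule miso_inner[OF assms])
  then show ?thesis by (simp only: of_real_eq_iff)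
qed

lemma cauchy_schwarz_complex:
  fixes u v :: "'a \<Rightarrow> complex"
  shows "cmod (\<Sum>a\<in>A. cnj (u a) * v a) \<le> sqrt (\<Sum>a\<in>A. (cmod (u a))\<^sup>2) * sqrt (\<Sum>a\<in>A. (cmod (v a))\<^sup>2)"
proof -
  have "cmod (\<Sum>a\<in>A. cnj (u a) * v a) \<le> (\<Sum>a\<in>A. \<bar>cmod (u a)\<bar> * \<bar>cmod (v a)\<bar>)"
    by (rule sum_norm_le) (simp add: norm_mult)
  also have "\<dots> \<le> L2_set (\<lambda>a. cmod (u a)) A * L2_set (\<lambda>a. cmod (v a)) A"
    by (rule L2_set_mult_ineq)
  finally show ?thesis by (simp add: L2_set_def)
qed

text \<open>The Maassen--Uffink entropic uncertainty principle for a fixed vector: the three lines theorem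
  interpolates between the contraction bound on \<open>l\<^sup>2\<close> and the bound from \<open>l\<^sup>1\<close> to \<open>l\<^sup>\<infinity>\<close>, and the entropy
  appears as the derivative at the former.\<close>
lemma entropic_uncertainty:
  fixes \<phi> :: "'a \<Rightarrow> complex"
  assumes fin: "finite A" and iso: "miso A V"
    and fixed: "\<And>b. b \<in> A \<Longrightarrow> mapp A V \<phi> b = \<phi> b"
    and norm1: "(\<Sum>a\<in>A. (cmod (\<phi> a))\<^sup>2) = 1"
    and bound: "\<And>a b. a \<in> A \<Longrightarrow> b \<in> A \<Longrightarrow> cmod (V b a) \<le> exp b0"
  shows "(\<Sum>a\<in>A. (cmod (\<phi> a))\<^sup>2 * ln ((cmod (\<phi> a))\<^sup>2)) \<le> b0"
proof -
  define h where "h a = ln (cmod (\<phi> a))" for a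
  \<comment> \<open>This is \<open>\<phi>\<close> times \<open>|\<phi>|\<close> to the power
    \<open>z\<close>, of modulus \<open>|\<phi>|\<close> to the power \<open>1 + Re z\<close>: a
    unit vector of l2 for \<open>Re z = 0\<close> and of l1 for \<open>Re z = 1\<close>. Zeros of
    \<open>\<phi>\<close> stay zeros, where the logarithm has no meaning.\<close>
  define u where "u z a = (if \<phi> a = 0 then 0 else \<phi> a * exp (z * of_real (h a)))" for z a
  \<comment> \<open>The conjugation inside \<open>u\<close> undoes the one outside, which leaves a
    function holomorphic in \<open>z\<close>.\<close>
  define F where "F z = (\<Sum>b\<in>A. cnj (u (cnj z) b) * mapp A V (u z) b)" for z
  have nu: "cmod (u z a) = (if \<phi> a = 0 then 0 else cmod (\<phi> a) * exp (Re z * h a))" for z a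
    by (simp add: u_def norm_mult norm_exp_eq_Re)
  have nu0: "cmod (u z a) = cmod (\<phi> a)" if "Re z = 0" for z a
    using that by (simp add: nu)
  have nu1: "cmod (u z a) = (cmod (\<phi> a))\<^sup>2" if "Re z = 1" for z a
    using that by (simp add: nu h_def power2_eq_square)
  have Fexp: "F z = (\<Sum>b\<in>A. \<Sum>a\<in>A. if \<phi> a = 0 \<or> \<phi> b = 0 then 0 else
       cnj (\<phi> b) * V b a * \<phi> a * exp (z * (of_real (h a + h b))))" for z
    unfolding F_def mapp_def sum_distrib_left
    by (intro sum.cong refl) (auto simp: u_def exp_cnj exp_add distrib_left)
  have holF: "F holomorphic_on UNIV"
    unfolding Fexp
  proof (intro holomorphic_on_sum)
    fix a b
    show "(\<lambda>z. if \<phi> a = 0 \<or> \<phi> b = 0 then 0 else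
       cnj (\<phi> b) * V b a * \<phi> a * exp (z * (of_real (h a + h b)))) holomorphic_on UNIV"
      by (cases "\<phi> a = 0 \<or> \<phi> b = 0") (auto intro!: holomorphic_intros)
  qed
  have cA: "cmod (\<phi> a) \<le> 1" if "a \<in> A" for a
  proof -
    have "(cmod (\<phi> a))\<^sup>2 \<le> 1" using member_le_sum[OF that, of "\<lambda>a. (cmod (\<phi> a))\<^sup>2"] fin norm1 by auto
    then show ?thesis by (simp add: power2_le_imp_le abs_square_le_1)
  qed
  have h0: "h a \<le> 0" if "a \<in> A" "\<phi> a \<noteq> 0" for a using cA[OF that(1)] that by (simp add: h_def)
  have F01: "cmod (F z) \<le> (\<Sum>b\<in>A. \<Sum>a\<in>A. cmod (V b a))" if "0 \<le> Re z" for z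
  proof -
    have *: "cmod (cnj (\<phi> b) * V b a * \<phi> a * exp (z * (of_real (h a + h b)))) \<le> cmod (V b a)"
      if "a \<in> A" "b \<in> A" "\<phi> a \<noteq> 0" "\<phi> b \<noteq> 0" for a b
    proof -
      have "Re z * (h a + h b) \<le> 0" using h0[OF that(1,3)] h0[OF that(2,4)] \<open>0 \<le> Re z\<close> by (simp add: mult_nonneg_nonpos)
      then have e: "exp (Re z * (h a + h b)) \<le> 1" by simp
      have "cmod (\<phi> b) * cmod (V b a) * cmod (\<phi> a) * exp (Re z * (h a + h b)) \<le> 1 * cmod (V b a) * 1 * 1"
        using e cA that by (intro mult_mono) auto
      then show ?thesis by (simp add: norm_mult norm_exp_eq_Re)
    qed
    show ?thesis unfolding Fexp
      by (intro sum_norm_le) (use * in auto)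
  qed
  have Fl: "cmod (F z) \<le> 1" if "Re z = 0" for z
  proof -
    have "cmod (F z) \<le> sqrt (\<Sum>b\<in>A. (cmod (u (cnj z) b))\<^sup>2) * sqrt (\<Sum>b\<in>A. (cmod (mapp A V (u z) b))\<^sup>2)"
      unfolding F_def by (rule cauchy_schwarz_complex)
    also have "\<dots> = 1" using that by (simp add: miso_norm[OF fin iso] nu0 norm1)
    finally show ?thesis .
  qed
  have Fr: "cmod (F z) \<le> exp b0" if z: "Re z = 1" for z
  proof -
    have m: "cmod (mapp A V (u z) b) \<le> exp b0" if "b \<in> A" for b
    proof -
      have "cmod (mapp A V (u z) b) \<le> (\<Sum>a\<in>A. exp b0 * (cmod (\<phi> a))\<^sup>2)"
        unfolding mapp_def using bound that z by (intro sum_norm_le) (auto simp: norm_mult nu1 intro!: mult_right_mono)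
      also have "\<dots> = exp b0" by (simp add: sum_distrib_left[symmetric] norm1)
      finally show ?thesis .
    qed
    have "cmod (F z) \<le> (\<Sum>b\<in>A. (cmod (\<phi> b))\<^sup>2 * exp b0)"
      unfolding F_def using m z by (intro sum_norm_le) (auto simp: norm_mult nu1 intro!: mult_left_mono)
    also have "\<dots> = exp b0" by (simp add: sum_distrib_right[symmetric] norm1)
    finally show ?thesis .
  qed
  have Fth: "Re (F (of_real t)) \<le> exp (t * b0)" if "0 \<le> t" "t \<le> 1" for t
    using three_lines[OF holF F01 Fl Fr that] complex_Re_le_cmod[of "F (of_real t)"] by linarith
  have u0: "u 0 a = \<phi> a" for a by (simp add: u_def)
  have F0: "F 0 = 1"
  proof -
    have "F 0 = (\<Sum>b\<in>A. of_real ((cmod (\<phi> b))\<^sup>2))"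
      unfolding F_def cmod_sq complex_cnj_zero u0
      using fixed by (intro sum.cong refl) (auto simp: u0 mapp_def)
    then show ?thesis using norm1 by (metis of_real_1 of_real_sum)
  qed
  define D where "D = (\<Sum>b\<in>A. \<Sum>a\<in>A. cnj (\<phi> b) * V b a * \<phi> a * of_real (h a + h b))"
  have dF: "(F has_field_derivative D) (at 0)"
    unfolding Fexp D_def
  proof (intro DERIV_sum)
    fix b a
    show "((\<lambda>z. if \<phi> a = 0 \<or> \<phi> b = 0 then 0 else
       cnj (\<phi> b) * V b a * \<phi> a * exp (z * (of_real (h a + h b)))) has_field_derivative
       cnj (\<phi> b) * V b a * \<phi> a * of_real (h a + h b)) (at 0)"
      by (cases "\<phi> a = 0 \<or> \<phi> b = 0") (auto intro!: derivative_eq_intros)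
  qed
  have dR: "((\<lambda>t. Re (F (of_real t))) has_real_derivative Re D) (at 0)"
  proof -
    have "((\<lambda>x. F (of_real x)) has_vector_derivative D) (at 0)"
      by (rule has_vector_derivative_real_field) (use dF in simp)
    then have "((\<lambda>x. Re (F (of_real x))) has_vector_derivative Re D) (at 0)"
      by (rule bounded_linear.has_vector_derivative[OF bounded_linear_Re])
    then show ?thesis by (simp add: has_real_derivative_iff_has_vector_derivative)
  qed
  \<comment> \<open>At \<open>t = 0\<close> both \<open>Re (F t)\<close> and the bound
    \<open>exp (t * b0)\<close> equal 1, so a larger slope of \<open>F\<close> would break the bound
    for small \<open>t > 0\<close>.\<close>
  have "Re D \<le> b0"
  proof (rule ccontr)
    assume "\<not> Re D \<le> b0"
    then have pos: "0 < Re D - b0" by simp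
    have "((\<lambda>t. exp (t * b0)) has_real_derivative b0) (at 0)"
      by (auto intro!: derivative_eq_intros)
    from DERIV_pos_inc_right[OF DERIV_diff[OF dR this] pos] obtain d where
      d: "d > 0" "\<And>t. t > 0 \<Longrightarrow> t < d \<Longrightarrow> Re (F (of_real 0)) - exp (0 * b0) < Re (F (of_real (0 + t))) - exp ((0+t) * b0)"
      by auto
    define t where "t = min 1 (d/2)"
    have "0 < t" "t < d" "t \<le> 1" using d(1) by (auto simp: t_def)
    then show False using d(2)[of t] Fth[of t] F0 by simp
  qed
  \<comment> \<open>The derivative falls on either factor of the inner product. One part is
    evaluated by \<open>V \<phi> = \<phi>\<close>, the other by inserting \<open>V\<close> in front
    of the first factor as well and cancelling it. Each gives the sum of
    \<open>|\<phi>|^2 ln |\<phi>|\<close>, and the two together make minus the entropy.\<close>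
  moreover have "D = of_real (\<Sum>a\<in>A. (cmod (\<phi> a))\<^sup>2 * ln ((cmod (\<phi> a))\<^sup>2))"
  proof -
    have D1: "(\<Sum>b\<in>A. cnj (\<phi> b) * of_real (h b) * mapp A V \<phi> b) = (\<Sum>b\<in>A. of_real ((cmod (\<phi> b))\<^sup>2 * h b))"
      using fixed by (intro sum.cong refl) (simp add: cmod_sq del: of_real_power)
    have "(\<Sum>b\<in>A. cnj (\<phi> b) * mapp A V (\<lambda>a. \<phi> a * h a) b) = (\<Sum>b\<in>A. cnj (mapp A V \<phi> b) * mapp A V (\<lambda>a. \<phi> a * h a) b)"
      using fixed by (intro sum.cong refl) simp
    also have "\<dots> = (\<Sum>b\<in>A. cnj (\<phi> b) * (\<phi> b * h b))" by (rule miso_inner[OF fin iso])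
    also have "\<dots> = (\<Sum>b\<in>A. of_real ((cmod (\<phi> b))\<^sup>2 * h b))"
      by (intro sum.cong refl) (simp add: cmod_sq del: of_real_power)
    finally have D2: "(\<Sum>b\<in>A. cnj (\<phi> b) * mapp A V (\<lambda>a. \<phi> a * h a) b) = (\<Sum>b\<in>A. of_real ((cmod (\<phi> b))\<^sup>2 * h b))" .
    have "D = (\<Sum>b\<in>A. cnj (\<phi> b) * mapp A V (\<lambda>a. \<phi> a * h a) b) + (\<Sum>b\<in>A. cnj (\<phi> b) * of_real (h b) * mapp A V \<phi> b)"
      unfolding D_def mapp_def sum_distrib_left sum.distrib[symmetric]
      by (intro sum.cong refl) (simp add: algebra_simps)
    also have "\<dots> = (\<Sum>b\<in>A. of_real ((cmod (\<phi> b))\<^sup>2 * ln ((cmod (\<phi> b))\<^sup>2)))"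
      unfolding D1 D2 sum.distrib[symmetric]
    proof (intro sum.cong refl)
      fix b
      have "(cmod (\<phi> b))\<^sup>2 * h b + (cmod (\<phi> b))\<^sup>2 * h b = (cmod (\<phi> b))\<^sup>2 * ln ((cmod (\<phi> b))\<^sup>2)"
        by (cases "\<phi> b = 0") (auto simp: h_def ln_realpow)
      then show "complex_of_real ((cmod (\<phi> b))\<^sup>2 * h b) + complex_of_real ((cmod (\<phi> b))\<^sup>2 * h b)
          = complex_of_real ((cmod (\<phi> b))\<^sup>2 * ln ((cmod (\<phi> b))\<^sup>2))"
        by (metis of_real_add)
    qed
    finally show ?thesis by simp
  qed
  ultimately show ?thesis by simp
qed

section \<open>Words and base-p expansions\<close>

lemma words_iff: "w \<in> words p k \<longleftrightarrow> length w = k \<and> set w \<subseteq> {..<p}"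
  by (auto simp: words_def)

lemma finite_words: "finite (words p k)"
proof -
  have "words p k = {w. set w \<subseteq> {..<p} \<and> length w = k}" by (auto simp: words_iff)
  then show ?thesis by (simp add: finite_lists_length_eq)
qed

lemma card_words: "card (words p k) = p ^ k"
proof -
  have "words p k = {w. set w \<subseteq> {..<p} \<and> length w = k}" by (auto simp: words_iff)
  then show ?thesis by (simp add: card_lists_length_eq)
qed

lemma words_0: "words p 0 = {[]}"
  by (auto simp: words_iff)

lemma sum_words_append:
  assumes "d \<le> k"
  shows "(\<Sum>x\<in>words p k. f x) = (\<Sum>u\<in>words p d. \<Sum>v\<in>words p (k - d). f (u @ v))"
proof -
  have "(\<Sum>u\<in>words p d. \<Sum>v\<in>words p (k - d). f (u @ v)) = (\<Sum>(u,v)\<in>words p d \<times> words p (k - d). f (u @ v))"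
    by (simp add: sum.cartesian_product finite_words)
  also have "\<dots> = (\<Sum>x\<in>words p k. f x)"
    by (rule sum.reindex_bij_witness[of _ "\<lambda>x. (take d x, drop d x)" "\<lambda>(u,v). u @ v"])
       (use assms in \<open>auto simp: words_iff dest!: in_set_takeD in_set_dropD\<close>)
  finally show ?thesis by simp
qed

lemma sum_words_Suc: "(\<Sum>x\<in>words p (Suc k). f x) = (\<Sum>c<p. \<Sum>v\<in>words p k. f (c # v))"
proof -
  have "(\<Sum>u\<in>words p 1. \<Sum>v\<in>words p k. f (u @ v)) = (\<Sum>c<p. \<Sum>v\<in>words p k. f (c # v))"
    by (rule sum.reindex_bij_witness[of _ "\<lambda>c. [c]" hd]) (auto simp: words_iff length_Suc_conv)
  then show ?thesis using sum_words_append[of 1 "Suc k" f p] by simp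
qed

text \<open>Each digit is summed independently; this turns inner products of tensor product vectors
  into products over the positions.\<close>

lemma sum_words_prod:
  fixes h :: "nat \<Rightarrow> nat \<Rightarrow> complex"
  shows "(\<Sum>y\<in>words p k. \<Prod>i<k. h i (y ! i)) = (\<Prod>i<k. \<Sum>c<p. h i c)"
proof (induction k arbitrary: h)
  case 0
  then show ?case by (simp add: words_0)
next
  case (Suc k)
  have "(\<Sum>y\<in>words p (Suc k). \<Prod>i<Suc k. h i (y ! i)) = (\<Sum>c<p. \<Sum>v\<in>words p k. h 0 c * (\<Prod>i<k. h (Suc i) (v ! i)))"
    by (simp add: sum_words_Suc prod.lessThan_Suc_shift del: prod.lessThan_Suc)
  also have "\<dots> = (\<Sum>c<p. h 0 c) * (\<Prod>i<k. \<Sum>c<p. h (Suc i) c)"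
    by (simp add: sum_distrib_left[symmetric] sum_distrib_right[symmetric] Suc.IH[of "\<lambda>i. h (Suc i)"])
  also have "\<dots> = (\<Prod>i<Suc k. \<Sum>c<p. h i c)" by (simp add: prod.lessThan_Suc_shift del: prod.lessThan_Suc)
  finally show ?case .
qed

section \<open>Left endpoints of cylinders\<close>

lemma cval_Nil [simp]: "cval p [] = 0" by (simp add: cval_def)

lemma sum_lessThan_add_split:
  fixes f :: "nat \<Rightarrow> real"
  shows "(\<Sum>i<m + k. f i) = (\<Sum>i<m. f i) + (\<Sum>i<k. f (m + i))"
  by (induction k) auto

lemma cval_append: "cval p (u @ v) = cval p u + cval p v / real p ^ length u"
proof -
  have "cval p (u @ v) = (\<Sum>i<length u + length v. real ((u @ v) ! i) / real p ^ Suc i)"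
    by (simp add: cval_def)
  also have "\<dots> = (\<Sum>i<length u. real ((u @ v) ! i) / real p ^ Suc i)
      + (\<Sum>i<length v. real ((u @ v) ! (length u + i)) / real p ^ Suc (length u + i))"
    by (rule sum_lessThan_add_split)
  also have "\<dots> = cval p u + cval p v / real p ^ length u"
    by (simp add: cval_def nth_append sum_divide_distrib power_add mult_ac)
  finally show ?thesis .
qed

lemma cval_Cons: "cval p (c # v) = (real c + cval p v) / real p"
  using cval_append[of p "[c]" v] by (simp add: cval_def add_divide_distrib)

lemma cval_nonneg: "0 \<le> cval p w"
  by (simp add: cval_def sum_nonneg)

lemma cval_le:
  assumes "p \<ge> 2" "set w \<subseteq> {..<p}"
  shows "cval p w + 1 / real p ^ length w \<le> 1"
  using assms(2)
proof (induction w)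
  case (Cons c w)
  then have "real c + 1 \<le> real p" by auto
  moreover have "cval p w + 1 / real p ^ length w \<le> 1" using Cons by simp
  moreover have "cval p (c # w) + 1 / real p ^ length (c # w) = (real c + (cval p w + 1 / real p ^ length w)) / real p"
    using assms(1) by (simp add: cval_Cons field_simps)
  ultimately show ?case using assms(1) by (simp add: divide_le_eq)
qed simp

lemma cval_lt_1:
  assumes "p \<ge> 2" "set w \<subseteq> {..<p}"
  shows "cval p w < 1"
proof -
  have "1 / real p ^ length w > 0" using assms(1) by simp
  with cval_le[OF assms] show ?thesis by linarith
qed

text \<open>Nesting of the cylinder of \<open>w\<close> in that of its prefix, one inequality for
  each endpoint; this is \<open>cval_le\<close> for the remaining digits, scaled down.\<close>

lemma cval_lt_next:
  assumes "p \<ge> 2" "set w \<subseteq> {..<p}" "d \<le> length w"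
  shows "cval p (take d w) \<le> cval p w"
    and "cval p w + 1 / real p ^ length w \<le> cval p (take d w) + 1 / real p ^ d"
proof -
  have w: "w = take d w @ drop d w" by simp
  have c: "cval p w = cval p (take d w) + cval p (drop d w) / real p ^ d"
    by (subst w, subst cval_append) (use assms(3) in simp)
  show "cval p (take d w) \<le> cval p w" using assms(1) by (simp add: c cval_nonneg)
  have "set (drop d w) \<subseteq> {..<p}" using assms(2) set_drop_subset by fast
  from cval_le[OF assms(1) this]
  have "(cval p (drop d w) + 1 / real p ^ (length w - d)) / real p ^ d \<le> 1 / real p ^ d"
    using assms(1) by (intro divide_right_mono) auto
  then show "cval p w + 1 / real p ^ length w \<le> cval p (take d w) + 1 / real p ^ d"
    using assms(3) by (simp add: c add_divide_distrib power_add[symmetric])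
qed

lemma cval_nat: "p \<ge> 1 \<Longrightarrow> \<exists>a::nat. cval p w * real p ^ length w = real a"
proof (induction w)
  case (Cons c w)
  then obtain a where "cval p w * real p ^ length w = real a" by auto
  then have "cval p (c # w) * real p ^ length (c # w) = real (c * p ^ length w + a)"
    using Cons(2) by (simp add: cval_Cons field_simps)
  then show ?case by blast
qed simp

lemma words_cval:
  assumes "p \<ge> 2" "a < p ^ k"
  shows "\<exists>w\<in>words p k. cval p w = real a / real p ^ k"
  using assms(2)
proof (induction k arbitrary: a)
  case 0
  then show ?case by (simp add: words_0)
next
  case (Suc k)
  have "a div p ^ k < p" using Suc.prems by (simp add: less_mult_imp_div_less mult.commute)
  moreover have "a mod p ^ k < p ^ k" using assms(1) by simp
  then obtain w where w: "w \<in> words p k" "cval p w = real (a mod p ^ k) / real p ^ k"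
    using Suc.IH by blast
  moreover have "real a = real (a div p ^ k) * real p ^ k + real (a mod p ^ k)"
    by (metis div_mult_mod_eq of_nat_add of_nat_mult of_nat_power)
  then have "cval p ((a div p ^ k) # w) = real a / real p ^ Suc k"
    using assms(1) w(2) by (simp add: cval_Cons field_simps)
  ultimately show ?case
    by (intro bexI[of _ "(a div p ^ k) # w"]) (auto simp: words_iff)
qed

text \<open>The first differing digit decides the order, since all later digits move an endpoint by
  at most one unit of that digit. Distinct cylinders of equal length therefore share at most an
  endpoint.\<close>

lemma cval_distinct:
  assumes "p \<ge> 2" "length u = length v" "set u \<subseteq> {..<p}" "set v \<subseteq> {..<p}" "u \<noteq> v"
  shows "cval p u + 1 / real p ^ length u \<le> cval p v \<or> cval p v + 1 / real p ^ length u \<le> cval p u"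
  using assms(2-)
proof (induction u v rule: list_induct2)
  case (Cons c u e v)
  show ?case
  proof (cases "c = e")
    case True
    then have "cval p u + 1 / real p ^ length u \<le> cval p v \<or> cval p v + 1 / real p ^ length u \<le> cval p u"
      using Cons by simp
    then have "(real e + (cval p u + 1 / real p ^ length u)) / real p \<le> (real e + cval p v) / real p
      \<or> (real e + (cval p v + 1 / real p ^ length u)) / real p \<le> (real e + cval p u) / real p"
      using assms(1) by (simp add: divide_le_cancel)
    then show ?thesis using True assms(1) by (simp add: cval_Cons add_divide_distrib mult.commute)
  next
    case False
    have *: "cval p (c # u) + 1 / real p ^ length (c # u) \<le> cval p (e # v)"
      if "c < e" "set u \<subseteq> {..<p}" for c e :: nat and u v :: "nat list"
    proof -
      have "real c + 1 \<le> real e" using that by simp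
      then have "(real c + (cval p u + 1 / real p ^ length u)) / real p \<le> (real e + cval p v) / real p"
        using cval_le[OF assms(1) that(2)] cval_nonneg[of p v] assms(1) by (intro divide_right_mono) auto
      then show ?thesis by (simp add: cval_Cons add_divide_distrib mult.commute)
    qed
    from False consider "c < e" | "e < c" by linarith
    then show ?thesis
    proof cases
      case 1
      then show ?thesis using *[of c e u v] Cons by simp
    next
      case 2
      then show ?thesis using *[of e c v u] Cons by simp
    qed
  qed
qed simp

lemma cval_replicate:
  assumes "p \<ge> 2"
  shows "cval p (replicate R (p - 1)) + 1 / real p ^ R = 1"
  using assms by (induction R) (auto simp: cval_Cons field_simps of_nat_diff)

text \<open>Every cylinder but the last stops one full cylinder short of 1. This room keeps closed
  cylinders away from the excluded right end of a half-open cell.\<close>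

lemma cval_le_not_top:
  assumes "p \<ge> 2" "set w \<subseteq> {..<p}" "w \<noteq> replicate (length w) (p - 1)"
  shows "cval p w + 1 / real p ^ length w \<le> 1 - 1 / real p ^ length w"
proof -
  have "cval p w + 1 / real p ^ length w \<le> cval p (replicate (length w) (p - 1))
     \<or> cval p (replicate (length w) (p - 1)) + 1 / real p ^ length w \<le> cval p w"
    using assms by (intro cval_distinct) auto
  then show ?thesis using cval_replicate[OF assms(1), of "length w"] cval_lt_1[OF assms(1,2)] by linarith
qed

section \<open>Prefix codes\<close>

text \<open>Words long enough to show their first codeword completely; a length function is
  constrained on these only.\<close>

definition words_ge :: "nat \<Rightarrow> nat \<Rightarrow> nat list set" where
  "words_ge p M = {w. M \<le> length w \<and> set w \<subseteq> {..<p}}"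

lemma words_geI: "w \<in> words p k \<Longrightarrow> M \<le> k \<Longrightarrow> w \<in> words_ge p M"
  by (simp add: words_iff words_ge_def)

text \<open>Birkhoff sum of \<open>G\<close> along the deletion of first codewords, over the blocks
  that begin before position \<open>s\<close>. Truncated subtraction lets the last block overrun
  \<open>s\<close>; the test \<open>L x = 0\<close> secures termination.\<close>

function blocksum :: "(nat list \<Rightarrow> nat) \<Rightarrow> (nat list \<Rightarrow> real) \<Rightarrow> nat \<Rightarrow> nat list \<Rightarrow> real" where
  "blocksum L G s x = (if s = 0 \<or> L x = 0 then 0 else G x + blocksum L G (s - L x) (drop (L x) x))"
  by auto
termination by (relation "Wellfounded.measure (\<lambda>(L, G, s, x). s)") auto

declare blocksum.simps [simp del]

lemma blocksum_0 [simp]: "blocksum L G 0 x = 0"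
  by (simp add: blocksum.simps)

text \<open>\<open>L x\<close> is the length of the first codeword of the digit word \<open>x\<close>, for a complete prefix code
  with codewords of length at most \<open>M\<close>.\<close>
locale prefix_code =
  fixes p M :: nat and L :: "nat list \<Rightarrow> nat"
  assumes p2: "2 \<le> p"
    and L_pos: "x \<in> words_ge p M \<Longrightarrow> 1 \<le> L x"
    and L_le: "x \<in> words_ge p M \<Longrightarrow> L x \<le> M"
    and L_prefix: "x \<in> words_ge p M \<Longrightarrow> y \<in> words_ge p M \<Longrightarrow> take (L x) x = take (L x) y \<Longrightarrow> L y = L x"
begin

definition cw :: "nat list \<Rightarrow> nat list" where "cw x = take (L x) x"
definition sh :: "nat list \<Rightarrow> nat list" where "sh x = drop (L x) x"
definition C :: "nat list set" where "C = cw ` words p M"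

text \<open>A codeword fits into \<open>M\<close> digits, so by the prefix property a truncation to
  at least \<open>M\<close> digits cannot change it.\<close>

lemma L_take:
  assumes "x \<in> words_ge p M" "M \<le> d"
  shows "take d x \<in> words_ge p M" "L (take d x) = L x" "cw (take d x) = cw x"
proof -
  show t: "take d x \<in> words_ge p M" using assms by (auto simp: words_ge_def dest: in_set_takeD)
  show "L (take d x) = L x" using L_prefix[OF assms(1) t] L_le[OF assms(1)] assms(2) by (simp add: min_absorb1)
  then show "cw (take d x) = cw x" using L_le[OF assms(1)] assms(2) by (simp add: cw_def min_absorb1)
qed

lemma L_cong:
  assumes "x \<in> words_ge p M" "y \<in> words_ge p M" "M \<le> d" "take d x = take d y"
  shows "L x = L y" "cw x = cw y"
  using L_take[OF assms(1,3)] L_take[OF assms(2,3)] assms(4) by auto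

lemma length_cw: "x \<in> words_ge p M \<Longrightarrow> length (cw x) = L x"
  using L_le[of x] by (auto simp: cw_def words_ge_def)

lemma cw_sh: "cw x @ sh x = x" by (simp add: cw_def sh_def)

lemma length_sh: "length (sh x) = length x - L x" by (simp add: sh_def)

lemma set_sh: "set x \<subseteq> {..<p} \<Longrightarrow> set (sh x) \<subseteq> {..<p}"
  unfolding sh_def using set_drop_subset by fast

lemma cw_in_C: "x \<in> words_ge p M \<Longrightarrow> cw x \<in> C"
  unfolding C_def using L_take(3)[of x M]
  by (intro image_eqI[of _ _ "take M x"]) (auto simp: words_ge_def words_iff dest: in_set_takeD)

lemma finite_C: "finite C" by (simp add: C_def finite_words)

lemma C_nonempty: "C \<noteq> {}"
proof -
  have "replicate M 0 \<in> words p M" using p2 by (auto simp: words_iff)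
  then show ?thesis by (auto simp: C_def)
qed

lemma C_D:
  assumes "c \<in> C"
  shows "1 \<le> length c" "length c \<le> M" "set c \<subseteq> {..<p}"
proof -
  obtain x where x: "x \<in> words p M" "c = cw x" using assms by (auto simp: C_def)
  then have w: "x \<in> words_ge p M" by (simp add: words_geI)
  show "1 \<le> length c" "length c \<le> M" using w L_pos L_le by (auto simp: x(2) length_cw)
  show "set c \<subseteq> {..<p}" using x by (auto simp: cw_def words_iff dest: in_set_takeD)
qed

lemma cw_eq_iff:
  assumes "c \<in> C" "y \<in> words_ge p M"
  shows "cw y = c \<longleftrightarrow> take (length c) y = c"
proof
  assume "cw y = c"
  then show "take (length c) y = c" using length_cw[OF assms(2)] by (auto simp: cw_def)
next
  assume t: "take (length c) y = c"
  obtain x where x: "x \<in> words p M" "c = cw x" using assms(1) by (auto simp: C_def)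
  then have w: "x \<in> words_ge p M" by (simp add: words_geI)
  have "L y = L x" using t length_cw[OF w] x by (intro L_prefix[OF w assms(2)]) (simp add: cw_def)
  then show "cw y = c" using t length_cw[OF w] x by (simp add: cw_def)
qed

lemma C_prefix_free:
  assumes "c \<in> C" "e \<in> C" "take (length c) e = c"
  shows "c = e"
proof -
  obtain x where x: "x \<in> words p M" "e = cw x" using assms(2) by (auto simp: C_def)
  then have w: "x \<in> words_ge p M" by (simp add: words_geI)
  have "length c \<le> length e" using assms(3) by (metis length_take min.cobounded1)
  then have "take (length c) x = c" using assms(3) x(2) length_cw[OF w] by (simp add: cw_def min_absorb1)
  then show ?thesis using cw_eq_iff[OF assms(1) w] x by simp
qed

lemma sum_words_code:
  assumes "M \<le> k"
  shows "(\<Sum>x\<in>words p k. f x) = (\<Sum>c\<in>C. \<Sum>r\<in>words p (k - length c). f (c @ r))"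
proof -
  have "(\<Sum>c\<in>C. \<Sum>r\<in>words p (k - length c). f (c @ r)) = (\<Sum>(c,r)\<in>Sigma C (\<lambda>c. words p (k - length c)). f (c @ r))"
    by (simp add: sum.Sigma finite_C finite_words)
  also have "\<dots> = (\<Sum>x\<in>words p k. f x)"
  proof (rule sum.reindex_bij_witness[of _ "\<lambda>x. (cw x, sh x)" "\<lambda>(c,r). c @ r"])
    fix x assume x: "x \<in> words p k"
    then have w: "x \<in> words_ge p M" using assms by (simp add: words_geI)
    show "(cw x, sh x) \<in> Sigma C (\<lambda>c. words p (k - length c))"
      using x set_sh[of x] cw_in_C[OF w] by (simp add: words_iff length_cw[OF w] length_sh)
    show "(case (cw x, sh x) of (c, r) \<Rightarrow> c @ r) = x" by (simp add: cw_sh)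
  next
    fix a assume a: "a \<in> Sigma C (\<lambda>c. words p (k - length c))"
    obtain c r where cr: "a = (c, r)" "c \<in> C" "r \<in> words p (k - length c)" using a by auto
    have m: "c @ r \<in> words p k" using cr C_D[OF cr(2)] assms by (auto simp: words_iff)
    then have w: "c @ r \<in> words_ge p M" using assms by (simp add: words_geI)
    have "cw (c @ r) = c" using cw_eq_iff[OF cr(2) w] by simp
    then show "(cw (case a of (c, r) \<Rightarrow> c @ r), sh (case a of (c, r) \<Rightarrow> c @ r)) = a"
      using cr cw_sh[of "c @ r"] by simp
    show "(case a of (c, r) \<Rightarrow> c @ r) \<in> words p k" using m cr by simp
    show "f (case a of (c, r) \<Rightarrow> c @ r) = (case a of (c, r) \<Rightarrow> f (c @ r))" using cr by simp
  qed
  finally show ?thesis by simp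
qed

lemma blocksum_step:
  assumes "x \<in> words_ge p M" "s > 0"
  shows "blocksum L G s x = G x + blocksum L G (s - L x) (sh x)"
  using assms L_pos[OF assms(1)] by (subst blocksum.simps) (auto simp: sh_def)

lemma blocksum_mono:
  assumes "\<And>x. 0 \<le> G x" "s \<le> t"
  shows "blocksum L G s x \<le> blocksum L G t x"
proof -
  have nn: "0 \<le> blocksum L G t x" for t x
  proof (induction t arbitrary: x rule: less_induct)
    case (less t)
    then show ?case using assms(1)[of x] by (subst blocksum.simps) (auto intro!: add_nonneg_nonneg)
  qed
  show ?thesis using assms(2)
  proof (induction s arbitrary: t x rule: less_induct)
    case (less s)
    show ?case
    proof (cases "s = 0 \<or> L x = 0")
      case True
      then have "blocksum L G s x = 0" by (subst blocksum.simps) auto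
      then show ?thesis using nn by simp
    next
      case False
      then show ?thesis using less.IH[of "s - L x" "t - L x" "drop (L x) x"] less.prems
        by (subst (1 2) blocksum.simps) auto
    qed
  qed
qed

text \<open>The summand is the weight of the blocks of \<open>x\<close> when blocks are independent
  with weights \<open>exp (- g c)\<close>. By the Kraft inequality these weights sum to at most 1
  over the block sequences that cover \<open>s\<close> digits, and at most \<open>k - s\<close>
  digits are left free.\<close>

lemma sum_exp_blocksum:
  assumes kraft: "(\<Sum>c\<in>C. exp (- g c)) \<le> 1" and "s + M \<le> k"
  shows "(\<Sum>x\<in>words p k. exp (- blocksum L (\<lambda>x. g (cw x)) s x)) \<le> real p ^ (k - s)"
  using assms(2)
proof (induction s arbitrary: k rule: less_induct)
  case (less s)
  let ?B = "blocksum L (\<lambda>x. g (cw x))"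
  show ?case
  proof (cases "s = 0")
    case True
    then show ?thesis by (simp add: card_words)
  next
    case False
    have inner: "(\<Sum>r\<in>words p (k - length c). exp (- ?B s (c @ r))) \<le> exp (- g c) * real p ^ (k - s)"
      if c: "c \<in> C" for c
    proof -
      have c1: "1 \<le> length c" "length c \<le> M" using C_D[OF c] by auto
      have eq: "exp (- ?B s (c @ r)) = exp (- g c) * exp (- ?B (s - length c) r)" if r: "r \<in> words p (k - length c)" for r
      proof -
        have m: "c @ r \<in> words p k" using r C_D[OF c] less.prems by (auto simp: words_iff)
        then have w: "c @ r \<in> words_ge p M" using less.prems by (simp add: words_geI)
        have cc: "cw (c @ r) = c" using cw_eq_iff[OF c w] by simp
        have "L (c @ r) = length c" using length_cw[OF w] cc by simp
        moreover have "sh (c @ r) = r" using cw_sh[of "c @ r"] cc by simp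
        ultimately show ?thesis
          using blocksum_step[OF w, of s] False cc by (simp add: exp_add[symmetric])
      qed
      have "(\<Sum>r\<in>words p (k - length c). exp (- ?B (s - length c) r)) \<le> real p ^ (k - s)"
      proof (cases "length c \<le> s")
        case True
        have "(\<Sum>r\<in>words p (k - length c). exp (- ?B (s - length c) r)) \<le> real p ^ (k - length c - (s - length c))"
          using True c1 False less.prems by (intro less.IH) auto
        then show ?thesis using True by simp
      next
        \<comment> \<open>Here the block overruns \<open>s\<close>, and the sum merely counts the
          digits after it, of which there are fewer than \<open>k - s\<close>.\<close>
        case False
        then have "(\<Sum>r\<in>words p (k - length c). exp (- ?B (s - length c) r)) = real p ^ (k - length c)"
          by (simp add: card_words)
        also have "\<dots> \<le> real p ^ (k - s)" using False p2 by (intro power_increasing) auto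
        finally show ?thesis .
      qed
      then show ?thesis by (simp add: eq sum_distrib_left[symmetric])
    qed
    have "(\<Sum>x\<in>words p k. exp (- ?B s x)) = (\<Sum>c\<in>C. \<Sum>r\<in>words p (k - length c). exp (- ?B s (c @ r)))"
      using less.prems by (intro sum_words_code) simp
    also have "\<dots> \<le> (\<Sum>c\<in>C. exp (- g c) * real p ^ (k - s))" by (intro sum_mono inner)
    also have "\<dots> = (\<Sum>c\<in>C. exp (- g c)) * real p ^ (k - s)" by (simp add: sum_distrib_right)
    also have "\<dots> \<le> 1 * real p ^ (k - s)" by (intro mult_right_mono kraft) simp
    finally show ?thesis by simp
  qed
qed

text \<open>Every block that counts begins before position \<open>s\<close> and has at most
  \<open>M\<close> digits.\<close>

lemma blocksum_local:
  assumes "s + M \<le> length x" "s + M \<le> length y" "set x \<subseteq> {..<p}" "set y \<subseteq> {..<p}"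
    "take (s + M) x = take (s + M) y"
  shows "blocksum L (\<lambda>x. g (cw x)) s x = blocksum L (\<lambda>x. g (cw x)) s y"
  using assms
proof (induction s arbitrary: x y rule: less_induct)
  case (less s)
  show ?case
  proof (cases "s = 0")
    case False
    have x: "x \<in> words_ge p M" and y: "y \<in> words_ge p M" using less.prems by (auto simp: words_ge_def)
    have Lc: "L x = L y" "cw x = cw y" using L_cong[OF x y _ less.prems(5)] by auto
    have "blocksum L (\<lambda>x. g (cw x)) (s - L x) (sh x) = blocksum L (\<lambda>x. g (cw x)) (s - L x) (sh y)"
    proof (cases "L x \<le> s")
      case True
      have "take (s - L x + M) (sh x) = drop (L x) (take (s + M) x)"
        using True by (simp add: sh_def take_drop)
      also have "\<dots> = take (s - L x + M) (sh y)"
        using True less.prems(5) by (simp add: Lc sh_def take_drop)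
      finally show ?thesis using True False L_pos[OF x] less.prems set_sh Lc
        by (intro less.IH) (auto simp: length_sh)
    qed simp
    then show ?thesis using False by (simp add: blocksum_step[OF x] blocksum_step[OF y] Lc)
  qed simp
qed

text \<open>Each shift inspects and deletes at most \<open>M\<close> digits, so \<open>i\<close>
  shifts bring only \<open>i * M\<close> further digits into view.\<close>

lemma sh_iter_local:
  assumes "set x \<subseteq> {..<p}" "set y \<subseteq> {..<p}" "r + i * M \<le> length x" "r + i * M \<le> length y"
    "take (r + i * M) x = take (r + i * M) y"
  shows "take r ((sh ^^ i) x) = take r ((sh ^^ i) y)"
  using assms
proof (induction i arbitrary: x y)
  case (Suc i)
  have x: "x \<in> words_ge p M" and y: "y \<in> words_ge p M" using Suc.prems by (auto simp: words_ge_def)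
  have Lc: "L x = L y" using L_cong(1)[OF x y _ Suc.prems(5)] by simp
  have LM: "L x \<le> M" by (rule L_le[OF x])
  have d: "take (r + i * M) (sh z) = take (r + i * M) (drop (L z) (take (r + Suc i * M) z))" if "L z \<le> M" for z
    using that by (simp add: sh_def take_drop min_absorb1)
  have "take (r + i * M) (sh x) = take (r + i * M) (sh y)"
    using LM Lc Suc.prems(5) by (simp add: d)
  then have "take r ((sh ^^ i) (sh x)) = take r ((sh ^^ i) (sh y))"
    using Suc.prems LM Lc set_sh[of x] set_sh[of y] by (intro Suc.IH) (auto simp: length_sh)
  then show ?case by (simp add: funpow_swap1)
qed simp

text \<open>The codeword of the last branch: its cylinder ends at 1, so its cell will be
  closed.\<close>

definition top :: "nat list" where "top = cw (replicate M (p - 1))"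

lemma replicate_top_ge: "replicate M (p - 1) \<in> words_ge p M"
  using p2 by (auto simp: words_ge_def)

lemma cw_top:
  assumes "x \<in> words_ge p M" "take M x = replicate M (p - 1)"
  shows "cw x = top"
  unfolding top_def using assms replicate_top_ge by (intro L_cong(2)[of _ _ M]) auto

text \<open>Whatever the codewords are, a shift consumes at most \<open>M\<close> digits of the
  run.\<close>

lemma sh_iter_top:
  assumes "set x \<subseteq> {..<p}" "length x \<ge> a" "a \<ge> t * M" "take a x = replicate a (p - 1)"
  shows "take (a - t * M) ((sh ^^ t) x) = replicate (a - t * M) (p - 1) \<and> set ((sh ^^ t) x) \<subseteq> {..<p}
     \<and> length ((sh ^^ t) x) \<ge> a - t * M"
  using assms(3)
proof (induction t)
  case 0
  then show ?case using assms by simp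
next
  case (Suc t)
  let ?y = "(sh ^^ t) x"
  have t: "a \<ge> t * M" and M: "a - t * M \<ge> M" using Suc.prems by auto
  have y: "take (a - t * M) ?y = replicate (a - t * M) (p - 1)" "set ?y \<subseteq> {..<p}" "length ?y \<ge> a - t * M"
    using Suc.IH[OF t] by auto
  then have w: "?y \<in> words_ge p M" using M by (auto simp: words_ge_def)
  note l = L_le[OF w]
  have "take (a - Suc t * M) (sh ?y) = take (a - Suc t * M) (drop (L ?y) (take (a - t * M) ?y))"
    using l M by (simp add: sh_def take_drop min_absorb1)
  also have "\<dots> = replicate (a - Suc t * M) (p - 1)" using l M by (simp add: y(1))
  finally show ?case using y(2,3) set_sh[of ?y] l by (auto simp: length_sh)
qed

end

section \<open>Quantized codes and the tower\<close>

fun mpow :: "'a set \<Rightarrow> ('a \<Rightarrow> 'a \<Rightarrow> complex) \<Rightarrow> nat \<Rightarrow> 'a \<Rightarrow> 'a \<Rightarrow> complex" where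
  "mpow A V 0 = (\<lambda>b a. if b = a then 1 else 0)"
| "mpow A V (Suc s) = mcomp A V (mpow A V s)"

lemma miso_mpow:
  assumes "finite A" "miso A V"
  shows "miso A (mpow A V s)"
proof (induction s)
  case 0
  show ?case using assms(1)
    by (auto simp: miso_def if_distrib[of cnj] if_distrib[of "\<lambda>x. x * _"] if_distrib[of "(*) _"] cong: if_cong)
next
  case (Suc s)
  then show ?case by (simp add: miso_mcomp[OF assms])
qed

lemma mapp_mpow_fixed:
  assumes "finite A" "\<And>b. b \<in> A \<Longrightarrow> mapp A V \<phi> b = \<phi> b" "b \<in> A"
  shows "mapp A (mpow A V s) \<phi> b = \<phi> b"
  using assms(3)
proof (induction s arbitrary: b)
  case 0
  then show ?case using assms(1) by (simp add: mapp_def if_distrib[of "\<lambda>x. x * _"] cong: if_cong)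
next
  case (Suc s)
  then show ?case using mapp_cong[of A "mapp A (mpow A V s) \<phi>" \<phi> V b] assms(2)[OF Suc.prems] by (simp add: mapp_mcomp)
qed

text \<open>Absence of interference: with at most one nonzero term, a bound on the terms passes to
  the sum without a factor \<open>card A\<close>.\<close>

lemma cmod_sum_single:
  fixes f :: "'a \<Rightarrow> complex"
  assumes "finite A" "0 \<le> B" "\<And>a. a \<in> A \<Longrightarrow> cmod (f a) \<le> B"
    and uniq: "\<And>a a'. a \<in> A \<Longrightarrow> a' \<in> A \<Longrightarrow> f a \<noteq> 0 \<Longrightarrow> f a' \<noteq> 0 \<Longrightarrow> a = a'"
  shows "cmod (sum f A) \<le> B"
proof (cases "\<exists>a\<in>A. f a \<noteq> 0")
  case True
  then obtain a where a: "a \<in> A" "f a \<noteq> 0" by auto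
  then have "sum f A = sum f {a}" using assms(1) uniq by (intro sum.mono_neutral_right) auto
  then show ?thesis using assms(3)[OF a(1)] by simp
next
  case False
  then show ?thesis using assms(2) by simp
qed

text \<open>The difference telescopes to the last \<open>l\<close> values, each at least
  \<open>b (s - l)\<close> by monotonicity; \<open>b 0 = 0\<close> makes truncated subtraction
  harmless for \<open>l > s\<close>. With \<open>l\<close> a codeword length, this is the source of
  the weight \<open>L x\<close>.\<close>

lemma sum_shift_ge:
  fixes b :: "nat \<Rightarrow> real"
  assumes "mono b" "b 0 = 0"
  shows "real l * b (s - l) \<le> (\<Sum>u=1..s. b u) - (\<Sum>u=1..s. b (u - l))"
proof (induction l)
  case (Suc l)
  have tel: "(\<Sum>u=1..s. b (u - l) - b (u - Suc l)) = b (s - l)"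
  proof (induction s)
    case (Suc s)
    have "(\<Sum>u=1..Suc s. b (u - l) - b (u - Suc l)) = b (s - l) + (b (Suc s - l) - b (s - l))"
      using Suc by simp
    then show ?case by simp
  qed (simp add: assms(2))
  have "b (s - Suc l) \<le> b (s - l)" by (rule monoD[OF assms(1)]) simp
  then have "real l * b (s - Suc l) \<le> real l * b (s - l)" by (intro mult_left_mono) auto
  with \<open>b (s - Suc l) \<le> b (s - l)\<close> have "real (Suc l) * b (s - Suc l) \<le> real l * b (s - l) + b (s - l)"
    by (simp add: distrib_right)
  then show ?case using Suc tel by (simp add: sum_subtractf)
qed (simp)

text \<open>What the argument retains of a quantization of \<open>T^m\<close>: the kernel deletes
  the first codeword, spreads the amplitude evenly over the new last digits, and is unitary. These
  properties are stable under composition, which gives access to \<open>T^m\<close>. The eigenvalue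
  is absorbed into \<open>K\<close>, so that \<open>\<psi>\<close> is a fixed vector.\<close>

locale quantized_code = prefix_code +
  fixes k :: nat and K :: "nat list \<Rightarrow> nat list \<Rightarrow> complex" and \<psi> :: "nat list \<Rightarrow> complex"
  assumes Mk: "M \<le> k"
    and K_supp: "x \<in> words p k \<Longrightarrow> y \<in> words p k \<Longrightarrow> K y x \<noteq> 0 \<Longrightarrow> take (k - L x) y = drop (L x) x"
    and K_bound: "x \<in> words p k \<Longrightarrow> y \<in> words p k \<Longrightarrow> cmod (K y x) \<le> (1 / sqrt p) ^ L x"
    and K_iso: "miso (words p k) K"
    and fixed: "y \<in> words p k \<Longrightarrow> mapp (words p k) K \<psi> y = \<psi> y"
    and norm1: "(\<Sum>x\<in>words p k. (cmod (\<psi> x))\<^sup>2) = 1"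
begin

definition prb :: "nat list \<Rightarrow> real" where "prb x = (cmod (\<psi> x))\<^sup>2"

lemma prb_nonneg [simp]: "0 \<le> prb x" by (simp add: prb_def)

lemma w_ge: "x \<in> words p k \<Longrightarrow> x \<in> words_ge p M" by (rule words_geI[OF _ Mk])

lemma prb_sum: "(\<Sum>x\<in>words p k. prb x) = 1" using norm1 by (simp add: prb_def)

text \<open>Exact Egorov property: \<open>|\<psi>|\<^sup>2\<close> is invariant on observables that do not see the last \<open>M\<close> digits.\<close>
lemma invariance:
  assumes f: "\<And>x y. x \<in> words p k \<Longrightarrow> y \<in> words p k \<Longrightarrow> take (k - L x) y = sh x \<Longrightarrow> f y = f (sh x)"
  shows "(\<Sum>x\<in>words p k. f (sh x) * prb x) = (\<Sum>x\<in>words p k. f x * prb x)"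
proof -
  let ?W = "words p k"
  \<comment> \<open>The support of \<open>K\<close> makes multiplication by \<open>f\<close> after
    \<open>K\<close> the same as multiplication by \<open>f \<circ> sh\<close> before it; the
    isometry of \<open>K\<close> turns this into an identity of expectations.\<close>
  have ap: "of_real (f y) * \<psi> y = mapp ?W K (\<lambda>x. of_real (f (sh x)) * \<psi> x) y" if y: "y \<in> ?W" for y
  proof -
    have "of_real (f y) * \<psi> y = of_real (f y) * mapp ?W K \<psi> y" using fixed[OF y] by simp
    also have "\<dots> = mapp ?W K (\<lambda>x. of_real (f (sh x)) * \<psi> x) y"
      unfolding mapp_def sum_distrib_left
    proof (intro sum.cong refl)
      fix x assume x: "x \<in> ?W"
      show "of_real (f y) * (K y x * \<psi> x) = K y x * (of_real (f (sh x)) * \<psi> x)"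
        using K_supp[OF x y] f[OF x y] by (cases "K y x = 0") (auto simp: sh_def)
    qed
    finally show ?thesis .
  qed
  have "complex_of_real (\<Sum>x\<in>?W. f x * prb x) = (\<Sum>y\<in>?W. cnj (\<psi> y) * (of_real (f y) * \<psi> y))"
    unfolding prb_def of_real_sum of_real_mult cmod_sq by (intro sum.cong refl) simp
  also have "\<dots> = (\<Sum>y\<in>?W. cnj (mapp ?W K \<psi> y) * mapp ?W K (\<lambda>x. of_real (f (sh x)) * \<psi> x) y)"
    using ap fixed by (intro sum.cong refl) auto
  also have "\<dots> = (\<Sum>x\<in>?W. cnj (\<psi> x) * (of_real (f (sh x)) * \<psi> x))"
    by (rule miso_inner[OF finite_words K_iso])
  also have "\<dots> = complex_of_real (\<Sum>x\<in>?W. f (sh x) * prb x)"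
    unfolding prb_def of_real_sum of_real_mult cmod_sq by (intro sum.cong refl) simp
  finally show ?thesis by (simp only: of_real_eq_iff)
qed

text \<open>The tower (suspension) over the code: the point \<open>(x, i)\<close> waits on the levels \<open>i < L x\<close> before
  \<open>K\<close> acts. All its basis vectors lose digits at unit speed, so its powers have uniformly small entries.\<close>
definition tower :: "(nat list \<times> nat) set" where
  "tower = Sigma (words p k) (\<lambda>x. {..<L x})"

definition W :: "nat list \<times> nat \<Rightarrow> nat list \<times> nat \<Rightarrow> complex" where
  "W b a = (if Suc (snd a) = L (fst a) then (if snd b = 0 then K (fst b) (fst a) else 0)
            else if fst b = fst a \<and> snd b = Suc (snd a) then 1 else 0)"

lemma finite_tower: "finite tower" by (simp add: tower_def finite_words)

lemma sum_tower: "(\<Sum>a\<in>tower. f a) = (\<Sum>x\<in>words p k. \<Sum>i<L x. f (x, i))"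
  unfolding tower_def by (subst sum.Sigma) (auto simp: finite_words)

lemma W_iso: "miso tower W"
  unfolding miso_def
proof (intro ballI)
  fix a a' assume a: "a \<in> tower" and a': "a' \<in> tower"
  obtain x i x' i' where xi: "a = (x, i)" "a' = (x', i')" by (cases a, cases a')
  have x: "x \<in> words p k" "i < L x" "x' \<in> words p k" "i' < L x'" using a a' xi by (auto simp: tower_def)
  consider (tt) "Suc i = L x" "Suc i' = L x'" | (tn) "Suc i = L x" "Suc i' \<noteq> L x'"
    | (nt) "Suc i \<noteq> L x" "Suc i' = L x'" | (nn) "Suc i \<noteq> L x" "Suc i' \<noteq> L x'" by auto
  then show "(\<Sum>b\<in>tower. cnj (W b a) * W b a') = (if a = a' then 1 else 0)"
  proof cases
    \<comment> \<open>Both columns live on level 0, which exists over every \<open>y\<close> because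
      \<open>L y \<ge> 1\<close>; this leaves the isometry of \<open>K\<close>.\<close>
    case tt
    have "(\<Sum>b\<in>tower. cnj (W b a) * W b a') = (\<Sum>y\<in>words p k. \<Sum>j<L y. if j = 0 then cnj (K y x) * K y x' else 0)"
      unfolding sum_tower using tt by (intro sum.cong refl) (simp add: W_def xi)
    also have "\<dots> = (\<Sum>y\<in>words p k. cnj (K y x) * K y x')"
      using L_pos[OF w_ge] by (intro sum.cong refl) (auto simp: Suc_le_eq)
    also have "\<dots> = (if x = x' then 1 else 0)" using K_iso x by (simp add: miso_def)
    also have "\<dots> = (if a = a' then 1 else 0)" using tt xi by auto
    finally show ?thesis .
  next
    case tn
    then have "a \<noteq> a'" using xi by auto
    moreover have "(\<Sum>b\<in>tower. cnj (W b a) * W b a') = 0"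
      using tn by (intro sum.neutral ballI) (auto simp: W_def xi)
    ultimately show ?thesis by simp
  next
    case nt
    then have "a \<noteq> a'" using xi by auto
    moreover have "(\<Sum>b\<in>tower. cnj (W b a) * W b a') = 0"
      using nt by (intro sum.neutral ballI) (auto simp: W_def xi)
    ultimately show ?thesis by simp
  next
    case nn
    have "(\<Sum>b\<in>tower. cnj (W b a) * W b a') = (\<Sum>b\<in>tower. if b = (x, Suc i) then (if a = a' then 1 else 0) else 0)"
      using nn by (intro sum.cong refl) (auto simp: W_def xi)
    moreover have "(x, Suc i) \<in> tower" using nn x by (auto simp: tower_def)
    ultimately show ?thesis using finite_tower by simp
  qed
qed

text \<open>The lift is constant along fibres, so climbing preserves it, and the return to level 0
  is the fixed point equation for \<open>K\<close>. The scalar \<open>c\<close> leaves room for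
  normalizing the lift.\<close>

lemma W_fixed:
  assumes "b \<in> tower"
  shows "mapp tower W (\<lambda>a. c * \<psi> (fst a)) b = c * \<psi> (fst b)"
proof -
  obtain y j where b: "b = (y, j)" "y \<in> words p k" "j < L y" using assms by (auto simp: tower_def)
  show ?thesis
  proof (cases j)
    case 0
    have "mapp tower W (\<lambda>a. c * \<psi> (fst a)) b = (\<Sum>x\<in>words p k. \<Sum>i<L x. if i = L x - 1 then K y x * (c * \<psi> x) else 0)"
      unfolding mapp_def sum_tower using 0
      by (intro sum.cong refl) (auto simp: W_def b)
    also have "\<dots> = (\<Sum>x\<in>words p k. K y x * (c * \<psi> x))"
      using L_pos[OF w_ge] by (intro sum.cong refl) (auto simp: Suc_le_eq)
    also have "\<dots> = c * mapp (words p k) K \<psi> y" by (simp add: mapp_def sum_distrib_left mult_ac)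
    finally show ?thesis using fixed b by simp
  next
    case (Suc i)
    have m: "(y, i) \<in> tower" using b Suc by (auto simp: tower_def)
    have "mapp tower W (\<lambda>a. c * \<psi> (fst a)) b = (\<Sum>a\<in>tower. if a = (y, i) then c * \<psi> y else 0)"
      unfolding mapp_def using Suc b
      by (intro sum.cong refl) (auto simp: W_def prod_eq_iff)
    then show ?thesis using m finite_tower b by simp
  qed
qed

text \<open>\<open>N\<close> is the number of digits deleted and \<open>j\<close> the level reached.
  Both are determined by the starting point as long as \<open>M\<close> digits of \<open>x\<close>
  survive, which the bound on \<open>s\<close> ensures. Each deleted digit costs a factor
  \<open>1 / sqrt p\<close>, and \<open>N + j = s + i\<close> ties their number to the elapsed
  time.\<close>

lemma mpow_W_bound:
  assumes "x \<in> words p k" "i < L x" "s + i + M \<le> k"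
  shows "\<exists>N j. N + j = s + i \<and> j < L (drop N x) \<and>
    (\<forall>b\<in>tower. cmod (mpow tower W s b (x, i)) \<le> (1 / sqrt p) ^ N \<and>
      (mpow tower W s b (x, i) \<noteq> 0 \<longrightarrow> snd b = j \<and> take (k - N) (fst b) = drop N x))"
  using assms(3)
proof (induction s)
  case 0
  then show ?case using assms by (intro exI[of _ 0] exI[of _ i]) (auto simp: words_iff tower_def)
next
  case (Suc s)
  have "s + i + M \<le> k" using Suc.prems by simp
  from Suc.IH[OF this] obtain N j where Nj: "N + j = s + i" "j < L (drop N x)"
    and bs: "\<forall>b\<in>tower. cmod (mpow tower W s b (x, i)) \<le> (1 / sqrt p) ^ N \<and>
      (mpow tower W s b (x, i) \<noteq> 0 \<longrightarrow> snd b = j \<and> take (k - N) (fst b) = drop N x)"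
    by blast
  have bd: "cmod (mpow tower W s b (x, i)) \<le> (1 / sqrt p) ^ N" if "b \<in> tower" for b
    using bs that by blast
  have supp: "snd b = j \<and> take (k - N) (fst b) = drop N x"
    if "b \<in> tower" "mpow tower W s b (x, i) \<noteq> 0" for b
    using bs that by blast
  have lx: "length x = k" "set x \<subseteq> {..<p}" using assms(1) by (auto simp: words_iff)
  have NM: "Suc N + M \<le> k" using Nj Suc.prems by simp
  define r where "r = 1 / sqrt (real p)"
  have r0: "0 \<le> r" by (simp add: r_def)
  let ?x = "drop N x"
  have dw: "drop n x \<in> words_ge p M" if "n + M \<le> k" for n
    using that lx by (auto simp: words_ge_def dest: in_set_dropD)
  \<comment> \<open>By \<open>NM\<close> the current word still begins with at least
    \<open>M\<close> digits of \<open>x\<close>, so its codeword can be read off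
    \<open>x\<close>.\<close>
  have Ltow: "L (fst a) = L ?x \<and> cw (fst a) = cw ?x"
    if "a \<in> tower" "take (k - N) (fst a) = ?x" for a
  proof -
    have "fst a \<in> words_ge p M" using that(1) w_ge by (auto simp: tower_def)
    then show ?thesis using L_take[of "fst a" "k - N"] that(2) NM by simp
  qed
  have Lx: "L ?x \<le> M" using L_le[OF dw] NM by simp
  show ?case
  proof (cases "Suc j = L ?x")
    case False
    have W1: "b = (fst a, Suc j)" if "a \<in> tower" "mpow tower W s a (x, i) \<noteq> 0" "W b a \<noteq> 0" for a b
      using supp[OF that(1,2)] Ltow[OF that(1)] that(3) False
      by (auto simp: W_def prod_eq_iff split: if_splits)
    have Wb: "cmod (W b a) \<le> 1" if "a \<in> tower" "mpow tower W s a (x, i) \<noteq> 0" for a b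
      using supp[OF that(1,2)] Ltow[OF that(1)] False by (auto simp: W_def)
    have "cmod (mpow tower W (Suc s) b (x, i)) \<le> r ^ N" if b: "b \<in> tower" for b
      unfolding mpow.simps mcomp_def mapp_def
    proof (rule cmod_sum_single[OF finite_tower])
      show "0 \<le> r ^ N" using r0 by simp
      fix a assume a: "a \<in> tower"
      show "cmod (W b a * mpow tower W s a (x, i)) \<le> r ^ N"
      proof (cases "mpow tower W s a (x, i) = 0")
        case False
        have "cmod (W b a * mpow tower W s a (x, i)) \<le> 1 * r ^ N"
          unfolding norm_mult using Wb[OF a False] bd[OF a] by (intro mult_mono) (auto simp: r_def)
        then show ?thesis by simp
      qed (use r0 in simp)
      fix a' assume a': "a' \<in> tower" and n: "W b a * mpow tower W s a (x, i) \<noteq> 0" "W b a' * mpow tower W s a' (x, i) \<noteq> 0"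
      have "b = (fst a, Suc j)" "snd a = j" using W1[OF a, of b] supp[OF a] n by auto
      moreover have "b = (fst a', Suc j)" "snd a' = j" using W1[OF a', of b] supp[OF a'] n by auto
      ultimately show "a = a'" by (simp add: prod_eq_iff)
    qed
    moreover have "snd b = Suc j \<and> take (k - N) (fst b) = ?x"
      if b: "b \<in> tower" "mpow tower W (Suc s) b (x, i) \<noteq> 0" for b
    proof -
      obtain a where a: "a \<in> tower" "W b a * mpow tower W s a (x, i) \<noteq> 0"
        using b(2) unfolding mpow.simps mcomp_def mapp_def by (meson sum.neutral)
      then have "b = (fst a, Suc j)" "take (k - N) (fst a) = ?x" using W1[OF a(1), of b] supp[OF a(1)] by auto
      then show ?thesis by simp
    qed
    ultimately show ?thesis using Nj False by (intro exI[of _ N] exI[of _ "Suc j"]) (auto simp: r_def)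
  next
    case True
    define N' where "N' = N + L ?x"
    have N': "N' = Suc (s + i)" using Nj True by (simp add: N'_def)
    \<comment> \<open>The landing point together with the known codeword of \<open>drop N x\<close>
      recovers the predecessor, so only one path contributes to the new entry.\<close>
    have n0: "mpow tower W s a (x, i) \<noteq> 0 \<Longrightarrow> W b a \<noteq> 0 \<Longrightarrow> a \<in> tower \<Longrightarrow> b \<in> tower \<Longrightarrow>
       snd b = 0 \<and> W b a = K (fst b) (fst a) \<and> a = (cw ?x @ take (k - L ?x) (fst b), j) \<and>
       take (k - N') (fst b) = drop N' x" for a b
    proof -
      assume as: "mpow tower W s a (x, i) \<noteq> 0" "W b a \<noteq> 0" "a \<in> tower" "b \<in> tower"
      have s1: "snd a = j" "take (k - N) (fst a) = ?x" using supp[OF as(3,1)] by auto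
      have L1: "L (fst a) = L ?x" "cw (fst a) = cw ?x" using Ltow[OF as(3) s1(2)] by auto
      have W1: "snd b = 0" "W b a = K (fst b) (fst a)" using as(2) s1 L1 True by (auto simp: W_def split: if_splits)
      have fw: "fst a \<in> words p k" "fst b \<in> words p k" using as by (auto simp: tower_def)
      have Ks: "take (k - L ?x) (fst b) = sh (fst a)" using K_supp[OF fw] W1 as(2) L1 by (simp add: sh_def)
      have e1: "fst a = cw ?x @ take (k - L ?x) (fst b)" using cw_sh[of "fst a"] L1 Ks by simp
      have "take (k - N') (fst b) = take (k - N') (take (k - L ?x) (fst b))" by (simp add: N'_def min_absorb1)
      also have "\<dots> = drop (L ?x) (take (k - N) (fst a))" unfolding Ks by (simp add: sh_def L1 N'_def drop_take diff_diff_left)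
      also have "\<dots> = drop N' x" by (simp add: s1 N'_def add.commute)
      finally show "snd b = 0 \<and> W b a = K (fst b) (fst a) \<and> a = (cw ?x @ take (k - L ?x) (fst b), j) \<and>
         take (k - N') (fst b) = drop N' x" using W1 e1 s1 by (auto simp: prod_eq_iff)
    qed
    have "cmod (mpow tower W (Suc s) b (x, i)) \<le> r ^ N'" if b: "b \<in> tower" for b
      unfolding mpow.simps mcomp_def mapp_def
    proof (rule cmod_sum_single[OF finite_tower])
      show "0 \<le> r ^ N'" using r0 by simp
      fix a assume a: "a \<in> tower"
      show "cmod (W b a * mpow tower W s a (x, i)) \<le> r ^ N'"
      proof (cases "W b a * mpow tower W s a (x, i) = 0")
        case False
        then have nz: "mpow tower W s a (x, i) \<noteq> 0" "W b a \<noteq> 0" by auto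
        have Lf: "L (fst a) = L ?x" using Ltow[OF a] supp[OF a nz(1)] by simp
        have fw: "fst a \<in> words p k" "fst b \<in> words p k" using a b by (auto simp: tower_def)
        have "W b a = K (fst b) (fst a)" using n0[OF nz a b] by blast
        then have Wb: "cmod (W b a) \<le> r ^ L ?x" using K_bound[OF fw] by (simp only: Lf r_def)
        have "cmod (W b a) * cmod (mpow tower W s a (x, i)) \<le> r ^ L ?x * r ^ N"
          by (rule mult_mono[OF Wb bd[OF a, folded r_def]]) (simp_all add: r_def)
        then show ?thesis by (simp add: norm_mult N'_def power_add mult.commute)
      next
        case True
        show ?thesis unfolding True using r0 by simp
      qed
      fix a' assume a': "a' \<in> tower" and n: "W b a * mpow tower W s a (x, i) \<noteq> 0" "W b a' * mpow tower W s a' (x, i) \<noteq> 0"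
      have nz: "mpow tower W s a (x, i) \<noteq> 0" "W b a \<noteq> 0" "mpow tower W s a' (x, i) \<noteq> 0" "W b a' \<noteq> 0"
        using n mult_not_zero by blast+
      have "a = (cw ?x @ take (k - L ?x) (fst b), j)" using n0[OF nz(1,2) a b] by simp
      moreover have "a' = (cw ?x @ take (k - L ?x) (fst b), j)" using n0[OF nz(3,4) a' b] by simp
      ultimately show "a = a'" by simp
    qed
    moreover have "snd b = 0 \<and> take (k - N') (fst b) = drop N' x"
      if b: "b \<in> tower" "mpow tower W (Suc s) b (x, i) \<noteq> 0" for b
    proof -
      obtain a where a: "a \<in> tower" "W b a * mpow tower W s a (x, i) \<noteq> 0"
        using b(2) unfolding mpow.simps mcomp_def mapp_def by (meson sum.neutral)
      then have "mpow tower W s a (x, i) \<noteq> 0" "W b a \<noteq> 0" using mult_not_zero by blast+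
      from n0[OF this a(1) b(1)] show ?thesis by simp
    qed
    moreover have "0 < L (drop N' x)" using L_pos[OF dw[of N']] N' Suc.prems by simp
    ultimately show ?thesis using N' by (intro exI[of _ N'] exI[of _ 0]) (auto simp: r_def)
  qed
qed

text \<open>The mean codeword length, which is also the squared norm of the lift of
  \<open>\<psi>\<close> to the tower.\<close>

definition ell :: real where "ell = (\<Sum>x\<in>words p k. real (L x) * prb x)"

lemma ell_bounds: "1 \<le> ell" "ell \<le> real M"
proof -
  have "(\<Sum>x\<in>words p k. 1 * prb x) \<le> ell" unfolding ell_def
    using L_pos[OF w_ge] by (intro sum_mono mult_right_mono) auto
  then show "1 \<le> ell" using prb_sum by simp
  have "ell \<le> (\<Sum>x\<in>words p k. real M * prb x)" unfolding ell_def
    using L_le[OF w_ge] by (intro sum_mono mult_right_mono) auto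
  then show "ell \<le> real M" using prb_sum by (simp add: sum_distrib_left[symmetric])
qed

text \<open>The uncertainty principle for the \<open>s\<close>-th power of the tower map at the
  normalized lift. The \<open>L x\<close> levels over \<open>x\<close> contribute equal terms, hence
  the weight; \<open>ln ell\<close> comes from the normalization.\<close>

lemma weighted_entropy_ge:
  assumes "s + 2 * M \<le> k"
  shows "ell * ((real s - real M) / 2 * ln p - ln ell) \<le> - (\<Sum>x\<in>words p k. real (L x) * (prb x * ln (prb x)))"
proof -
  define \<phi> where "\<phi> a = complex_of_real (1 / sqrt ell) * \<psi> (fst a)" for a :: "nat list \<times> nat"
  have l0: "ell > 0" using ell_bounds by simp
  have n\<phi>: "(cmod (\<phi> a))\<^sup>2 = prb (fst a) / ell" for a
    using l0 by (simp add: \<phi>_def norm_mult norm_divide power_mult_distrib power_divide prb_def)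
  \<comment> \<open>At least \<open>s - M\<close> digits are deleted within \<open>s\<close> steps,
    because the final level is below \<open>M\<close>; each costs \<open>1 / sqrt p\<close>.\<close>
  define b0 where "b0 = - ((real s - real M) / 2 * ln p)"
  have p0: "real p > 0" using p2 by simp
  have "(\<Sum>a\<in>tower. (cmod (\<phi> a))\<^sup>2 * ln ((cmod (\<phi> a))\<^sup>2)) \<le> b0"
  proof (rule entropic_uncertainty[OF finite_tower miso_mpow[OF finite_tower W_iso]])
    show "mapp tower (mpow tower W s) \<phi> b = \<phi> b" if "b \<in> tower" for b
      by (rule mapp_mpow_fixed[OF finite_tower _ that]) (unfold \<phi>_def, rule W_fixed)
    have "(\<Sum>a\<in>tower. (cmod (\<phi> a))\<^sup>2) = (\<Sum>x\<in>words p k. real (L x) * prb x) / ell"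
      by (simp add: n\<phi> sum_tower sum_divide_distrib)
    then show "(\<Sum>a\<in>tower. (cmod (\<phi> a))\<^sup>2) = 1" using l0 by (simp add: ell_def)
    fix a b assume a: "a \<in> tower" and b: "b \<in> tower"
    obtain x i where xi: "a = (x, i)" "x \<in> words p k" "i < L x" using a by (auto simp: tower_def)
    have iM: "i < M" using xi L_le[OF w_ge[OF xi(2)]] by simp
    then have "s + i + M \<le> k" using assms by simp
    from mpow_W_bound[OF xi(2,3) this] b obtain N j where Nj: "N + j = s + i" "j < L (drop N x)"
      and bd: "cmod (mpow tower W s b a) \<le> (1 / sqrt p) ^ N"
      unfolding xi(1) by blast
    have "drop N x \<in> words_ge p M" using xi(2) Nj iM assms by (auto simp: words_iff words_ge_def dest: in_set_dropD)
    then have NM: "real s - real M \<le> real N" using Nj L_le[of "drop N x"] by linarith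
    have "(1 / sqrt p) ^ N = exp (real N * ln (1 / sqrt p))"
      using p0 by (simp add: exp_of_nat_mult)
    also have "\<dots> = exp (- (real N / 2 * ln p))" using p0 by (simp add: ln_div ln_sqrt)
    also have "\<dots> \<le> exp b0" using NM p2 by (simp add: b0_def mult_right_mono divide_right_mono)
    finally show "cmod (mpow tower W s b a) \<le> exp b0" using bd by simp
  qed
  moreover have "(\<Sum>a\<in>tower. (cmod (\<phi> a))\<^sup>2 * ln ((cmod (\<phi> a))\<^sup>2))
     = (\<Sum>x\<in>words p k. real (L x) * (prb x * ln (prb x))) / ell - ln ell"
  proof -
    have t: "prb x / ell * ln (prb x / ell) = prb x * ln (prb x) / ell - ln ell / ell * prb x" for x
      using l0 by (cases "prb x = 0") (auto simp: ln_div less_le algebra_simps diff_divide_distrib)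
    have "(\<Sum>a\<in>tower. (cmod (\<phi> a))\<^sup>2 * ln ((cmod (\<phi> a))\<^sup>2))
      = (\<Sum>x\<in>words p k. real (L x) * (prb x * ln (prb x)) / ell - ln ell / ell * (real (L x) * prb x))"
      unfolding n\<phi> sum_tower fst_conv t
      by (intro sum.cong refl) (simp add: right_diff_distrib)
    also have "\<dots> = (\<Sum>x\<in>words p k. real (L x) * (prb x * ln (prb x))) / ell - ln ell / ell * ell"
      by (simp add: sum_subtractf sum_divide_distrib sum_distrib_left ell_def)
    finally show ?thesis using l0 by simp
  qed
  ultimately have "(\<Sum>x\<in>words p k. real (L x) * (prb x * ln (prb x))) / ell \<le> b0 + ln ell" by simp
  then have "(\<Sum>x\<in>words p k. real (L x) * (prb x * ln (prb x))) \<le> (b0 + ln ell) * ell"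
    using l0 by (simp add: divide_le_eq)
  then show ?thesis by (simp add: b0_def algebra_simps)
qed

end

text \<open>Defined with \<open>k\<close> and \<open>\<psi>\<close> as arguments, outside the
  locale, so that it can be followed along a sequence of states.\<close>

definition cyl_prob :: "nat \<Rightarrow> nat \<Rightarrow> (nat list \<Rightarrow> complex) \<Rightarrow> nat list \<Rightarrow> real" where
  "cyl_prob p k \<psi> c = (\<Sum>x\<in>words p k. of_bool (take (length c) x = c) * (cmod (\<psi> x))\<^sup>2)"

context quantized_code
begin

text \<open>Gibbs' inequality against the unnormalized weight \<open>exp (- B x)\<close>, from
  \<open>ln t \<le> t - 1\<close> with \<open>t = exp (- B x) / prb x\<close> termwise. The bound on
  \<open>m\<close> controls the total mass of that weight, which appears as the second
  summand.\<close>

lemma gibbs_weighted: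
  assumes "\<And>x. x \<in> words p k \<Longrightarrow> 0 \<le> m x \<and> m x \<le> real M"
  shows "- (\<Sum>x\<in>words p k. m x * (prb x * ln (prb x)))
    \<le> (\<Sum>x\<in>words p k. m x * (prb x * B x)) + real M * (\<Sum>x\<in>words p k. exp (- B x))"
proof -
  have "- (m x * (prb x * ln (prb x))) \<le> m x * (prb x * B x) + real M * exp (- B x)"
    if x: "x \<in> words p k" for x
  proof (cases "prb x = 0")
    case False
    then have p0: "0 < prb x" using prb_nonneg[of x] by linarith
    have "- B x - ln (prb x) = ln (exp (- B x) / prb x)" using p0 by (simp add: ln_div)
    also have "\<dots> \<le> exp (- B x) / prb x - 1" using p0 by (intro ln_le_minus_one) simp
    finally have "prb x * (- B x - ln (prb x)) \<le> prb x * (exp (- B x) / prb x - 1)"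
      using p0 by (intro mult_left_mono) auto
    also have "\<dots> = exp (- B x) - prb x" using p0 by (simp add: field_simps)
    also have "\<dots> \<le> exp (- B x)" by simp
    finally have "m x * (prb x * (- B x - ln (prb x))) \<le> m x * exp (- B x)"
      using assms[OF x] by (intro mult_left_mono) auto
    also have "\<dots> \<le> real M * exp (- B x)" using assms[OF x] by (intro mult_right_mono) auto
    finally show ?thesis by (simp add: algebra_simps)
  qed simp
  then have "(\<Sum>x\<in>words p k. - (m x * (prb x * ln (prb x))))
    \<le> (\<Sum>x\<in>words p k. m x * (prb x * B x) + real M * exp (- B x))"
    by (intro sum_mono)
  then show ?thesis by (simp add: sum_negf sum.distrib sum_distrib_left)
qed

text \<open>Summing \<open>blocksum u\<close> over \<open>u \<le> s\<close> and using invariance telescopes: the boundary terms produce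
  exactly the weight \<open>L x\<close>.\<close>
lemma weighted_blocksum_le:
  assumes g: "\<And>c. 0 \<le> g c" and s: "s + 2 * M \<le> k"
  defines "B \<equiv> blocksum L (\<lambda>x. g (cw x))"
  shows "(\<Sum>x\<in>words p k. real (L x) * (prb x * (B s x - g (cw x)))) \<le> real s * (\<Sum>x\<in>words p k. prb x * g (cw x))"
proof (cases "s = 0")
  case True
  have "(\<Sum>x\<in>words p k. real (L x) * (prb x * (B s x - g (cw x)))) \<le> (\<Sum>x\<in>words p k. 0)"
    using g by (intro sum_mono) (simp add: True B_def mult_nonneg_nonpos)
  then show ?thesis using True by simp
next
  case False
  have B0: "B 0 x = 0" for x by (simp add: B_def)
  have mono: "mono (\<lambda>u. B u x)" for x
    unfolding B_def by (intro monoI blocksum_mono g)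
  have step: "B u x = g (cw x) + B (u - L x) (sh x)" if "x \<in> words p k" "0 < u" for x u
    unfolding B_def by (rule blocksum_step[OF w_ge[OF that(1)] that(2)])
  \<comment> \<open>\<open>B u\<close> reads at most \<open>u + M\<close> digits, all of which
    survive the deletion of one more codeword because \<open>u \<le> s\<close>.\<close>
  have inv: "(\<Sum>x\<in>words p k. B u (sh x) * prb x) = (\<Sum>x\<in>words p k. B u x * prb x)" if u: "u \<le> s" for u
  proof (rule invariance)
    fix x y assume x: "x \<in> words p k" and y: "y \<in> words p k" and t: "take (k - L x) y = sh x"
    have LM: "L x \<le> M" by (rule L_le[OF w_ge[OF x]])
    have lx: "length x = k" "set x \<subseteq> {..<p}" and ly: "length y = k" "set y \<subseteq> {..<p}" using x y by (auto simp: words_iff)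
    have "take (u + M) y = take (u + M) (take (k - L x) y)" using LM u s by (simp add: min_absorb1)
    then have "take (u + M) y = take (u + M) (sh x)" by (simp only: t)
    then show "B u y = B u (sh x)" unfolding B_def
      using LM u s lx ly set_sh[of x] by (intro blocksum_local) (auto simp: length_sh)
  qed
  \<comment> \<open>\<open>B s x - g (cw x)\<close> is \<open>B (s - L x) (sh x)\<close>. Comparing
    the sums along \<open>sh x\<close> at times \<open>u\<close> and \<open>u - L x\<close> turns
    the weight \<open>L x\<close> into a difference whose mean vanishes by invariance, and leaves
    \<open>s\<close> copies of \<open>g (cw x)\<close>.\<close>
  have pt: "real (L x) * (prb x * (B s x - g (cw x)))
     \<le> prb x * (\<Sum>u=1..s. B u (sh x)) - prb x * (\<Sum>u=1..s. B u x) + real s * (prb x * g (cw x))"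
    if x: "x \<in> words p k" for x
  proof -
    have "(\<Sum>u=1..s. B u x) = (\<Sum>u=1..s. g (cw x) + B (u - L x) (sh x))"
      by (intro sum.cong refl step[OF x]) auto
    then have e: "(\<Sum>u=1..s. B (u - L x) (sh x)) = (\<Sum>u=1..s. B u x) - real s * g (cw x)"
      by (simp add: sum.distrib)
    have "real (L x) * B (s - L x) (sh x) \<le> (\<Sum>u=1..s. B u (sh x)) - (\<Sum>u=1..s. B (u - L x) (sh x))"
      by (rule sum_shift_ge[OF mono B0])
    then have "real (L x) * (B s x - g (cw x)) \<le> (\<Sum>u=1..s. B u (sh x)) - (\<Sum>u=1..s. B u x) + real s * g (cw x)"
      using step[OF x, of s] False e by simp
    then have "prb x * (real (L x) * (B s x - g (cw x))) \<le> prb x * ((\<Sum>u=1..s. B u (sh x)) - (\<Sum>u=1..s. B u x) + real s * g (cw x))"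
      by (intro mult_left_mono) auto
    then show ?thesis by (simp only: algebra_simps)
  qed
  have sw: "(\<Sum>x\<in>words p k. prb x * (\<Sum>u=1..s. f u x)) = (\<Sum>u=1..s. \<Sum>x\<in>words p k. f u x * prb x)" for f
    unfolding sum_distrib_left by (subst sum.swap) (simp add: mult.commute)
  have "(\<Sum>x\<in>words p k. prb x * (\<Sum>u=1..s. B u (sh x))) = (\<Sum>x\<in>words p k. prb x * (\<Sum>u=1..s. B u x))"
    unfolding sw by (intro sum.cong refl inv) auto
  moreover have "(\<Sum>x\<in>words p k. real (L x) * (prb x * (B s x - g (cw x)))) \<le>
     (\<Sum>x\<in>words p k. prb x * (\<Sum>u=1..s. B u (sh x)) - prb x * (\<Sum>u=1..s. B u x) + real s * (prb x * g (cw x)))"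
    by (intro sum_mono pt)
  ultimately show ?thesis by (simp add: sum.distrib sum_subtractf sum_distrib_left)
qed

text \<open>Both estimates at finite \<open>k\<close>. Since \<open>2 * M\<close> digits lie beyond
  \<open>s\<close>, the Kraft sum costs a power of \<open>p\<close> with exponent
  \<open>2 * M\<close>; \<open>M * Gm\<close> pays for the first block, and \<open>ln ell\<close> is
  replaced by \<open>ln M\<close>.\<close>

lemma entropy_inequality:
  assumes g: "\<And>c. 0 \<le> g c" "\<And>c. c \<in> C \<Longrightarrow> g c \<le> Gm" and kraft: "(\<Sum>c\<in>C. exp (- g c)) \<le> 1"
    and s: "s + 2 * M = k"
  shows "ell * ((real s - real M) / 2 * ln p - ln M)
     \<le> real s * (\<Sum>x\<in>words p k. prb x * g (cw x)) + real M * Gm + real M * real p ^ (2 * M)"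
proof -
  let ?B = "blocksum L (\<lambda>x. g (cw x)) s"
  have "ell * ((real s - real M) / 2 * ln p - ln M) \<le> ell * ((real s - real M) / 2 * ln p - ln ell)"
    using ell_bounds by (intro mult_left_mono) auto
  also have "\<dots> \<le> - (\<Sum>x\<in>words p k. real (L x) * (prb x * ln (prb x)))"
    by (rule weighted_entropy_ge) (use s in simp)
  also have "\<dots> \<le> (\<Sum>x\<in>words p k. real (L x) * (prb x * ?B x)) + real M * (\<Sum>x\<in>words p k. exp (- ?B x))"
    using L_le[OF w_ge] by (intro gibbs_weighted) auto
  also have "real M * (\<Sum>x\<in>words p k. exp (- ?B x)) \<le> real M * real p ^ (2 * M)"
    using sum_exp_blocksum[OF kraft, of s k] s by (intro mult_left_mono) auto
  also have "(\<Sum>x\<in>words p k. real (L x) * (prb x * ?B x))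
     = (\<Sum>x\<in>words p k. real (L x) * (prb x * (?B x - g (cw x)))) + (\<Sum>x\<in>words p k. real (L x) * (prb x * g (cw x)))"
    by (simp add: sum.distrib[symmetric] algebra_simps)
  also have "(\<Sum>x\<in>words p k. real (L x) * (prb x * (?B x - g (cw x)))) \<le> real s * (\<Sum>x\<in>words p k. prb x * g (cw x))"
    using weighted_blocksum_le[OF g(1), of s] s by simp
  also have "(\<Sum>x\<in>words p k. real (L x) * (prb x * g (cw x))) \<le> (\<Sum>x\<in>words p k. real M * (prb x * Gm))"
    using L_le[OF w_ge] g cw_in_C[OF w_ge] by (intro sum_mono mult_mono) auto
  also have "\<dots> = real M * Gm"
    by (simp add: sum_distrib_left[symmetric] sum_distrib_right[symmetric] prb_sum)
  finally show ?thesis by (simp add: algebra_simps)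
qed

abbreviation cprob :: "nat list \<Rightarrow> real" where
  "cprob \<equiv> cyl_prob p k \<psi>"

lemma cprob_def: "cprob c = (\<Sum>x\<in>words p k. of_bool (take (length c) x = c) * prb x)"
  by (simp add: cyl_prob_def prb_def)

lemma sum_by_code:
  "(\<Sum>x\<in>words p k. f (cw x) * prb x) = (\<Sum>c\<in>C. f c * cprob c)"
proof -
  have "(\<Sum>x\<in>words p k. f (cw x) * prb x) = (\<Sum>x\<in>words p k. \<Sum>c\<in>C. f c * (of_bool (take (length c) x = c) * prb x))"
  proof (intro sum.cong refl)
    fix x assume x: "x \<in> words p k"
    have "(\<Sum>c\<in>C. f c * (of_bool (take (length c) x = c) * prb x)) = (\<Sum>c\<in>C. if c = cw x then f (cw x) * prb x else 0)"
      using cw_eq_iff[OF _ w_ge[OF x]] by (intro sum.cong refl) auto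
    then show "f (cw x) * prb x = (\<Sum>c\<in>C. f c * (of_bool (take (length c) x = c) * prb x))"
      using finite_C cw_in_C[OF w_ge[OF x]] by simp
  qed
  also have "\<dots> = (\<Sum>c\<in>C. f c * cprob c)"
    unfolding cprob_def sum_distrib_left by (rule sum.swap)
  finally show ?thesis .
qed

lemma cprob_sum: "(\<Sum>c\<in>C. cprob c) = 1"
  using sum_by_code[of "\<lambda>_. 1"] prb_sum by simp

lemma ell_by_code: "ell = (\<Sum>c\<in>C. real (length c) * cprob c)"
  using sum_by_code[of "\<lambda>c. real (length c)"] length_cw[OF w_ge] by (simp add: ell_def)

text \<open>An observable of \<open>r\<close> digits reads at most \<open>r + i * M\<close> digits
  after \<open>i\<close> shifts, and each application of \<open>invariance\<close> needs
  \<open>M\<close> digits of reserve.\<close>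

lemma iterated_invariance:
  assumes loc: "\<And>x. f x = f (take r x)" and "r + (N + 1) * M \<le> k" "i \<le> N"
  shows "(\<Sum>x\<in>words p k. f ((sh ^^ i) x) * prb x) = (\<Sum>x\<in>words p k. f x * prb x)"
  using assms(3)
proof (induction i)
  case (Suc i)
  have "(\<Sum>x\<in>words p k. f ((sh ^^ i) (sh x)) * prb x) = (\<Sum>x\<in>words p k. f ((sh ^^ i) x) * prb x)"
  proof (rule invariance)
    fix x y assume x: "x \<in> words p k" and y: "y \<in> words p k" and t: "take (k - L x) y = sh x"
    have LM: "L x \<le> M" by (rule L_le[OF w_ge[OF x]])
    have lx: "length x = k" "set x \<subseteq> {..<p}" and ly: "length y = k" "set y \<subseteq> {..<p}" using x y by (auto simp: words_iff)
    have "(i + 1) * M \<le> (N + 1) * M" using Suc.prems by (intro mult_le_mono) auto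
    then have ri: "r + i * M + M \<le> k" using assms(2) unfolding add_mult_distrib by linarith
    have "take (r + i * M) y = take (r + i * M) (take (k - L x) y)" using LM ri by (simp add: min_absorb1)
    then have "take (r + i * M) y = take (r + i * M) (sh x)" by (simp only: t)
    then have "take r ((sh ^^ i) y) = take r ((sh ^^ i) (sh x))"
      using LM ri lx ly set_sh[of x] by (intro sh_iter_local) (auto simp: length_sh)
    then show "f ((sh ^^ i) y) = f ((sh ^^ i) (sh x))" using loc by metis
  qed
  then show ?case using Suc by (simp add: funpow_swap1)
qed simp

text \<open>No mass accumulates at the right end of the cylinder of \<open>c\<close>: a visit to \<open>c\<close> followed by a long
  run of the top digit excludes further visits during this run.\<close>
lemma cprob_top_run:
  assumes c: "c \<in> C" "c \<noteq> top" and k: "length c + 2 * (N + 1) * M \<le> k"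
  shows "real N * cprob (c @ replicate ((N + 1) * M) (p - 1)) \<le> 1"
proof -
  let ?d = "c @ replicate ((N + 1) * M) (p - 1)"
  let ?r = "length ?d"
  define f where "f x = (of_bool (take ?r x = ?d) :: real)" for x
  have one: "(\<Sum>i<N. f ((sh ^^ i) x)) \<le> 1" if x: "x \<in> words p k" for x
  proof -
    have uniq: False if h: "i < i'" "i' < N" "f ((sh ^^ i) x) \<noteq> 0" "f ((sh ^^ i') x) \<noteq> 0" for i i'
    proof -
      let ?z = "(sh ^^ i) x"
      have z: "take ?r ?z = ?d" using h(3) by (simp add: f_def)
      have sz: "set ((sh ^^ j) x) \<subseteq> {..<p}" for j
        using x set_sh by (induction j) (auto simp: words_iff)
      have lr: "?r \<le> length ?z" using z by (metis length_take min.cobounded1)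
      have wz: "?z \<in> words_ge p M" using lr sz by (auto simp: words_ge_def)
      have "take (length c) ?z = take (length c) (take ?r ?z)" by (simp add: min_absorb1)
      then have "cw ?z = c" unfolding z using cw_eq_iff[OF c(1) wz] by simp
      then have shz: "sh ?z = drop (length c) ?z" using length_cw[OF wz] by (simp add: sh_def)
      have "take ((N + 1) * M) (sh ?z) = drop (length c) (take ?r ?z)" unfolding shz by (simp add: take_drop add.commute)
      then have t1: "take ((N + 1) * M) (sh ?z) = replicate ((N + 1) * M) (p - 1)" unfolding z by simp
      \<comment> \<open>The number of shifts between the removal of \<open>c\<close> and the time
        \<open>i'\<close>. It is below \<open>N\<close>, so at least \<open>M\<close> digits of the
        run remain and the codeword read at time \<open>i'\<close> is \<open>top\<close>.\<close>
      define t where "t = i' - i - 1"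
      have tN: "(t + 1) * M \<le> (N + 1) * M" using h by (intro mult_le_mono) (auto simp: t_def)
      then have tM: "t * M \<le> (N + 1) * M" by (rule order_trans[rotated]) simp
      have l1: "(N + 1) * M \<le> length (sh ?z)" using lr shz by simp
      have s2: "take ((N + 1) * M - t * M) ((sh ^^ t) (sh ?z)) = replicate ((N + 1) * M - t * M) (p - 1)"
        "length ((sh ^^ t) (sh ?z)) \<ge> (N + 1) * M - t * M"
        using sh_iter_top[OF set_sh[OF sz] l1 tM t1] by auto
      have "(sh ^^ t) (sh ?z) = (sh ^^ (t + 1 + i)) x" by (simp add: funpow_add funpow_swap1)
      also have "t + 1 + i = i'" using h by (simp add: t_def)
      finally have e: "(sh ^^ t) (sh ?z) = (sh ^^ i') x" .
      let ?y = "(sh ^^ i') x"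
      have Ml: "M \<le> (N + 1) * M - t * M" using tN unfolding add_mult_distrib by linarith
      have wy: "?y \<in> words_ge p M" using s2(2) Ml sz e by (auto simp: words_ge_def)
      have "take M ?y = take M (take ((N + 1) * M - t * M) ?y)" using Ml by (simp add: min_absorb1)
      also have "\<dots> = replicate M (p - 1)" using s2(1) Ml unfolding e by (simp add: min_absorb1)
      finally have "cw ?y = top" by (rule cw_top[OF wy])
      moreover have "take ?r ?y = ?d" using h(4) by (simp add: f_def)
      then have "take (length c) ?y = c" by (metis append_eq_conv_conj take_add length_append take_take min.absorb1 le_add1)
      then have "cw ?y = c" using cw_eq_iff[OF c(1) wy] by simp
      ultimately show False using c(2) by simp
    qed
    show ?thesis
    proof (cases "\<exists>i<N. f ((sh ^^ i) x) \<noteq> 0")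
      case True
      then obtain i where i: "i < N" "f ((sh ^^ i) x) \<noteq> 0" by auto
      have "(\<Sum>i<N. f ((sh ^^ i) x)) = (\<Sum>i\<in>{i}. f ((sh ^^ i) x))"
        using i uniq by (intro sum.mono_neutral_right) (auto, metis linorder_neqE_nat)
      also have "\<dots> = f ((sh ^^ i) x)" by simp
      also have "\<dots> \<le> 1" unfolding f_def by (rule of_bool_less_eq_one)
      finally show ?thesis .
    next
      case False
      then show ?thesis by simp
    qed
  qed
  have kk: "?r + (N + 1) * M \<le> k" using k by (simp add: algebra_simps)
  \<comment> \<open>By invariance all \<open>N\<close> times give the same mass, while visits at
    different times exclude one another.\<close>
  have "real N * cprob ?d = (\<Sum>i<N. \<Sum>x\<in>words p k. f ((sh ^^ i) x) * prb x)"
    using iterated_invariance[of f ?r N, OF _ kk] by (simp add: cprob_def f_def)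
  also have "\<dots> = (\<Sum>x\<in>words p k. (\<Sum>i<N. f ((sh ^^ i) x)) * prb x)"
    unfolding sum_distrib_right by (rule sum.swap)
  also have "\<dots> \<le> (\<Sum>x\<in>words p k. 1 * prb x)" by (intro sum_mono mult_right_mono one) auto
  finally show ?thesis by (simp add: prb_sum)
qed

end

section \<open>The semiclassical limit\<close>

text \<open>The diagonal entries of the observable are cylinder averages, so a test function above 1
  on the cylinders of \<open>S\<close> dominates the mass of \<open>S\<close>.\<close>

lemma qexp_ge:
  assumes p: "p \<ge> 2" and f: "continuous_on UNIV f" "\<And>x. 0 \<le> f x"
    and S: "S \<subseteq> words p k" and f1: "\<And>w x. w \<in> S \<Longrightarrow> x \<in> cyl p w \<Longrightarrow> 1 \<le> f x"
  shows "(\<Sum>w\<in>S. (cmod (\<psi> w))\<^sup>2) \<le> qexp p k \<psi> f"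
proof -
  have p0: "0 < real p ^ m" for m using p by simp
  have int: "f integrable_on cyl p w" for w
    unfolding cyl_def by (intro integrable_continuous_real continuous_on_subset[OF f(1)]) auto
  have nn: "0 \<le> cavg p w f" for w
    unfolding cavg_def using f(2) by (intro mult_nonneg_nonneg integral_nonneg int) auto
  have one: "1 \<le> cavg p w f" if "w \<in> S" for w
  proof -
    have i1: "((\<lambda>x. 1) has_integral (1 / real p ^ length w)) (cyl p w)"
      unfolding cyl_def using has_integral_const_real[of "1::real" "cval p w" "cval p w + 1 / real p ^ length w"] p0
      by simp
    then have "1 / real p ^ length w = integral (cyl p w) (\<lambda>x. 1)" by (simp add: integral_unique)
    also have "\<dots> \<le> integral (cyl p w) f"
      using i1 f1[OF that] by (intro integral_le int) (auto simp: has_integral_integrable)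
    finally show ?thesis using p0[of "length w"] unfolding cavg_def by (simp add: divide_le_eq mult.commute)
  qed
  have "(\<Sum>w\<in>S. (cmod (\<psi> w))\<^sup>2) \<le> (\<Sum>w\<in>S. (cmod (\<psi> w))\<^sup>2 * cavg p w f)"
    using one by (intro sum_mono) (simp add: mult_le_cancel_left1)
  also have "\<dots> \<le> qexp p k \<psi> f"
    unfolding qexp_def using nn S by (intro sum_mono2 finite_words) auto
  finally show ?thesis .
qed

text \<open>The upper half of the portmanteau theorem for a closed interval. One continuous majorant
  of its indicator is fixed before \<open>i\<close>, which makes the estimate uniform over all sets
  \<open>S\<close> of words whose cylinders lie in the interval.\<close>

lemma semiclassical_upper:
  fixes \<mu> :: "real measure"
  assumes p: "p \<ge> 2" and prob: "prob_space \<mu>" and sets: "sets \<mu> = sets (restrict_space borel {0..1})"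
    and conv: "\<And>f. continuous_on {0..1} f \<Longrightarrow> (\<lambda>i. qexp p (r i) (\<psi> (r i)) f) \<longlonglongrightarrow> integral\<^sup>L \<mu> f"
    and e: "0 < e"
  shows "\<forall>\<^sub>F i in sequentially. \<forall>S\<subseteq>words p (r i). (\<forall>w\<in>S. cyl p w \<subseteq> {a..b}) \<longrightarrow>
     (\<Sum>w\<in>S. (cmod (\<psi> (r i) w))\<^sup>2) \<le> measure \<mu> ({a..b} \<inter> {0..1}) + e"
proof -
  interpret prob_space \<mu> by (rule prob)
  have sp: "space \<mu> = {0..1}" using sets_eq_imp_space_eq[OF sets] by (simp add: space_restrict_space)
  \<comment> \<open>For \<open>a \<le> b\<close> the distance to the interval; it is positive
    everywhere if the interval is empty.\<close>
  define d where "d x = max 0 (max (a - x) (x - b))" for x :: real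
  define f where "f j x = max 0 (1 - real j * d x)" for j x
  have cf: "continuous_on A (f j)" for j A unfolding f_def d_def by (intro continuous_intros)
  have d0: "0 \<le> d x" for x by (simp add: d_def)
  have d0_iff: "d x = 0 \<longleftrightarrow> x \<in> {a..b}" for x by (auto simp: d_def max_def)
  have f01: "0 \<le> f j x" "f j x \<le> 1" for j x using d0[of x] by (auto simp: f_def)
  have meas: "f j \<in> borel_measurable \<mu>" for j
  proof -
    have "f j \<in> borel_measurable borel" by (intro borel_measurable_continuous_onI cf)
    then have "f j \<in> borel_measurable (restrict_space borel {0..1})" by (rule measurable_restrict_space1)
    then show ?thesis using measurable_cong_sets[OF sets refl] by blast
  qed
  have Am: "{a..b} \<inter> {0..1} \<in> sets \<mu>" unfolding sets sets_restrict_space by (intro image_eqI[of _ _ "{a..b}"]) auto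
  have "(\<lambda>j. integral\<^sup>L \<mu> (f j)) \<longlonglongrightarrow> integral\<^sup>L \<mu> (indicator ({a..b} \<inter> {0..1}))"
  proof (rule integral_dominated_convergence[where w = "\<lambda>_. 1"])
    show "(indicator ({a..b} \<inter> {0..1}) :: real \<Rightarrow> real) \<in> borel_measurable \<mu>" using Am by simp
    show "AE x in \<mu>. (\<lambda>j. f j x) \<longlonglongrightarrow> indicator ({a..b} \<inter> {0..1}) x"
    proof (intro AE_I2)
      fix x assume "x \<in> space \<mu>"
      then have x: "x \<in> {0..1}" by (simp add: sp)
      show "(\<lambda>j. f j x) \<longlonglongrightarrow> indicator ({a..b} \<inter> {0..1}) x"
      proof (cases "x \<in> {a..b}")
        case True
        then have "f j x = 1" for j using d0_iff[of x] by (simp add: f_def)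
        then show ?thesis using True x by simp
      next
        case False
        then have dp: "0 < d x" using d0[of x] d0_iff[of x] by linarith
        obtain n where n: "1 / d x < real n" using reals_Archimedean2 by blast
        have "f j x = 0" if "n \<le> j" for j
        proof -
          have "1 < real n * d x" using n dp by (simp add: divide_less_eq)
          also have "\<dots> \<le> real j * d x" using that dp by (intro mult_right_mono) auto
          finally show ?thesis by (simp add: f_def)
        qed
        then have "\<forall>\<^sub>F j in sequentially. f j x = indicator ({a..b} \<inter> {0..1}) x"
          using False by (intro eventually_sequentiallyI[of n]) (auto simp: indicator_def)
        then show ?thesis by (rule tendsto_eventually)
      qed
    qed
  qed (use f01 in \<open>auto simp: meas\<close>)
  moreover have "integral\<^sup>L \<mu> (indicator ({a..b} \<inter> {0..1})) = measure \<mu> ({a..b} \<inter> {0..1})"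
    using Am by simp
  ultimately have "(\<lambda>j. integral\<^sup>L \<mu> (f j)) \<longlonglongrightarrow> measure \<mu> ({a..b} \<inter> {0..1})" by simp
  from order_tendstoD(2)[OF this, of "measure \<mu> ({a..b} \<inter> {0..1}) + e / 2"] e
  obtain j where j: "integral\<^sup>L \<mu> (f j) < measure \<mu> ({a..b} \<inter> {0..1}) + e / 2"
    by (auto simp: eventually_sequentially)
  have "\<forall>\<^sub>F i in sequentially. qexp p (r i) (\<psi> (r i)) (f j) < integral\<^sup>L \<mu> (f j) + e / 2"
    using e by (intro order_tendstoD(2)[OF conv[OF cf]]) simp
  then show ?thesis
  proof eventually_elim
    case (elim i)
    show ?case
    proof (intro allI impI)
      fix S assume S: "S \<subseteq> words p (r i)" "\<forall>w\<in>S. cyl p w \<subseteq> {a..b}"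
      have "(\<Sum>w\<in>S. (cmod (\<psi> (r i) w))\<^sup>2) \<le> qexp p (r i) (\<psi> (r i)) (f j)"
      proof (rule qexp_ge[OF p cf f01(1) S(1)])
        fix w x assume "w \<in> S" "x \<in> cyl p w"
        then have "d x = 0" using S(2) d0_iff by blast
        then show "1 \<le> f j x" by (simp add: f_def)
      qed
      then show "(\<Sum>w\<in>S. (cmod (\<psi> (r i) w))\<^sup>2) \<le> measure \<mu> ({a..b} \<inter> {0..1}) + e"
        using elim j by linarith
    qed
  qed
qed

section \<open>Half-open cells of a prefix code\<close>

definition hcell :: "nat \<Rightarrow> nat list \<Rightarrow> real set" where
  "hcell p c = {cval p c ..< cval p c + 1 / real p ^ length c}"

text \<open>Closed cylinders share endpoints, half-open cells are disjoint; only the cell that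
  reaches 1 keeps its right endpoint, in agreement with \<open>Ipart\<close>.\<close>

definition cell :: "nat \<Rightarrow> nat list \<Rightarrow> real set" where
  "cell p c = hcell p c \<union> (if cval p c + 1 / real p ^ length c = 1 then {1} else {})"

context prefix_code
begin

text \<open>The shorter codeword is compared with the prefix of equal length of the longer one, from
  which it differs by prefix freeness.\<close>

lemma C_ordered:
  assumes "c \<in> C" "e \<in> C" "c \<noteq> e"
  shows "cval p c + 1 / real p ^ length c \<le> cval p e \<or> cval p e + 1 / real p ^ length e \<le> cval p c"
proof -
  have *: "cval p c + 1 / real p ^ length c \<le> cval p e \<or> cval p e + 1 / real p ^ length e \<le> cval p c"
    if c: "c \<in> C" and e: "e \<in> C" and ne: "c \<noteq> e" and le: "length c \<le> length e" for c e
  proof -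
    let ?u = "take (length c) e"
    have "?u \<noteq> c" using C_prefix_free[OF c e] ne by auto
    moreover have "set ?u \<subseteq> {..<p}" using C_D(3)[OF e] by (auto dest: in_set_takeD)
    ultimately have "cval p c + 1 / real p ^ length c \<le> cval p ?u \<or> cval p ?u + 1 / real p ^ length c \<le> cval p c"
      using cval_distinct[OF p2, of c ?u] C_D(3)[OF c] le by (simp add: min_absorb2)
    then show ?thesis using cval_lt_next[OF p2 C_D(3)[OF e] le] by linarith
  qed
  show ?thesis using *[OF assms] *[OF assms(2,1)] assms(3) by fastforce
qed

lemma cell_disjoint:
  assumes "c \<in> C" "e \<in> C" "c \<noteq> e"
  shows "cell p c \<inter> cell p e = {}"
  using C_ordered[OF assms] cval_lt_1[OF p2 C_D(3)[OF assms(1)]] cval_lt_1[OF p2 C_D(3)[OF assms(2)]]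
  by (auto simp: cell_def hcell_def split: if_splits)

lemma cell_subset: "c \<in> C \<Longrightarrow> cell p c \<subseteq> {0..1}"
  using cval_le[OF p2 C_D(3), of c] cval_nonneg[of p c] by (auto simp: cell_def hcell_def)

lemma top_eq: "top = replicate (length top) (p - 1)"
  using L_le[OF replicate_top_ge] by (simp add: top_def cw_def min_absorb1)

end

text \<open>The code is fixed while the states converge weakly along \<open>r\<close>. The kernel
  may vary with \<open>k\<close> and is only required to exist; \<open>k0\<close> lets small
  \<open>k\<close> be discarded.\<close>

locale semiclassical_code = prefix_code +
  fixes \<psi> :: "nat \<Rightarrow> nat list \<Rightarrow> complex" and r :: "nat \<Rightarrow> nat" and \<mu> :: "real measure" and k0 :: nat
  assumes quantized: "k0 \<le> k \<Longrightarrow> \<exists>K. quantized_code p M L k K (\<psi> k)"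
    and r: "strict_mono r"
    and prob: "prob_space \<mu>"
    and sets_\<mu>: "sets \<mu> = sets (restrict_space borel {0..1})"
    and conv: "continuous_on {0..1} f \<Longrightarrow> (\<lambda>i. qexp p (r i) (\<psi> (r i)) f) \<longlonglongrightarrow> integral\<^sup>L \<mu> f"
begin

sublocale prob_space \<mu> by (rule prob)

abbreviation cp :: "nat \<Rightarrow> nat list \<Rightarrow> real" where "cp i \<equiv> cyl_prob p (r i) (\<psi> (r i))"

lemma r_large: "\<forall>\<^sub>F i in sequentially. K \<le> r i"
  using filterlim_subseq[OF r] by (simp add: filterlim_at_top)

lemma cell_sets: "c \<in> C \<Longrightarrow> cell p c \<in> sets \<mu>"
  unfolding sets_\<mu> sets_restrict_space using cell_subset[of c]
  by (intro image_eqI[of _ _ "cell p c"]) (auto simp: cell_def hcell_def)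

lemma cp_sum: "\<forall>\<^sub>F i in sequentially. (\<Sum>c\<in>C. cp i c) = 1"
  using r_large[of k0]
proof eventually_elim
  case (elim i)
  then obtain K where "quantized_code p M L (r i) K (\<psi> (r i))" using quantized by blast
  then interpret quantized_code p M L "r i" K "\<psi> (r i)" .
  show ?case by (rule cprob_sum)
qed

text \<open>For \<open>top\<close> the cell is closed and the portmanteau bound applies to it. Any
  other cell lacks its right endpoint, where mass could escape into the next cell;
  \<open>cprob_top_run\<close> bounds the mass close to that endpoint, and the rest fits into a
  closed subinterval.\<close>

lemma cp_upper:
  assumes c: "c \<in> C" and e: "0 < e"
  shows "\<forall>\<^sub>F i in sequentially. cp i c \<le> measure \<mu> (cell p c) + e"
proof (cases "c = top")
  case True
  then have one: "cval p c + 1 / real p ^ length c = 1" using top_eq cval_replicate[OF p2, of "length c"] by simp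
  have "cval p c < 1" by (rule cval_lt_1[OF p2 C_D(3)[OF c]])
  then have cl: "cell p c = {cval p c..1} \<inter> {0..1}"
    using one cval_nonneg[of p c] by (auto simp: cell_def hcell_def)
  show ?thesis using semiclassical_upper[OF p2 prob sets_\<mu> conv e, of "cval p c" 1, simplified] r_large[of "length c"]
  proof eventually_elim
    case (elim i)
    let ?S = "{x \<in> words p (r i). take (length c) x = c}"
    have "cyl p x \<subseteq> {cval p c..1}" if "x \<in> ?S" for x
    proof -
      have x: "set x \<subseteq> {..<p}" "length c \<le> length x" "take (length c) x = c"
        using that elim(2) by (auto simp: words_iff)
      show ?thesis using cval_lt_next[OF p2 x(1,2)] cval_le[OF p2 x(1)] x(3) by (auto simp: cyl_def)
    qed
    then have "(\<Sum>w\<in>?S. (cmod (\<psi> (r i) w))\<^sup>2) \<le> measure \<mu> ({cval p c..1} \<inter> {0..1}) + e"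
      using elim(1)[rule_format, of ?S] by auto
    moreover have "cp i c = (\<Sum>w\<in>?S. (cmod (\<psi> (r i) w))\<^sup>2)"
      unfolding cyl_prob_def by (simp add: finite_words Int_def)
    ultimately show ?case using cl by simp
  qed
next
  case False
  obtain N where N: "2 / e < real N" using reals_Archimedean2 by blast
  then have N0: "0 < real N" using e by (metis divide_pos_pos less_trans zero_less_numeral)
  define R where "R = (N + 1) * M"
  \<comment> \<open>The left endpoint of the cylinder of \<open>c @ replicate R (p - 1)\<close>,
    hence strictly inside the cell.\<close>
  define b where "b = cval p c + (1 - 1 / real p ^ R) / real p ^ length c"
  have p0: "0 < real p ^ m" for m using p2 by simp
  have bsub: "{cval p c..b} \<inter> {0..1} \<subseteq> cell p c"
  proof -
    have "(1 - 1 / real p ^ R) / real p ^ length c < 1 / real p ^ length c"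
      using p0 by (intro divide_strict_right_mono) auto
    then show ?thesis by (auto simp: b_def cell_def hcell_def)
  qed
  have e2: "0 < e / 2" using e by simp
  show ?thesis
    using semiclassical_upper[OF p2 prob sets_\<mu> conv e2, of "cval p c" b, simplified]
      r_large[of "k0 + length c + 2 * (N + 1) * M"]
  proof eventually_elim
    case (elim i)
    then have k0: "k0 \<le> r i" by simp
    then obtain K where "quantized_code p M L (r i) K (\<psi> (r i))" using quantized by blast
    then interpret quantized_code p M L "r i" K "\<psi> (r i)" .
    have rR: "length c + R \<le> r i" using elim(2) by (simp add: R_def)
    let ?d = "c @ replicate R (p - 1)"
    \<comment> \<open>The words of \<open>c\<close> are these, whose cylinders end at or before
      \<open>b\<close>, and those that continue with the top run, of mass below
      \<open>e / 2\<close>.\<close>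
    let ?S = "{x \<in> words p (r i). take (length c) x = c \<and> take (length ?d) x \<noteq> ?d}"
    have "real N * cprob ?d \<le> 1" unfolding R_def by (rule cprob_top_run[OF c False]) (use elim(2) in simp)
    then have "cprob ?d \<le> 1 / real N" using N0 by (simp add: field_simps)
    also have "\<dots> < e / 2" using N N0 e by (simp add: field_simps)
    finally have d: "cprob ?d < e / 2" .
    have "cyl p x \<subseteq> {cval p c..b}" if "x \<in> ?S" for x
    proof -
      have x: "set x \<subseteq> {..<p}" "length x = r i" "take (length c) x = c" "take (length c + R) x \<noteq> ?d"
        using that by (auto simp: words_iff)
      define v where "v = take R (drop (length c) x)"
      have cv: "take (length c + R) x = c @ v" using x(3) by (simp add: v_def take_add)
      have lv: "length v = R" using x(2) rR by (simp add: v_def)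
      have sv: "set v \<subseteq> {..<p}" using x(1) by (auto simp: v_def dest: in_set_takeD in_set_dropD)
      have "v \<noteq> replicate (length v) (p - 1)" using x(4) cv lv by auto
      then have vt: "cval p v + 1 / real p ^ R \<le> 1 - 1 / real p ^ R" using cval_le_not_top[OF p2 sv] lv by simp
      have "length c + R \<le> length x" using x(2) rR by simp
      from cval_lt_next(2)[OF p2 x(1) this]
      have "cval p x + 1 / real p ^ length x \<le> cval p c + (cval p v + 1 / real p ^ R) / real p ^ length c"
        unfolding cv by (simp add: cval_append add_divide_distrib power_add mult.commute)
      also have "\<dots> \<le> b" unfolding b_def using vt p0[of "length c"] by (intro add_left_mono divide_right_mono) auto
      finally have u: "cval p x + 1 / real p ^ length x \<le> b" .
      have "cval p c \<le> cval p x" using cval_lt_next(1)[OF p2 x(1), of "length c"] x(2,3) rR by simp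
      then show ?thesis using u by (auto simp: cyl_def)
    qed
    then have S: "(\<Sum>w\<in>?S. (cmod (\<psi> (r i) w))\<^sup>2) \<le> measure \<mu> ({cval p c..b} \<inter> {0..1}) + e / 2"
      using elim(1)[rule_format, of ?S] by auto
    have "cprob c \<le> (\<Sum>x\<in>words p (r i). of_bool (take (length ?d) x = ?d) * prb x + (if x \<in> ?S then prb x else 0))"
      unfolding cprob_def by (intro sum_mono) auto
    also have "\<dots> = cprob ?d + (\<Sum>w\<in>?S. prb w)"
      unfolding sum.distrib cprob_def by (simp add: sum.If_cases finite_words Int_def)
    finally have "cprob c \<le> measure \<mu> ({cval p c..b} \<inter> {0..1}) + e"
      using S d unfolding prb_def by linarith
    also have "measure \<mu> ({cval p c..b} \<inter> {0..1}) \<le> measure \<mu> (cell p c)"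
      by (rule finite_measure_mono[OF bsub cell_sets[OF c]])
    finally show ?case by simp
  qed
qed

lemma sum_cell_le: "(\<Sum>c\<in>C. measure \<mu> (cell p c)) \<le> 1"
proof -
  have "(\<Sum>c\<in>C. measure \<mu> (cell p c)) = measure \<mu> (\<Union>c\<in>C. cell p c)"
    using cell_sets cell_disjoint finite_C
    by (intro finite_measure_finite_Union[symmetric]) (auto simp: disjoint_family_on_def)
  then show ?thesis by simp
qed

text \<open>Upper bounds suffice: the weights sum to 1 and the cells to at most 1, so if no weight
  exceeds its cell by more than \<open>d\<close>, none can fall short by more than
  \<open>card C\<close> times \<open>d\<close>.\<close>

lemma cp_tendsto:
  assumes c: "c \<in> C"
  shows "(\<lambda>i. cp i c) \<longlonglongrightarrow> measure \<mu> (cell p c)"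
proof (rule tendstoI)
  fix e :: real assume e: "0 < e"
  define d where "d = e / (2 * real (card C))"
  have cC: "0 < real (card C)" using c finite_C by (auto simp: card_gt_0_iff)
  have d0: "0 < d" using e cC by (simp add: d_def)
  have "\<forall>\<^sub>F i in sequentially. \<forall>c\<in>C. cp i c \<le> measure \<mu> (cell p c) + d"
    using cp_upper[OF _ d0] by (intro eventually_ball_finite finite_C) auto
  with cp_sum show "\<forall>\<^sub>F i in sequentially. dist (cp i c) (measure \<mu> (cell p c)) < e"
  proof eventually_elim
    case (elim i)
    have 1: "(\<Sum>c\<in>C. cp i c) = cp i c + (\<Sum>c\<in>C - {c}. cp i c)"
      "(\<Sum>c\<in>C. measure \<mu> (cell p c)) = measure \<mu> (cell p c) + (\<Sum>c\<in>C - {c}. measure \<mu> (cell p c))"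
      using c finite_C by (simp_all add: sum.remove)
    have "(\<Sum>c\<in>C - {c}. cp i c) \<le> (\<Sum>c\<in>C - {c}. measure \<mu> (cell p c) + d)"
      using elim(2) by (intro sum_mono) auto
    also have "\<dots> = (\<Sum>c\<in>C - {c}. measure \<mu> (cell p c)) + real (card (C - {c})) * d"
      by (simp add: sum.distrib)
    also have "real (card (C - {c})) * d \<le> real (card C) * d"
      using d0 finite_C by (intro mult_right_mono) (auto intro: card_mono)
    also have "real (card C) * d = e / 2" using cC by (simp add: d_def)
    finally have "measure \<mu> (cell p c) \<le> cp i c + e / 2" using elim(1) sum_cell_le 1 by linarith
    moreover have "d \<le> e / 2" using cC c finite_C e
      by (simp add: d_def field_simps Suc_le_eq card_gt_0_iff)
    then have "cp i c \<le> measure \<mu> (cell p c) + e / 2" using elim(2) c by fastforce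
    ultimately show ?case using e by (simp add: dist_real_def)
  qed
qed

lemma sum_cell: "(\<Sum>c\<in>C. measure \<mu> (cell p c)) = 1"
proof -
  have "(\<lambda>i. \<Sum>c\<in>C. cp i c) \<longlonglongrightarrow> (\<Sum>c\<in>C. measure \<mu> (cell p c))"
    by (intro tendsto_sum cp_tendsto)
  moreover have "(\<lambda>i. \<Sum>c\<in>C. cp i c) \<longlonglongrightarrow> 1"
    using cp_sum by (rule tendsto_eventually)
  ultimately show ?thesis by (rule LIMSEQ_unique)
qed

text \<open>The finite estimate divided by \<open>s i\<close>. With code and \<open>g\<close> fixed,
  the error terms are constants over \<open>s i\<close>, and the rest consists of finitely many
  cylinder weights, which converge.\<close>

lemma cross_entropy_bound:
  assumes g: "\<And>c. 0 \<le> g c" "\<And>c. c \<in> C \<Longrightarrow> g c \<le> Gm" and kraft: "(\<Sum>c\<in>C. exp (- g c)) \<le> 1"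
  shows "1 / 2 * ln p * (\<Sum>c\<in>C. real (length c) * measure \<mu> (cell p c)) \<le> (\<Sum>c\<in>C. g c * measure \<mu> (cell p c))"
proof (rule tendsto_le[OF sequentially_bot])
  define s where "s i = real (r i - 2 * M)" for i
  have s_inf: "filterlim s at_top sequentially"
  proof -
    have "\<forall>\<^sub>F i in sequentially. K \<le> s i" for K
      using r_large[of "nat \<lceil>K\<rceil> + 2 * M"] by eventually_elim (simp add: s_def, linarith)
    then show ?thesis by (simp add: filterlim_at_top)
  qed
  define E where "E i = (\<Sum>c\<in>C. real (length c) * cp i c)" for i
  have E: "E \<longlonglongrightarrow> (\<Sum>c\<in>C. real (length c) * measure \<mu> (cell p c))"
    unfolding E_def by (intro tendsto_intros cp_tendsto)
  have inv: "(\<lambda>i. a / s i) \<longlonglongrightarrow> 0" for a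
    by (rule tendsto_divide_0[OF tendsto_const filterlim_at_top_imp_at_infinity[OF s_inf]])
  let ?K = "real M * Gm + real M * real p ^ (2 * M)"
  have "(\<lambda>i. E i * ((1 - real M / s i) / 2 * ln p - ln M / s i)) \<longlonglongrightarrow>
      (\<Sum>c\<in>C. real (length c) * measure \<mu> (cell p c)) * ((1 - 0) / 2 * ln p - 0)"
    by (intro tendsto_intros E inv) simp
  then show "(\<lambda>i. E i * ((1 - real M / s i) / 2 * ln p - ln M / s i)) \<longlonglongrightarrow>
      1 / 2 * ln p * (\<Sum>c\<in>C. real (length c) * measure \<mu> (cell p c))" by (simp add: mult.commute)
  have "(\<lambda>i. (\<Sum>c\<in>C. g c * cp i c) + ?K / s i) \<longlonglongrightarrow> (\<Sum>c\<in>C. g c * measure \<mu> (cell p c)) + 0"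
    by (intro tendsto_intros cp_tendsto inv)
  then show "(\<lambda>i. (\<Sum>c\<in>C. g c * cp i c) + ?K / s i) \<longlonglongrightarrow> (\<Sum>c\<in>C. g c * measure \<mu> (cell p c))" by simp
  show "\<forall>\<^sub>F i in sequentially. E i * ((1 - real M / s i) / 2 * ln p - ln M / s i) \<le> (\<Sum>c\<in>C. g c * cp i c) + ?K / s i"
    using r_large[of "Suc (k0 + 2 * M)"]
  proof eventually_elim
    case (elim i)
    then have k0: "k0 \<le> r i" by simp
    then obtain K where "quantized_code p M L (r i) K (\<psi> (r i))" using quantized by blast
    then interpret quantized_code p M L "r i" K "\<psi> (r i)" .
    have sp: "0 < s i" using elim by (simp add: s_def)
    have el: "ell = E i" unfolding E_def by (rule ell_by_code)
    have gs: "(\<Sum>x\<in>words p (r i). prb x * g (cw x)) = (\<Sum>c\<in>C. g c * cp i c)"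
      using sum_by_code[of g] by (simp add: mult.commute)
    have "E i * ((s i - real M) / 2 * ln p - ln M) \<le> s i * (\<Sum>c\<in>C. g c * cp i c) + ?K"
      using entropy_inequality[OF g kraft, of "r i - 2 * M"] elim by (simp add: el gs s_def add.assoc)
    then have "E i * ((s i - real M) / 2 * ln p - ln M) / s i \<le> (s i * (\<Sum>c\<in>C. g c * cp i c) + ?K) / s i"
      using sp by (intro divide_right_mono) auto
    also have "\<dots> = (\<Sum>c\<in>C. g c * cp i c) + ?K / s i" using sp by (simp add: add_divide_distrib)
    also have "E i * ((s i - real M) / 2 * ln p - ln M) / s i = E i * ((1 - real M / s i) / 2 * ln p - ln M / s i)"
      using sp by (simp add: field_simps)
    finally show ?case .
  qed
qed

text \<open>Apply the cross entropy bound to the cell probabilities, mixed with the uniform distribution to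
  keep the logarithms finite.\<close>
lemma entropy_bound:
  "1 / 2 * ln p * (\<Sum>c\<in>C. real (length c) * measure \<mu> (cell p c))
     \<le> - (\<Sum>c\<in>C. measure \<mu> (cell p c) * ln (measure \<mu> (cell p c)))"
proof (rule field_le_epsilon)
  fix e :: real assume e: "0 < e"
  \<comment> \<open>Multiplying a probability by \<open>t\<close> lowers its logarithm by exactly
    \<open>e\<close>.\<close>
  define t where "t = exp (- e)"
  have t: "0 < t" "t < 1" using e by (auto simp: t_def)
  define m where "m c = measure \<mu> (cell p c)" for c
  have m01: "0 \<le> m c" "m c \<le> 1" for c by (auto simp: m_def)
  have cC: "0 < real (card C)" using C_nonempty finite_C by (simp add: card_gt_0_iff)
  \<comment> \<open>The uniform part: it completes the total mass of \<open>q\<close> to 1 and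
    bounds \<open>- ln (q c)\<close> by \<open>- ln u\<close>.\<close>
  define u where "u = (1 - t) / real (card C)"
  have u0: "0 < u" using t cC by (simp add: u_def)
  have "1 \<le> real (card C)" using cC by simp
  then have u: "0 < u" "u \<le> 1 - t"
    using u0 t cC by (auto simp: u_def divide_le_eq mult_le_cancel_left1)
  define q where "q c = t * m c + u" for c
  have q0: "0 < q c" for c using m01[of c] t u by (simp add: q_def add_nonneg_pos)
  have q1: "q c \<le> 1" for c
  proof -
    have "t * m c \<le> t" using m01(2)[of c] t by (simp add: mult_left_le)
    then show ?thesis using u by (simp add: q_def)
  qed
  have qu: "u \<le> q c" for c using m01[of c] t by (simp add: q_def)
  have "1 / 2 * ln p * (\<Sum>c\<in>C. real (length c) * m c) \<le> (\<Sum>c\<in>C. (- ln (q c)) * m c)"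
    unfolding m_def
  proof (rule cross_entropy_bound)
    show "0 \<le> - ln (q c)" for c using q0[of c] q1[of c] by simp
    show "- ln (q c) \<le> - ln u" for c using q0[of c] qu[of c] u by simp
    have "(\<Sum>c\<in>C. exp (- (- ln (q c)))) = t * (\<Sum>c\<in>C. m c) + (1 - t)"
      using q0 cC by (simp add: q_def sum.distrib sum_distrib_left u_def)
    then show "(\<Sum>c\<in>C. exp (- (- ln (q c)))) \<le> 1" using sum_cell by (simp add: m_def)
  qed
  also have "\<dots> \<le> (\<Sum>c\<in>C. - (m c * ln (m c)) + e * m c)"
  proof (intro sum_mono)
    fix c
    show "- ln (q c) * m c \<le> - (m c * ln (m c)) + e * m c"
    proof (cases "m c = 0")
      case False
      then have mp: "0 < m c" using m01(1)[of c] by linarith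
      have "ln (t * m c) \<le> ln (q c)" using mp t u q0[of c] by (simp add: q_def)
      then have "ln (m c) - e \<le> ln (q c)" using mp by (simp add: t_def ln_mult)
      then have "m c * (ln (m c) - e) \<le> m c * ln (q c)" using mp by (intro mult_left_mono) auto
      then show ?thesis by (simp add: algebra_simps)
    qed simp
  qed
  also have "\<dots> = - (\<Sum>c\<in>C. m c * ln (m c)) + e"
    using sum_cell by (simp add: sum.distrib sum_negf sum_subtractf sum_distrib_left[symmetric] m_def)
  finally show "1 / 2 * ln p * (\<Sum>c\<in>C. real (length c) * measure \<mu> (cell p c))
     \<le> - (\<Sum>c\<in>C. measure \<mu> (cell p c) * ln (measure \<mu> (cell p c))) + e"
    by (simp add: m_def)
qed

end

section \<open>Affine maps with p-adic slopes\<close>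

lemma prefix_code_comp:
  assumes "prefix_code p M1 L1" "prefix_code p M2 L2"
  shows "prefix_code p (M1 + M2) (\<lambda>x. L1 x + L2 (drop (L1 x) x))"
proof -
  interpret c1: prefix_code p M1 L1 by fact
  interpret c2: prefix_code p M2 L2 by fact
  have ge: "x \<in> words_ge p M1" "drop (L1 x) x \<in> words_ge p M2" if "x \<in> words_ge p (M1 + M2)" for x
  proof -
    show x: "x \<in> words_ge p M1" using that by (simp add: words_ge_def)
    show "drop (L1 x) x \<in> words_ge p M2" using that c1.L_le[OF x] c1.set_sh[of x] by (auto simp: words_ge_def c1.sh_def)
  qed
  show ?thesis
  proof
    show "2 \<le> p" by (rule c1.p2)
    fix x assume x: "x \<in> words_ge p (M1 + M2)"
    note x1 = ge[OF x]
    show "1 \<le> L1 x + L2 (drop (L1 x) x)" using c1.L_pos[OF x1(1)] by simp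
    show "L1 x + L2 (drop (L1 x) x) \<le> M1 + M2" using c1.L_le[OF x1(1)] c2.L_le[OF x1(2)] by simp
    fix y assume y: "y \<in> words_ge p (M1 + M2)"
      and t: "take (L1 x + L2 (drop (L1 x) x)) x = take (L1 x + L2 (drop (L1 x) x)) y"
    note y1 = ge[OF y]
    have "take (L1 x) (take (L1 x + L2 (drop (L1 x) x)) x) = take (L1 x) (take (L1 x + L2 (drop (L1 x) x)) y)"
      by (simp only: t)
    then have e1: "L1 y = L1 x" by (intro c1.L_prefix[OF x1(1) y1(1)]) (simp add: min_absorb1)
    have "drop (L1 x) (take (L1 x + L2 (drop (L1 x) x)) x) = drop (L1 x) (take (L1 x + L2 (drop (L1 x) x)) y)"
      by (simp only: t)
    then have "L2 (drop (L1 y) y) = L2 (drop (L1 x) x)"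
      using e1 by (intro c2.L_prefix[OF x1(2) y1(2)]) (simp add: drop_take)
    then show "L1 y + L2 (drop (L1 y) y) = L1 x + L2 (drop (L1 x) x)" using e1 by simp
  qed
qed

text \<open>The intermediate word is unique: its first codeword is known from \<open>x\<close>,
  since \<open>M1 + M2 \<le> k\<close> leaves enough digits of \<open>x\<close> in place, and its
  remaining digits are read off \<open>y\<close>. Hence the entry bounds multiply without a sum over
  paths.\<close>

lemma quantized_code_comp:
  assumes "quantized_code p M1 L1 k K1 \<psi>" "quantized_code p M2 L2 k K2 \<psi>" "M1 + M2 \<le> k"
  shows "quantized_code p (M1 + M2) (\<lambda>x. L1 x + L2 (drop (L1 x) x)) k (mcomp (words p k) K2 K1) \<psi>"
proof -
  interpret c1: quantized_code p M1 L1 k K1 \<psi> by fact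
  interpret c2: quantized_code p M2 L2 k K2 \<psi> by fact
  interpret c: prefix_code p "M1 + M2" "\<lambda>x. L1 x + L2 (drop (L1 x) x)"
    by (rule prefix_code_comp) unfold_locales
  let ?W = "words p k"
  have path: "z = c2.cw (drop (L1 x) x) @ take (k - L2 (drop (L1 x) x)) y \<and> L2 z = L2 (drop (L1 x) x) \<and>
      take (k - (L1 x + L2 (drop (L1 x) x))) y = drop (L1 x + L2 (drop (L1 x) x)) x"
    if x: "x \<in> ?W" and y: "y \<in> ?W" and z: "z \<in> ?W" and nz: "K2 y z \<noteq> 0" "K1 z x \<noteq> 0" for x y z
  proof -
    have LM: "L1 x \<le> M1" by (rule c1.L_le[OF c1.w_ge[OF x]])
    have t1: "take (k - L1 x) z = drop (L1 x) x" by (rule c1.K_supp[OF x z nz(2)])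
    have t2: "take (k - L2 z) y = drop (L2 z) z" by (rule c2.K_supp[OF z y nz(1)])
    have Lz: "L2 z = L2 (drop (L1 x) x)" "c2.cw z = c2.cw (drop (L1 x) x)"
      using c2.L_take[OF c2.w_ge[OF z], of "k - L1 x"] LM assms(3) t1 by auto
    have "take (k - (L1 x + L2 z)) y = take (k - (L1 x + L2 z)) (take (k - L2 z) y)" by (simp add: min_absorb1)
    also have "\<dots> = drop (L2 z) (take (k - L1 x) z)" unfolding t2 by (simp add: drop_take diff_diff_left)
    also have "\<dots> = drop (L1 x + L2 z) x" unfolding t1 by (simp add: add.commute)
    finally show ?thesis using c2.cw_sh[of z] t2 Lz by (simp add: c2.sh_def)
  qed
  show ?thesis
  proof
    show "M1 + M2 \<le> k" by fact
    show "miso ?W (mcomp ?W K2 K1)" by (rule miso_mcomp[OF finite_words c2.K_iso c1.K_iso])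
    show "(\<Sum>x\<in>?W. (cmod (\<psi> x))\<^sup>2) = 1" by (rule c1.norm1)
    show "mapp ?W (mcomp ?W K2 K1) \<psi> y = \<psi> y" if "y \<in> ?W" for y
      using mapp_cong[of ?W "mapp ?W K1 \<psi>" \<psi> K2 y] c1.fixed c2.fixed[OF that] by (simp add: mapp_mcomp)
    fix x y assume x: "x \<in> ?W" and y: "y \<in> ?W"
    show "take (k - (L1 x + L2 (drop (L1 x) x))) y = drop (L1 x + L2 (drop (L1 x) x)) x"
      if "mcomp ?W K2 K1 y x \<noteq> 0"
    proof -
      obtain z where "z \<in> ?W" "K2 y z * K1 z x \<noteq> 0"
        using \<open>mcomp ?W K2 K1 y x \<noteq> 0\<close> unfolding mcomp_def mapp_def by (meson sum.neutral)
      then show ?thesis using path[OF x y] by auto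
    qed
    show "cmod (mcomp ?W K2 K1 y x) \<le> (1 / sqrt p) ^ (L1 x + L2 (drop (L1 x) x))"
      unfolding mcomp_def mapp_def
    proof (rule cmod_sum_single[OF finite_words])
      fix z assume z: "z \<in> ?W"
      show "cmod (K2 y z * K1 z x) \<le> (1 / sqrt p) ^ (L1 x + L2 (drop (L1 x) x))"
      proof (cases "K2 y z * K1 z x = 0")
        case False
        then have nz: "K2 y z \<noteq> 0" "K1 z x \<noteq> 0" by auto
        from path[OF x y z nz] have "L2 z = L2 (drop (L1 x) x)" by blast
        then have b2: "cmod (K2 y z) \<le> (1 / sqrt p) ^ L2 (drop (L1 x) x)" using c2.K_bound[OF z y] by simp
        have "cmod (K2 y z) * cmod (K1 z x) \<le> (1 / sqrt p) ^ L2 (drop (L1 x) x) * (1 / sqrt p) ^ L1 x"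
          by (rule mult_mono[OF b2 c1.K_bound[OF x z]]) auto
        then show ?thesis by (simp add: norm_mult power_add mult.commute)
      next
        case True
        show ?thesis unfolding True by simp
      qed
      fix z' assume z': "z' \<in> ?W" and n: "K2 y z * K1 z x \<noteq> 0" "K2 y z' * K1 z' x \<noteq> 0"
      then have nz: "K2 y z \<noteq> 0" "K1 z x \<noteq> 0" "K2 y z' \<noteq> 0" "K1 z' x \<noteq> 0" by auto
      from path[OF x y z nz(1,2)] path[OF x y z' nz(3,4)] show "z = z'" by metis
    qed simp
  qed
qed

text \<open>\<open>cond1\<close> puts the left endpoint of branch \<open>j\<close> on the grid of
  mesh \<open>p\<close> to the power \<open>- n j\<close>, so each branch interval is a cylinder of
  length \<open>n j\<close>.\<close>

locale affine_digit_map =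
  fixes p l :: nat and n :: "nat \<Rightarrow> nat"
  assumes p2: "2 \<le> p" and n_pos: "\<forall>j<l. 1 \<le> n j"
    and sum1: "(\<Sum>j<l. 1 / real p ^ n j) = 1"
    and cond1: "\<forall>j<l. real p ^ n j * aL p n j \<in> \<int>"
begin

definition "nmax = Max (n ` {..<l})"

abbreviation a :: "nat \<Rightarrow> real" where "a \<equiv> aL p n"

text \<open>Half-open for every branch, unlike \<open>Ipart\<close>, whose last interval contains 1;
  that point is treated separately.\<close>

definition I :: "nat \<Rightarrow> real set" where "I j = {a j ..< a (Suc j)}"

lemma n_le: "j < l \<Longrightarrow> n j \<le> nmax" by (simp add: nmax_def)

lemma p_pos: "0 < real p ^ m" using p2 by simp

lemma a_Suc: "a (Suc j) = a j + 1 / real p ^ n j" by (simp add: aL_def)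

lemma a_0: "a 0 = 0" by (simp add: aL_def)

lemma a_l: "a l = 1" using sum1 by (simp add: aL_def)

lemma a_strict_mono: "strict_mono a"
  using p_pos by (intro strict_monoI_Suc) (simp add: a_Suc)

lemma a_mono: "i \<le> j \<Longrightarrow> a i \<le> a j" using a_strict_mono by (simp add: strict_mono_less_eq)

lemma l_pos: "0 < l" using sum1 by (cases l) auto

lemma I_unique:
  assumes "y \<in> I i" "y \<in> I j"
  shows "i = j"
proof -
  have "\<not> i < j" using assms a_mono[of "Suc i" j] by (auto simp: I_def)
  moreover have "\<not> j < i" using assms a_mono[of "Suc j" i] by (auto simp: I_def)
  ultimately show ?thesis by simp
qed

lemma I_cover:
  assumes "0 \<le> y" "y < 1"
  obtains j where "j < l" "y \<in> I j"
proof -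
  have "y < a m \<Longrightarrow> \<exists>j<m. y \<in> I j" for m
  proof (induction m)
    case 0
    then show ?case using assms by (simp add: a_0)
  next
    case (Suc m)
    show ?case
    proof (cases "y < a m")
      case True
      then show ?thesis using Suc.IH less_Suc_eq by blast
    next
      case False
      then show ?thesis using Suc.prems by (auto simp: I_def)
    qed
  qed
  from this[of l] show ?thesis using assms a_l that by auto
qed

lemma I_subset: "j < l \<Longrightarrow> I j \<subseteq> {0..<1}"
  using a_mono[of 0 j] a_mono[of "Suc j" l] by (auto simp: I_def a_0 a_l)

lemma a_mem_I: "a j \<in> I j" using p_pos by (simp add: I_def a_Suc)

text \<open>Both sides are integer multiples of \<open>1 / p ^ n j\<close> and differ by less than
  that unit.\<close>

lemma prefix_cval:
  assumes "set x \<subseteq> {..<p}" "nmax \<le> length x" "j < l" "cval p x \<in> I j"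
  shows "cval p (take (n j) x) = a j"
proof -
  have nj: "n j \<le> length x" using n_le[OF assms(3)] assms(2) by simp
  let ?u = "take (n j) x"
  obtain i where i: "cval p ?u * real p ^ n j = real i" using cval_nat[of p ?u] p2 nj by (auto simp: min_absorb2)
  obtain z where z: "real p ^ n j * a j = of_int z" using cond1 assms(3) by (auto elim: Ints_cases)
  have "cval p ?u \<le> cval p x" "cval p x < cval p ?u + 1 / real p ^ n j"
    using cval_lt_next[OF p2 assms(1) nj] p_pos[of "length x"] by (auto intro: less_le_trans[rotated])
  then have "\<bar>cval p ?u - a j\<bar> < 1 / real p ^ n j" using assms(4) by (auto simp: I_def a_Suc)
  then have "\<bar>cval p ?u - a j\<bar> * real p ^ n j < 1" using p_pos[of "n j"] by (simp add: less_divide_eq)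
  then have "\<bar>(cval p ?u - a j) * real p ^ n j\<bar> < 1" using p_pos[of "n j"] by (simp add: abs_mult)
  moreover have "(cval p ?u - a j) * real p ^ n j = of_int (int i - z)"
    using i z by (simp add: algebra_simps)
  ultimately have "\<bar>int i - z\<bar> < 1" by (metis of_int_abs of_int_less_1_iff)
  then have "int i = z" by simp
  then have "cval p ?u * real p ^ n j = a j * real p ^ n j" using i z by (simp add: mult.commute)
  then show ?thesis using p2 by simp
qed

lemma widx_eq:
  assumes x: "x \<in> words_ge p nmax" and j: "j < l" "cval p x \<in> I j"
  shows "widx p l n x = j"
  unfolding widx_def
proof (rule the_equality)
  have x': "set x \<subseteq> {..<p}" "nmax \<le> length x" using x by (auto simp: words_ge_def)
  have "n j \<le> length x" using n_le[OF j(1)] x'(2) by simp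
  then show "j < l \<and> cyl p x \<subseteq> {a j..a (Suc j)}"
    using cval_lt_next[OF p2 x'(1), of "n j"] prefix_cval[OF x' j] j by (auto simp: cyl_def a_Suc)
  fix i assume i: "i < l \<and> cyl p x \<subseteq> {a i..a (Suc i)}"
  moreover have "cval p x \<in> cyl p x" "cval p x + 1 / real p ^ length x \<in> cyl p x"
    using p_pos[of "length x"] by (auto simp: cyl_def)
  ultimately have "cval p x \<in> {a i..a (Suc i)}" "cval p x + 1 / real p ^ length x \<in> {a i..a (Suc i)}" by blast+
  \<comment> \<open>Positive length makes the bound of the left endpoint by \<open>a (Suc i)\<close>
    strict, so the closed intervals in \<open>widx\<close> still determine \<open>i\<close>.\<close>
  moreover have "0 < 1 / real p ^ length x" using p2 by simp
  ultimately have "cval p x \<in> I i" unfolding I_def atLeastAtMost_iff atLeastLessThan_iff by linarith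
  then show "i = j" using I_unique j(2) by blast
qed

lemma widx:
  assumes x: "x \<in> words_ge p nmax"
  shows "widx p l n x < l" "cval p x \<in> I (widx p l n x)" "cval p (take (n (widx p l n x)) x) = a (widx p l n x)"
proof -
  have x': "set x \<subseteq> {..<p}" "nmax \<le> length x" using x by (auto simp: words_ge_def)
  obtain j where j: "j < l" "cval p x \<in> I j" using I_cover[OF cval_nonneg cval_lt_1[OF p2 x'(1)]] .
  have w: "widx p l n x = j" by (rule widx_eq[OF x j])
  show "widx p l n x < l" "cval p x \<in> I (widx p l n x)" using j w by auto
  show "cval p (take (n (widx p l n x)) x) = a (widx p l n x)" unfolding w by (rule prefix_cval[OF x' j])
qed

definition len :: "nat list \<Rightarrow> nat" where "len x = n (widx p l n x)"

text \<open>The codewords are the digit words of the branch intervals: a word that agrees with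
  \<open>x\<close> on \<open>len x\<close> digits has its left endpoint in the same
  interval.\<close>

lemma prefix_code_len: "prefix_code p nmax len"
proof
  show "2 \<le> p" by (rule p2)
  fix x assume x: "x \<in> words_ge p nmax"
  show "1 \<le> len x" "len x \<le> nmax" using widx(1)[OF x] n_pos n_le by (auto simp: len_def)
  fix y assume y: "y \<in> words_ge p nmax" and t: "take (len x) x = take (len x) y"
  let ?j = "widx p l n x"
  have y': "set y \<subseteq> {..<p}" "nmax \<le> length y" using y by (auto simp: words_ge_def)
  have ly: "len x \<le> length y" using y' \<open>len x \<le> nmax\<close> by simp
  have "cval p (take (len x) y) = a ?j" using widx(3)[OF x] t by (simp add: len_def)
  then have "cval p y \<in> I ?j" using cval_lt_next[OF p2 y'(1) ly] p_pos[of "length y"] unfolding I_def a_Suc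
    by (auto simp: len_def intro: less_le_trans[rotated])
  then show "len y = len x" using widx_eq[OF y widx(1)[OF x]] by (simp add: len_def)
qed

text \<open>Total length of the first \<open>m\<close> codewords. For \<open>m = 0\<close> the
  positivity required of a code fails, so codes are built from \<open>lenm (Suc m)\<close>.\<close>

fun lenm :: "nat \<Rightarrow> nat list \<Rightarrow> nat" where
  "lenm 0 x = 0"
| "lenm (Suc m) x = len x + lenm m (drop (len x) x)"

lemma lenm_fun: "lenm (Suc m) = (\<lambda>x. len x + lenm m (drop (len x) x))"
  by auto

lemma prefix_code_lenm: "prefix_code p (Suc m * nmax) (lenm (Suc m))"
proof (induction m)
  case 0
  then show ?case using prefix_code_len by (simp add: lenm_fun)
next
  case (Suc m)
  show ?case using prefix_code_comp[OF prefix_code_len Suc] unfolding lenm_fun[of "Suc m"] by simp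
qed

lemma quantized_code_lenm:
  assumes "quantized_code p nmax len k K \<psi>" "Suc m * nmax \<le> k"
  shows "\<exists>K'. quantized_code p (Suc m * nmax) (lenm (Suc m)) k K' \<psi>"
  using assms(2)
proof (induction m)
  case 0
  then show ?case using assms(1) by (auto simp: lenm_fun)
next
  case (Suc m)
  then have "Suc m * nmax \<le> k" by simp
  then obtain K' where K': "quantized_code p (Suc m * nmax) (lenm (Suc m)) k K' \<psi>" using Suc.IH by blast
  show ?case using quantized_code_comp[OF assms(1) K'] Suc.prems unfolding lenm_fun[of "Suc m"] by auto
qed

text \<open>The length of \<open>m + 1\<close> blocks is that of the first block plus that of
  \<open>m\<close> blocks of the shifted word, and the latter has the same mean by
  invariance.\<close>

lemma sum_lenm:
  assumes "quantized_code p nmax len k K \<psi>" "Suc m * nmax \<le> k"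
  shows "(\<Sum>x\<in>words p k. real (lenm m x) * (cmod (\<psi> x))\<^sup>2) = real m * (\<Sum>x\<in>words p k. real (len x) * (cmod (\<psi> x))\<^sup>2)"
proof -
  interpret quantized_code p nmax len k K \<psi> by fact
  show ?thesis using assms(2)
  proof (induction m)
    case (Suc m)
    have "(\<Sum>x\<in>words p k. real (lenm m (sh x)) * prb x) = (\<Sum>x\<in>words p k. real (lenm m x) * prb x)"
    proof (rule invariance)
      fix x y assume x: "x \<in> words p k" and y: "y \<in> words p k" and t: "take (k - len x) y = sh x"
      show "real (lenm m y) = real (lenm m (sh x))"
      proof (cases m)
        case (Suc m')
        interpret m: prefix_code p "Suc m' * nmax" "lenm (Suc m')" by (rule prefix_code_lenm)
        have "y \<in> words_ge p (Suc m' * nmax)" using y Suc.prems Suc by (auto intro!: words_geI)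
        from m.L_take(2)[OF this, of "k - len x"] show ?thesis
          using t Suc \<open>Suc (Suc m) * nmax \<le> k\<close> L_le[OF w_ge[OF x]] by simp
      qed simp
    qed
    moreover have "(\<Sum>x\<in>words p k. real (lenm m x) * prb x) = real m * (\<Sum>x\<in>words p k. real (len x) * prb x)"
      using Suc by (simp add: prb_def)
    ultimately show ?case
      by (simp add: distrib_right sum.distrib prb_def sh_def)
  qed simp
qed

end

section \<open>The tensorial quantization as a quantized code\<close>

lemma prod_lessThan_add_split:
  fixes f :: "nat \<Rightarrow> complex"
  shows "(\<Prod>i<m + k. f i) = (\<Prod>i<m. f i) * (\<Prod>i<k. f (m + i))"
  by (induction k) auto

text \<open>The image of a basis vector is a product vector; this is its component at position
  \<open>t\<close>: a basis vector on the shifted positions, a matrix column on the last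
  \<open>m\<close>.\<close>

definition amp_fac :: "(nat \<Rightarrow> nat \<Rightarrow> nat \<Rightarrow> complex) \<Rightarrow> nat \<Rightarrow> nat list \<Rightarrow> nat \<Rightarrow> nat \<Rightarrow> complex" where
  "amp_fac Ms m x t c = (if t < length x - m then (if c = x ! (t + m) then 1 else 0)
      else Ms (length x - t) c (x ! (length x - 1 - t)))"

context affine_digit_map
begin

lemma amp_eq_prod:
  assumes x: "x \<in> words p k" and y: "y \<in> words p k" and k: "nmax \<le> k"
  shows "amp p l n Ms y x = (\<Prod>t<k. amp_fac Ms (len x) x t (y ! t))"
proof -
  define m where "m = len x"
  have mk: "m \<le> k" using prefix_code.L_le[OF prefix_code_len words_geI[OF x k]] k by (simp add: m_def)
  have lx: "length x = k" "length y = k" using x y by (auto simp: words_iff)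
  have 1: "(\<Prod>t<k - m. amp_fac Ms m x t (y ! t)) = (if take (k - m) y = drop m x then 1 else 0)"
  proof (cases "take (k - m) y = drop m x")
    case True
    have "y ! t = x ! (t + m)" if "t < k - m" for t
      using that arg_cong[OF True, of "\<lambda>w. w ! t"] lx by (simp add: add.commute)
    then have "(\<Prod>t<k - m. amp_fac Ms m x t (y ! t)) = 1" by (intro prod.neutral) (auto simp: amp_fac_def lx)
    then show ?thesis using True by simp
  next
    case False
    then obtain t where t: "t < k - m" "y ! t \<noteq> x ! (t + m)"
      by (auto simp: list_eq_iff_nth_eq lx add.commute)
    then have "(\<Prod>t<k - m. amp_fac Ms m x t (y ! t)) = 0"
      by (intro prod_zero bexI[of _ t]) (auto simp: amp_fac_def lx)
    then show ?thesis using False by simp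
  qed
  have 2: "(\<Prod>i<m. amp_fac Ms m x (k - m + i) (y ! (k - m + i))) = (\<Prod>i<m. Ms (Suc i) (y ! (k - 1 - i)) (x ! i))"
  proof -
    \<comment> \<open>The freed positions are filled in reverse order: position
      \<open>k - 1 - i\<close> receives digit \<open>i\<close> through the matrix of index
      \<open>Suc i\<close>.\<close>
    have "(\<Prod>i<m. amp_fac Ms m x (k - m + i) (y ! (k - m + i)))
      = (\<Prod>i<m. amp_fac Ms m x (k - m + (m - Suc i)) (y ! (k - m + (m - Suc i))))"
      by (rule prod.nat_diff_reindex[symmetric])
    also have "\<dots> = (\<Prod>i<m. Ms (Suc i) (y ! (k - 1 - i)) (x ! i))"
    proof (intro prod.cong refl)
      fix i assume "i \<in> {..<m}"
      then have "k - m + (m - Suc i) = k - 1 - i" "\<not> k - 1 - i < k - m" "k - (k - 1 - i) = Suc i" "k - 1 - (k - 1 - i) = i"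
        using mk by auto
      then show "amp_fac Ms m x (k - m + (m - Suc i)) (y ! (k - m + (m - Suc i))) = Ms (Suc i) (y ! (k - 1 - i)) (x ! i)"
        by (simp add: amp_fac_def lx)
    qed
    finally show ?thesis .
  qed
  have "amp p l n Ms y x = (if take (k - m) y = drop m x then (\<Prod>i<m. Ms (Suc i) (y ! (k - 1 - i)) (x ! i)) else 0)"
    by (simp add: amp_def Let_def lx m_def len_def)
  also have "\<dots> = (\<Prod>t<(k - m) + m. amp_fac Ms m x t (y ! t))"
    unfolding prod_lessThan_add_split 1 2 by simp
  finally show ?thesis using mk by (simp add: m_def)
qed

text \<open>Inner products of columns factor over positions. If the words differ at a digit inside
  both first codewords, two columns of one unitary matrix are orthogonal there. Otherwise the prefix
  property forces equal codeword lengths, and the words differ at a digit that is only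
  shifted.\<close>

lemma miso_amp:
  assumes k: "nmax \<le> k" and mats: "tensorial_mats p nmax Ms"
  shows "miso (words p k) (amp p l n Ms)"
  unfolding miso_def
proof (intro ballI)
  interpret prefix_code p nmax len by (rule prefix_code_len)
  fix x x' assume x: "x \<in> words p k" and x': "x' \<in> words p k"
  define G where "G t = (\<Sum>c<p. cnj (amp_fac Ms (len x) x t c) * amp_fac Ms (len x') x' t c)" for t
  have w: "x \<in> words_ge p nmax" "x' \<in> words_ge p nmax" using x x' k by (auto intro: words_geI)
  have lx: "length x = k" "length x' = k" using x x' by (auto simp: words_iff)
  have dig: "x ! i < p" "x' ! i < p" if "i < k" for i
    using x x' that by (auto simp: words_iff lx dest!: subsetD[OF _ nth_mem])
  have le: "len x \<le> nmax" "len x' \<le> nmax" using L_le w by auto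
  have "(\<Sum>y\<in>words p k. cnj (amp p l n Ms y x) * amp p l n Ms y x')
    = (\<Sum>y\<in>words p k. \<Prod>t<k. cnj (amp_fac Ms (len x) x t (y ! t)) * amp_fac Ms (len x') x' t (y ! t))"
    by (intro sum.cong refl) (simp add: amp_eq_prod[OF x _ k] amp_eq_prod[OF x' _ k] prod.distrib)
  also have "\<dots> = (\<Prod>t<k. G t)" unfolding G_def by (rule sum_words_prod)
  finally have eq: "(\<Sum>y\<in>words p k. cnj (amp p l n Ms y x) * amp p l n Ms y x') = (\<Prod>t<k. G t)" .
  \<comment> \<open>Position \<open>k - 1 - i\<close> involves digit \<open>i\<close> and matrix
    \<open>Suc i\<close> for both words, even if their codeword lengths differ, since it is counted
    from the right end.\<close>
  have block: "G (k - 1 - i) = (if x ! i = x' ! i then 1 else 0)" if i: "i < len x" "i < len x'" for i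
  proof -
    have ik: "i < k" using i le k by simp
    have s: "\<not> k - 1 - i < k - len x" "\<not> k - 1 - i < k - len x'" "k - (k - 1 - i) = Suc i" "k - 1 - (k - 1 - i) = i"
      using i le k by auto
    have "G (k - 1 - i) = (\<Sum>c<p. cnj (Ms (Suc i) c (x ! i)) * Ms (Suc i) c (x' ! i))"
      unfolding G_def amp_fac_def lx s(3,4) using s(1,2) by simp
    moreover have "Suc i \<in> {1..nmax}" using i le by simp
    ultimately show ?thesis using mats dig[OF ik] unfolding tensorial_mats_def by auto
  qed
  have shift: "G t = (if x ! (t + len x) = x' ! (t + len x) then 1 else 0)" if t: "t < k - len x" "len x' = len x" for t
  proof -
    have "G t = (\<Sum>c<p. if c = x ! (t + len x) then (if c = x' ! (t + len x) then 1 else 0) else 0)"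
      unfolding G_def amp_fac_def lx using t by (intro sum.cong refl) auto
    then show ?thesis using dig[of "t + len x"] t by simp
  qed
  show "(\<Sum>y\<in>words p k. cnj (amp p l n Ms y x) * amp p l n Ms y x') = (if x = x' then 1 else 0)"
  proof (cases "x = x'")
    case True
    have "G t = 1" if "t < k" for t
    proof (cases "t < k - len x")
      case True
      then show ?thesis using shift[of t, unfolded \<open>x = x'\<close>[symmetric]] by simp
    next
      case False
      then have "k - 1 - t < len x" using that by simp
      then have "G (k - 1 - (k - 1 - t)) = 1" using block[of "k - 1 - t", unfolded \<open>x = x'\<close>[symmetric]] by simp
      moreover have "k - 1 - (k - 1 - t) = t" using that by simp
      ultimately show ?thesis by simp
    qed
    then show ?thesis unfolding eq using True by simp
  next
    case False
    have "\<exists>t<k. G t = 0"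
    proof (cases "\<exists>i. i < len x \<and> i < len x' \<and> x ! i \<noteq> x' ! i")
      case True
      then obtain i where i: "i < len x" "i < len x'" "x ! i \<noteq> x' ! i" by auto
      then have "k - 1 - i < k" using le k by simp
      then show ?thesis using block[OF i(1,2)] i(3) by (intro exI[of _ "k - 1 - i"]) simp
    next
      case False
      then have same: "x ! i = x' ! i" if "i < len x" "i < len x'" for i using that by auto
      have ll: "len x' = len x"
      proof (cases "len x \<le> len x'")
        case True
        have "take (len x) x = take (len x) x'" using same True le k by (auto simp: list_eq_iff_nth_eq lx)
        then show ?thesis by (rule L_prefix[OF w])
      next
        case False
        have "take (len x') x' = take (len x') x" using same False le k by (auto simp: list_eq_iff_nth_eq lx)
        then show ?thesis using L_prefix[OF w(2,1)] by simp
      qed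
      obtain i where i: "i < k" "x ! i \<noteq> x' ! i" using \<open>x \<noteq> x'\<close> by (auto simp: list_eq_iff_nth_eq lx)
      have "\<not> i < len x" using same i(2) ll by auto
      then have "i - len x < k - len x" "i - len x + len x = i" using i(1) by auto
      moreover from this have "G (i - len x) = 0" using shift[OF _ ll, of "i - len x"] i(2) by simp
      ultimately show ?thesis by (intro exI[of _ "i - len x"]) simp
    qed
    then show ?thesis unfolding eq using False by (auto simp: prod_zero_iff)
  qed
qed

lemma amp_bound:
  assumes x: "x \<in> words p k" and y: "y \<in> words p k" and k: "nmax \<le> k" and mats: "tensorial_mats p nmax Ms"
  shows "cmod (amp p l n Ms y x) \<le> (1 / sqrt p) ^ len x"
proof -
  have le: "len x \<le> nmax" using prefix_code.L_le[OF prefix_code_len words_geI[OF x k]] .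
  have lx: "length x = k" "length y = k" using x y by (auto simp: words_iff)
  have dig: "x ! i < p" "y ! i < p" if "i < k" for i
    using x y that by (auto simp: words_iff lx dest!: subsetD[OF _ nth_mem])
  have "cmod (\<Prod>i<len x. Ms (Suc i) (y ! (k - 1 - i)) (x ! i)) = (\<Prod>i<len x. 1 / sqrt p)"
    unfolding prod_norm[symmetric]
  proof (intro prod.cong refl)
    fix i assume "i \<in> {..<len x}"
    then have "Suc i \<in> {1..nmax}" "i < k" "k - 1 - i < k" using le k by auto
    then show "cmod (Ms (Suc i) (y ! (k - 1 - i)) (x ! i)) = 1 / sqrt p"
      using mats dig unfolding tensorial_mats_def by blast
  qed
  then show ?thesis by (simp add: amp_def Let_def lx len_def[symmetric])
qed

text \<open>Unitarity forces \<open>lam\<close> to have modulus 1, so dividing by it preserves the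
  isometry and the entry bounds and makes \<open>\<psi>\<close> a fixed vector.\<close>

lemma quantized_code_amp:
  assumes k: "nmax \<le> k" and mats: "tensorial_mats p nmax Ms"
    and norm1: "(\<Sum>w\<in>words p k. (cmod (\<psi> w))\<^sup>2) = 1"
    and eig: "\<And>y. y \<in> words p k \<Longrightarrow> Uapply p l n Ms \<psi> y = lam * \<psi> y"
  shows "quantized_code p nmax len k (\<lambda>y x. amp p l n Ms y x / lam) \<psi>"
proof -
  interpret prefix_code p nmax len by (rule prefix_code_len)
  have ap: "mapp (words p k) (amp p l n Ms) \<psi> y = lam * \<psi> y" if "y \<in> words p k" for y
    using eig[OF that] that by (simp add: Uapply_def mapp_def words_iff)
  have "1 = (\<Sum>y\<in>words p k. (cmod (mapp (words p k) (amp p l n Ms) \<psi> y))\<^sup>2)"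
    using miso_norm[OF finite_words miso_amp[OF k mats], of \<psi>] norm1 by simp
  also have "\<dots> = (cmod lam)\<^sup>2 * (\<Sum>w\<in>words p k. (cmod (\<psi> w))\<^sup>2)"
    unfolding sum_distrib_left by (intro sum.cong refl) (simp add: ap norm_mult power_mult_distrib)
  finally have ev2: "(cmod lam)\<^sup>2 = 1" using norm1 by simp
  then have lam1: "cmod lam = 1" using norm_ge_zero[of lam] by (simp add: power2_eq_1_iff)
  then have lam0: "lam \<noteq> 0" by auto
  have evc: "cnj lam * lam = 1" using cmod_sq[of lam] ev2 by simp
  show ?thesis
  proof
    show "nmax \<le> k" "(\<Sum>w\<in>words p k. (cmod (\<psi> w))\<^sup>2) = 1" by fact+
    show "miso (words p k) (\<lambda>y x. amp p l n Ms y x / lam)"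
      using miso_amp[OF k mats] evc unfolding miso_def by (simp add: sum_divide_distrib[symmetric])
    show "mapp (words p k) (\<lambda>y x. amp p l n Ms y x / lam) \<psi> y = \<psi> y" if "y \<in> words p k" for y
      using ap[OF that] lam0 by (simp add: mapp_def sum_divide_distrib[symmetric])
    fix x y assume x: "x \<in> words p k" and y: "y \<in> words p k"
    show "cmod (amp p l n Ms y x / lam) \<le> (1 / sqrt p) ^ len x"
      using amp_bound[OF x y k mats] by (simp add: norm_divide lam1)
    show "take (k - len x) y = drop (len x) x" if "amp p l n Ms y x / lam \<noteq> 0"
      using that x by (auto simp: amp_def Let_def words_iff len_def split: if_splits)
  qed
qed

section \<open>Itineraries and the dynamical partition\<close>

abbreviation T :: "real \<Rightarrow> real" where "T \<equiv> Tmap p l n"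

lemma Ipart_eq:
  assumes "j < l"
  shows "Ipart p l n j = I j \<union> (if j = l - 1 then {1} else {})"
proof (cases "j = l - 1")
  case True
  then have "Suc j = l" using assms by simp
  then have "a (Suc j) = 1" "a j < 1" using a_l a_strict_mono strict_monoD[of a j "Suc j"] by auto
  then show ?thesis using True by (auto simp: Ipart_def I_def)
qed (simp add: Ipart_def I_def)

lemma jidx_eq:
  assumes "j < l" "y \<in> I j"
  shows "jidx p l n y = j"
  unfolding jidx_def
proof (rule the_equality)
  show "j < l \<and> y \<in> Ipart p l n j" using assms by (simp add: Ipart_eq)
  fix i assume i: "i < l \<and> y \<in> Ipart p l n i"
  have "y \<noteq> 1" using I_subset[OF assms(1)] assms(2) by auto
  then have "y \<in> I i" using i by (auto simp: Ipart_eq split: if_splits)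
  then show "i = j" using I_unique assms(2) by blast
qed

text \<open>On \<open>I j\<close> the integer part of \<open>p ^ n j * y\<close> is
  \<open>p ^ n j * a j\<close>, an integer by \<open>cond1\<close>.\<close>

lemma T_eq:
  assumes "j < l" "y \<in> I j"
  shows "T y = real p ^ n j * (y - a j)"
proof -
  have "0 \<le> real p ^ n j * (y - a j)" "real p ^ n j * (y - a j) < 1"
    using assms(2) p_pos[of "n j"] by (auto simp: I_def a_Suc field_simps)
  then have "frac (real p ^ n j * y) = real p ^ n j * (y - a j)"
    using cond1 assms(1) by (subst frac_unique_iff) (simp add: right_diff_distrib)
  then show ?thesis by (simp add: Tmap_def jidx_eq[OF assms])
qed

lemma T_1: "T 1 = 0"
proof -
  have "real p ^ m \<in> \<int>" for m by simp
  then show ?thesis by (simp add: Tmap_def frac_eq_0_iff)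
qed

lemma T_0: "T 0 = 0"
  by (simp add: Tmap_def)

text \<open>Symbolic dynamics: a concatenation of \<open>m\<close> codewords prescribes the first
  \<open>m\<close> branches visited. The first branch maps the cell affinely onto the cell of the
  remaining codewords, which drives the induction.\<close>

lemma hcell_lenm:
  assumes "x \<in> words_ge p (m * nmax)"
  shows "\<exists>f. (\<forall>i<m. f i < l) \<and> hcell p (take (lenm m x) x) = {y \<in> {0..<1}. \<forall>i<m. (T ^^ i) y \<in> I (f i)}"
  using assms
proof (induction m arbitrary: x)
  case 0
  then show ?case by (auto simp: hcell_def)
next
  case (Suc m)
  interpret prefix_code p nmax len by (rule prefix_code_len)
  have x: "x \<in> words_ge p nmax" using Suc.prems by (simp add: words_ge_def)
  let ?x = "drop (len x) x"
  let ?j = "widx p l n x"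
  have "?x \<in> words_ge p (m * nmax)" using Suc.prems L_le[OF x] set_sh[of x] by (auto simp: words_ge_def sh_def)
  then obtain f where f: "\<forall>i<m. f i < l"
    "hcell p (take (lenm m ?x) ?x) = {y \<in> {0..<1}. \<forall>i<m. (T ^^ i) y \<in> I (f i)}" using Suc.IH by blast
  note j = widx[OF x]
  let ?c = "take (lenm m ?x) ?x"
  have eq: "take (lenm (Suc m) x) x = take (len x) x @ ?c" by (simp add: take_add)
  have lc: "length (take (len x) x) = n ?j" using length_cw[OF x] by (simp add: cw_def len_def)
  have cv: "cval p (take (len x) x) = a ?j" using j(3) by (simp add: len_def)
  have sub: "hcell p ?c \<subseteq> {0..<1}" unfolding f(2) by auto
  have split: "y \<in> hcell p (take (lenm (Suc m) x) x) \<longleftrightarrow> real p ^ n ?j * (y - a ?j) \<in> hcell p ?c" for y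
    unfolding eq hcell_def cval_append cv lc length_append power_add
    using p_pos[of "n ?j"] by (auto simp: field_simps)
  have unit: "real p ^ n ?j * (y - a ?j) \<in> {0..<1} \<longleftrightarrow> y \<in> I ?j" for y
    using p_pos[of "n ?j"] by (auto simp: I_def a_Suc field_simps)
  have "hcell p (take (lenm (Suc m) x) x) = {y \<in> {0..<1}. \<forall>i<Suc m. (T ^^ i) y \<in> I (case_nat ?j f i)}"
  proof (intro set_eqI)
    fix y
    have "y \<in> hcell p (take (lenm (Suc m) x) x) \<longleftrightarrow> y \<in> I ?j \<and> T y \<in> hcell p ?c"
      using split[of y] unit[of y] sub T_eq[OF j(1), of y] by auto
    also have "\<dots> \<longleftrightarrow> y \<in> I ?j \<and> (\<forall>i<m. (T ^^ Suc i) y \<in> I (f i))"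
      using unit[of y] T_eq[OF j(1), of y] by (auto simp: f(2) funpow_swap1)
    also have "\<dots> \<longleftrightarrow> y \<in> {y \<in> {0..<1}. \<forall>i<Suc m. (T ^^ i) y \<in> I (case_nat ?j f i)}"
      using I_subset[OF j(1)] by (auto simp: less_Suc_eq_0_disj)
    finally show "y \<in> hcell p (take (lenm (Suc m) x) x) \<longleftrightarrow> y \<in> {y \<in> {0..<1}. \<forall>i<Suc m. (T ^^ i) y \<in> I (case_nat ?j f i)}" .
  qed
  moreover have "\<forall>i<Suc m. case_nat ?j f i < l" using f(1) j(1) by (auto split: nat.split)
  ultimately show ?case by blast
qed

text \<open>The point \<open>1\<close> is the only one where \<open>T\<close> is not conjugate to the shift (\<open>T 1 = 0\<close>, while the top
  codeword repeats forever), and \<open>\<mu>\<close> may charge it, so it gets an atom of its own.\<close>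
definition P :: "real set set" where "P = insert {1} (I ` {..<l})"

lemma is_fpart_P:
  assumes sets: "sets \<mu> = sets (restrict_space borel {0..1})"
  shows "is_fpart \<mu> P"
proof -
  have sp: "space \<mu> = {0..1}" using sets_eq_imp_space_eq[OF sets] by (simp add: space_restrict_space)
  have "A \<in> sets \<mu>" if "A \<in> P" for A
  proof -
    have "A \<subseteq> {0..1}" using that I_subset unfolding P_def by fastforce
    moreover have "A \<in> sets borel" using that by (auto simp: P_def I_def)
    ultimately show ?thesis unfolding sets sets_restrict_space by (intro image_eqI[of _ _ A]) auto
  qed
  moreover have "disjoint P"
    unfolding disjoint_def
  proof (intro ballI impI)
    have 1: "1 \<notin> I j" if "j < l" for j using I_subset[OF that] by auto
    fix A B assume "A \<in> P" "B \<in> P" "A \<noteq> B"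
    then consider j where "A = {1}" "j < l" "B = I j" | j where "B = {1}" "j < l" "A = I j"
      | i j where "A = I i" "B = I j" "i \<noteq> j"
      by (auto simp: P_def)
    then show "A \<inter> B = {}" using 1 I_unique by cases auto
  qed
  moreover have "\<Union>P = space \<mu>"
  proof
    show "\<Union>P \<subseteq> space \<mu>" unfolding sp P_def using I_subset by fastforce
    show "space \<mu> \<subseteq> \<Union>P"
    proof
      fix y assume "y \<in> space \<mu>"
      then have y: "0 \<le> y" "y \<le> 1" by (auto simp: sp)
      show "y \<in> \<Union>P"
      proof (cases "y = 1")
        case False
        then have "y < 1" using y by simp
        with y(1) obtain j where "j < l" "y \<in> I j" by (rule I_cover)
        then show ?thesis by (auto simp: P_def)
      qed (simp add: P_def)
    qed
  qed
  ultimately show ?thesis by (auto simp: is_fpart_def P_def)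
qed

text \<open>The itineraries in \<open>dynref\<close> are arbitrary functions on all of
  \<open>nat\<close>; only their restrictions to \<open>{..<m}\<close> matter, and these are finite
  in number.\<close>

lemma finite_dynref: "finite (dynref \<mu> T P m)"
proof -
  have "dynref \<mu> T P m \<subseteq> (\<lambda>f. space \<mu> \<inter> (\<Inter>i<m. (T ^^ i) -` f i)) ` ({..<m} \<rightarrow>\<^sub>E P)"
  proof
    fix A assume "A \<in> dynref \<mu> T P m"
    then obtain f where f: "\<forall>i<m. f i \<in> P" "A = space \<mu> \<inter> (\<Inter>i<m. (T ^^ i) -` f i)" by (auto simp: dynref_def)
    then have "A = space \<mu> \<inter> (\<Inter>i<m. (T ^^ i) -` restrict f {..<m} i)" by auto
    moreover have "restrict f {..<m} \<in> {..<m} \<rightarrow>\<^sub>E P" using f(1) by auto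
    ultimately show "A \<in> (\<lambda>f. space \<mu> \<inter> (\<Inter>i<m. (T ^^ i) -` f i)) ` ({..<m} \<rightarrow>\<^sub>E P)" by blast
  qed
  moreover have "finite P" by (simp add: P_def)
  ultimately show ?thesis by (meson finite_PiE finite_imageI finite_lessThan finite_subset)
qed

text \<open>The point 1 goes to the fixed point 0 of \<open>T\<close>, so its itinerary is
  \<open>{1}\<close> followed by \<open>I 0\<close> forever, and the first entry already singles it
  out.\<close>

lemma one_in_dynref:
  assumes "space \<mu> = {0..1}"
  shows "{1} \<in> dynref \<mu> T P (Suc m)"
proof -
  have T0: "(T ^^ i) 0 = 0" for i by (induction i) (auto simp: T_0)
  have "(T ^^ Suc i) 1 = 0" for i by (simp only: funpow_Suc_right o_apply T_1 T0)
  then have m: "(T ^^ i) 1 \<in> (case i of 0 \<Rightarrow> {1} | Suc _ \<Rightarrow> I 0)" for i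
    using a_mem_I[of 0] by (cases i) (auto simp: a_0)
  have "(\<Inter>i<Suc m. (T ^^ i) -` (case i of 0 \<Rightarrow> {1} | Suc _ \<Rightarrow> I 0)) \<subseteq> (T ^^ 0) -` {1}" by force
  then have "{1} = space \<mu> \<inter> (\<Inter>i<Suc m. (T ^^ i) -` (case i of 0 \<Rightarrow> {1} | Suc _ \<Rightarrow> I 0))"
    using m assms by auto
  moreover have "\<forall>i<Suc m. (case i of 0 \<Rightarrow> {1} | Suc _ \<Rightarrow> I 0) \<in> P"
    using l_pos by (auto simp: P_def split: nat.split)
  ultimately show ?thesis unfolding dynref_def by blast
qed

lemma hcell_in_dynref:
  assumes "space \<mu> = {0..1}" "x \<in> words_ge p (Suc m * nmax)"
  shows "hcell p (take (lenm (Suc m) x) x) \<in> dynref \<mu> T P (Suc m)"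
proof -
  obtain f where f: "\<forall>i<Suc m. f i < l"
    "hcell p (take (lenm (Suc m) x) x) = {y \<in> {0..<1}. \<forall>i<Suc m. (T ^^ i) y \<in> I (f i)}"
    using hcell_lenm[OF assms(2)] by blast
  have "y \<in> {0..<1}" if "\<forall>i<Suc m. (T ^^ i) y \<in> I (f i)" for y
    using that[rule_format, of 0] I_subset[of "f 0"] f(1) by auto
  then have "hcell p (take (lenm (Suc m) x) x) = space \<mu> \<inter> (\<Inter>i<Suc m. (T ^^ i) -` I (f i))"
    unfolding f(2) assms(1) by fastforce
  moreover have "\<forall>i<Suc m. I (f i) \<in> P" using f(1) by (simp add: P_def)
  moreover have "hcell p (take (lenm (Suc m) x) x) \<noteq> {}" using p_pos by (simp add: hcell_def)
  ultimately show ?thesis unfolding dynref_def mem_Collect_eq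
    by (intro conjI exI[of _ "\<lambda>i. I (f i)"])
qed

end

section \<open>Kolmogorov--Sinai entropy\<close>

text \<open>The reason why splitting an atom does not lower the entropy.\<close>

lemma xlnx_superadditive:
  fixes x y :: real
  assumes "0 \<le> x" "0 \<le> y"
  shows "x * ln x + y * ln y \<le> (x + y) * ln (x + y)"
proof (cases "x = 0 \<or> y = 0")
  case False
  then have p: "0 < x" "0 < y" using assms by auto
  have "x * ln x \<le> x * ln (x + y)" "y * ln y \<le> y * ln (x + y)"
    using p by (auto intro!: mult_left_mono)
  then show ?thesis by (simp add: distrib_right)
qed auto

context affine_digit_map
begin

text \<open>Passing from cells to atoms of the refinement only splits 1 off the cell that contains
  it, which does not lower the entropy. Further members of the refinement contribute nonnegative
  terms.\<close>

lemma code_entropy_le_part_entropy: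
  assumes sc: "semiclassical_code p (Suc m * nmax) (lenm (Suc m)) \<psi> r \<mu> k0"
  defines "C \<equiv> prefix_code.C p (Suc m * nmax) (lenm (Suc m))"
  shows "- (\<Sum>c\<in>C. measure \<mu> (cell p c) * ln (measure \<mu> (cell p c))) \<le> part_entropy \<mu> (dynref \<mu> T P (Suc m))"
proof -
  interpret s: semiclassical_code p "Suc m * nmax" "lenm (Suc m)" \<psi> r \<mu> k0 by fact
  have sp: "space \<mu> = {0..1}" using sets_eq_imp_space_eq[OF s.sets_\<mu>] by (simp add: space_restrict_space)
  define \<eta> where "\<eta> A = - (measure \<mu> A * ln (measure \<mu> A))" for A
  have \<eta>0: "0 \<le> \<eta> A" for A
    using s.prob_le_1[of A] by (cases "measure \<mu> A = 0") (auto simp: \<eta>_def mult_nonneg_nonpos zero_less_measure_iff less_le)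
  have fC: "finite C" unfolding C_def by (rule s.finite_C)
  have CD: "set c \<subseteq> {..<p}" if "c \<in> C" for c using s.C_D(3) that by (simp add: C_def)
  have hsub: "hcell p c \<subseteq> {0..<1}" if "c \<in> C" for c
    using cval_le[OF p2 CD[OF that]] cval_nonneg[of p c] by (auto simp: hcell_def)
  have hs: "hcell p c \<in> sets \<mu>" if "c \<in> C" for c
    unfolding s.sets_\<mu> sets_restrict_space using hsub[OF that]
    by (intro image_eqI[of _ _ "hcell p c"]) (auto simp: hcell_def)
  have s1: "{1} \<in> sets \<mu>"
    unfolding s.sets_\<mu> sets_restrict_space by (intro image_eqI[of _ _ "{1}"]) auto
  have hne: "hcell p c \<noteq> {}" for c using p2 by (simp add: hcell_def)
  have hinj: "inj_on (hcell p) C"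
  proof (rule inj_onI, rule ccontr)
    fix c e assume "c \<in> C" "e \<in> C" "hcell p c = hcell p e" "c \<noteq> e"
    then show False using s.cell_disjoint[of c e] hne[of c] by (auto simp: C_def cell_def)
  qed
  let ?full = "\<lambda>c. cval p c + 1 / real p ^ length c = 1"
  \<comment> \<open>Distinct cells lie side by side, so at most one of them reaches 1 and
    \<open>\<eta> {1}\<close> is charged only once.\<close>
  have full_unique: "c = e" if "c \<in> C" "e \<in> C" "?full c" "?full e" for c e
    using s.C_ordered[of c e] cval_lt_1[OF p2 CD[OF that(1)]] cval_lt_1[OF p2 CD[OF that(2)]] that
    by (auto simp: C_def)
  have "(\<Sum>c\<in>C. \<eta> (cell p c)) \<le> (\<Sum>c\<in>C. \<eta> (hcell p c) + (if ?full c then \<eta> {1} else 0))"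
  proof (intro sum_mono)
    fix c assume c: "c \<in> C"
    show "\<eta> (cell p c) \<le> \<eta> (hcell p c) + (if ?full c then \<eta> {1} else 0)"
    proof (cases "?full c")
      case True
      have "hcell p c \<inter> {1} = {}" using hsub[OF c] by auto
      then have "measure \<mu> (cell p c) = measure \<mu> (hcell p c) + measure \<mu> {1}"
        unfolding cell_def using True s.finite_measure_Union[OF hs[OF c] s1] by simp
      then show ?thesis using True xlnx_superadditive[of "measure \<mu> (hcell p c)" "measure \<mu> {1}"]
        by (simp add: \<eta>_def)
    qed (simp add: cell_def)
  qed
  also have "\<dots> = (\<Sum>c\<in>C. \<eta> (hcell p c)) + (\<Sum>c\<in>C. if ?full c then \<eta> {1} else 0)"
    by (rule sum.distrib)
  also have "(\<Sum>c\<in>C. if ?full c then \<eta> {1} else 0) \<le> \<eta> {1}"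
  proof (cases "\<exists>e\<in>C. ?full e")
    case True
    then obtain e where e: "e \<in> C" "?full e" by auto
    then have "(\<Sum>c\<in>C. if ?full c then \<eta> {1} else 0) = (\<Sum>c\<in>C. if c = e then \<eta> {1} else 0)"
      using full_unique by (intro sum.cong refl if_cong) auto
    then show ?thesis using e(1) fC by simp
  next
    case False
    then have "(\<Sum>c\<in>C. if ?full c then \<eta> {1} else 0) = 0" by (intro sum.neutral) auto
    then show ?thesis using \<eta>0 by simp
  qed
  also have "(\<Sum>c\<in>C. \<eta> (hcell p c)) + \<eta> {1} = (\<Sum>A\<in>insert {1} (hcell p ` C). \<eta> A)"
  proof -
    have "{1} \<notin> hcell p ` C" using hsub by force
    then show ?thesis using fC hinj by (simp add: sum.reindex)
  qed
  also have "\<dots> \<le> (\<Sum>A\<in>dynref \<mu> T P (Suc m). \<eta> A)"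
  proof (intro sum_mono2 finite_dynref)
    have "hcell p c \<in> dynref \<mu> T P (Suc m)" if c: "c \<in> C" for c
    proof -
      obtain x where x: "x \<in> words p (Suc m * nmax)" "c = take (lenm (Suc m) x) x"
        using c unfolding C_def s.C_def s.cw_def by blast
      show ?thesis unfolding x(2) by (rule hcell_in_dynref[OF sp words_geI[OF x(1)]]) simp
    qed
    then show "insert {1} (hcell p ` C) \<subseteq> dynref \<mu> T P (Suc m)"
      using one_in_dynref[OF sp] by auto
  qed (use \<eta>0 in auto)
  finally show ?thesis by (simp add: \<eta>_def part_entropy_def sum_negf)
qed

text \<open>Codewords and branches correspond: \<open>w j\<close> is the word of length
  \<open>n j\<close> whose cylinder starts at \<open>a j\<close>, and its cell is
  \<open>Ipart p l n j\<close>, right end included for the last branch only.\<close>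

lemma sum_code_len:
  defines "D \<equiv> prefix_code.C p nmax len"
  shows "(\<Sum>c\<in>D. real (length c) * measure \<mu> (cell p c)) = (\<Sum>j<l. real (n j) * measure \<mu> (Ipart p l n j))"
proof -
  interpret c: prefix_code p nmax len by (rule prefix_code_len)
  have "\<exists>w\<in>words p (n j). cval p w = a j" if j: "j < l" for j
  proof -
    obtain z where z: "real p ^ n j * a j = of_int z" using cond1 j by (auto elim: Ints_cases)
    have aj: "0 \<le> a j" "a j < 1" using I_subset[OF j] a_mem_I[of j] by auto
    have "0 \<le> real_of_int z" using z aj p_pos[of "n j"] by (metis mult_nonneg_nonneg less_imp_le)
    then have z0: "0 \<le> z" by simp
    have "real_of_int z < real p ^ n j" using z aj p_pos[of "n j"] by (metis mult.right_neutral mult_strict_left_mono)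
    then have "nat z < p ^ n j" using z0 by (metis nat_less_iff of_int_less_iff of_int_of_nat_eq of_nat_power)
    from words_cval[OF p2 this] obtain w where "w \<in> words p (n j)" "cval p w = real (nat z) / real p ^ n j" by blast
    moreover have "real (nat z) = real p ^ n j * a j" using z z0 by simp
    ultimately show ?thesis using p2 by (intro bexI[of _ w]) auto
  qed
  then obtain w where w: "w j \<in> words p (n j)" "cval p (w j) = a j" if "j < l" for j by metis
  have w_code: "w j \<in> D" if j: "j < l" for j
  proof -
    \<comment> \<open>Padding with zeros keeps the left endpoint \<open>a j\<close>, so the first
      codeword of this word is \<open>w j\<close>.\<close>
    let ?x = "w j @ replicate (nmax - n j) 0"
    have x: "?x \<in> words p nmax" using w(1)[OF j] n_le[OF j] p2 by (auto simp: words_iff)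
    then have xg: "?x \<in> words_ge p nmax" by (simp add: words_geI)
    have "cval p (replicate i 0) = 0" for i by (simp add: cval_def)
    then have "cval p ?x = a j" using w[OF j] by (simp add: cval_append)
    then have "len ?x = n j" using widx_eq[OF xg j] a_mem_I by (simp add: len_def)
    then have "c.cw ?x = w j" using w(1)[OF j] by (simp add: c.cw_def words_iff)
    then show ?thesis unfolding D_def c.C_def using x by (metis image_eqI)
  qed
  have img: "w ` {..<l} = D"
  proof
    show "w ` {..<l} \<subseteq> D" using w_code by auto
    show "D \<subseteq> w ` {..<l}"
    proof
      fix c assume "c \<in> D"
      then obtain x where x: "x \<in> words p nmax" "c = c.cw x"
        unfolding D_def c.C_def by auto
      then have xg: "x \<in> words_ge p nmax" by (simp add: words_geI)
      note j = widx[OF xg]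
      let ?j = "widx p l n x"
      have c: "cval p c = a ?j" "length c = n ?j" "set c \<subseteq> {..<p}"
        using j(3) c.length_cw[OF xg] x by (auto simp: c.cw_def len_def words_iff dest: in_set_takeD)
      have "c = w ?j"
      proof (rule ccontr)
        assume "c \<noteq> w ?j"
        moreover have "length c = length (w ?j)" "set (w ?j) \<subseteq> {..<p}"
          using w(1)[OF j(1)] c(2) by (auto simp: words_iff)
        ultimately have "a ?j + 1 / real p ^ n ?j \<le> a ?j"
          using cval_distinct[OF p2 _ c(3), of "w ?j"] w(2)[OF j(1)] c(1,2) by simp
        moreover have "0 < 1 / real p ^ n ?j" using p2 by simp
        ultimately show False by linarith
      qed
      then show "c \<in> w ` {..<l}" using j(1) by (metis imageI lessThan_iff)
    qed
  qed
  have inj: "inj_on w {..<l}"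
  proof (rule inj_onI)
    fix i j assume ij: "i \<in> {..<l}" "j \<in> {..<l}" and "w i = w j"
    then have "cval p (w i) = cval p (w j)" by simp
    then have "a i = a j" using ij by (simp add: w(2))
    then show "i = j" using strict_mono_eq[OF a_strict_mono] by blast
  qed
  have val: "real (length (w j)) * measure \<mu> (cell p (w j)) = real (n j) * measure \<mu> (Ipart p l n j)" if j: "j < l" for j
  proof -
    have lw: "length (w j) = n j" using w(1)[OF j] by (simp add: words_iff)
    have h: "hcell p (w j) = I j" using w(2)[OF j] by (simp add: hcell_def I_def a_Suc lw)
    have "a (Suc j) = 1 \<longleftrightarrow> Suc j = l" using a_strict_mono a_l by (metis strict_mono_eq)
    then have "cval p (w j) + 1 / real p ^ length (w j) = 1 \<longleftrightarrow> j = l - 1"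
      using w(2)[OF j] j by (auto simp: a_Suc lw)
    then show ?thesis using h lw Ipart_eq[OF j] by (simp add: cell_def)
  qed
  show ?thesis unfolding img[symmetric] sum.reindex[OF inj] o_def by (intro sum.cong refl val) auto
qed

text \<open>The proportionality is exact for the states at each large finite level by
  \<open>sum_lenm\<close>, and both sides converge along \<open>r\<close>.\<close>

lemma sum_code_lenm:
  assumes sc: "semiclassical_code p (Suc m * nmax) (lenm (Suc m)) \<psi> r \<mu> k0"
    and sc1: "semiclassical_code p nmax len \<psi> r \<mu> k1"
  shows "(\<Sum>c\<in>prefix_code.C p (Suc m * nmax) (lenm (Suc m)). real (length c) * measure \<mu> (cell p c))
    = real (Suc m) * (\<Sum>c\<in>prefix_code.C p nmax len. real (length c) * measure \<mu> (cell p c))"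
    (is "?l = real (Suc m) * ?r")
proof -
  interpret s: semiclassical_code p "Suc m * nmax" "lenm (Suc m)" \<psi> r \<mu> k0 by fact
  interpret s1: semiclassical_code p nmax len \<psi> r \<mu> k1 by fact
  have 1: "(\<lambda>i. \<Sum>c\<in>s.C. real (length c) * s.cp i c) \<longlonglongrightarrow> ?l"
    by (intro tendsto_intros s.cp_tendsto)
  have 2: "(\<lambda>i. real (Suc m) * (\<Sum>c\<in>s1.C. real (length c) * s1.cp i c)) \<longlonglongrightarrow> real (Suc m) * ?r"
    by (intro tendsto_intros s1.cp_tendsto)
  have "\<forall>\<^sub>F i in sequentially. (\<Sum>c\<in>s.C. real (length c) * s.cp i c) = real (Suc m) * (\<Sum>c\<in>s1.C. real (length c) * s1.cp i c)"
    using s.r_large[of "k1 + Suc (Suc m) * nmax"]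
  proof eventually_elim
    case (elim i)
    then have k1: "k1 \<le> r i" and km: "Suc (Suc m) * nmax \<le> r i" "Suc m * nmax \<le> r i" by auto
    obtain K where "quantized_code p nmax len (r i) K (\<psi> (r i))" using s1.quantized[OF k1] by blast
    then interpret q1: quantized_code p nmax len "r i" K "\<psi> (r i)" .
    obtain K' where "quantized_code p (Suc m * nmax) (lenm (Suc m)) (r i) K' (\<psi> (r i))"
      using quantized_code_lenm[OF q1.quantized_code_axioms km(2)] by blast
    then interpret q: quantized_code p "Suc m * nmax" "lenm (Suc m)" "r i" K' "\<psi> (r i)" .
    show ?case
      using sum_lenm[OF q1.quantized_code_axioms km(1)]
      unfolding q.ell_by_code[symmetric] q1.ell_by_code[symmetric]
      unfolding q.ell_def q1.ell_def q.prb_def q1.prb_def .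
  qed
  from LIMSEQ_unique[OF Lim_transform_eventually[OF 1 this] 2] show ?thesis .
qed

end

theorem theorem3:
  fixes p l :: nat and n :: "nat \<Rightarrow> nat"
    and Ms :: "nat \<Rightarrow> nat \<Rightarrow> nat \<Rightarrow> nat \<Rightarrow> complex"
    and \<psi> :: "nat \<Rightarrow> nat list \<Rightarrow> complex"
    and \<mu> :: "real measure"
  defines "nmax \<equiv> Max (n ` {..<l})"
  assumes p: "p \<ge> 2"
    and n_pos: "\<forall>j<l. n j \<ge> 1"
    and sum1: "(\<Sum>j<l. 1 / real p ^ n j) = 1"
    and cond1: "\<forall>j<l. real p ^ n j * aL p n j \<in> \<int>"
    and quant: "\<forall>k\<ge>nmax. tensorial_mats p nmax (Ms k)"
    and eig: "\<forall>k\<ge>nmax. (\<Sum>w\<in>words p k. (cmod (\<psi> k w))\<^sup>2) = 1 \<and>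
                 (\<exists>ev. \<forall>y\<in>words p k. Uapply p l n (Ms k) (\<psi> k) y = ev * \<psi> k y)"
    and sc: "semiclassical p \<psi> \<mu>"
  shows "ks_entropy \<mu> (Tmap p l n) \<ge>
           ereal (1/2 * (\<Sum>j<l. measure \<mu> (Ipart p l n j) * ln (real p ^ n j)))"
proof -
  interpret A: affine_digit_map p l n by unfold_locales fact+
  have nm: "A.nmax = nmax" by (simp add: A.nmax_def nmax_def)
  obtain r where r: "strict_mono r"
    and conv: "\<And>f. continuous_on {0..1} f \<Longrightarrow> (\<lambda>i. qexp p (r i) (\<psi> (r i)) f) \<longlonglongrightarrow> integral\<^sup>L \<mu> f"
    and prob: "prob_space \<mu>" and sets: "sets \<mu> = sets (restrict_space borel {0..1::real})"
    using sc unfolding semiclassical_def by blast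
  have base: "\<exists>K. quantized_code p A.nmax A.len k K (\<psi> k)" if k: "A.nmax \<le> k" for k
  proof -
    obtain lam where "\<forall>y\<in>words p k. Uapply p l n (Ms k) (\<psi> k) y = lam * \<psi> k y"
      using eig k nm by auto
    then show ?thesis using A.quantized_code_amp[OF k, of "Ms k" "\<psi> k" lam] quant eig k nm by auto
  qed
  have code: "semiclassical_code p (Suc m * A.nmax) (A.lenm (Suc m)) \<psi> r \<mu> (Suc m * A.nmax)" for m
  proof (rule semiclassical_code.intro[OF A.prefix_code_lenm], rule semiclassical_code_axioms.intro)
    fix k assume k: "Suc m * A.nmax \<le> k"
    then have "A.nmax \<le> k" by simp
    then obtain K where "quantized_code p A.nmax A.len k K (\<psi> k)" using base by blast
    from A.quantized_code_lenm[OF this k]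
    show "\<exists>K. quantized_code p (Suc m * A.nmax) (A.lenm (Suc m)) k K (\<psi> k)" .
  qed (rule r prob sets conv, assumption?)+
  have code1: "semiclassical_code p A.nmax A.len \<psi> r \<mu> A.nmax" using code[of 0] by (simp add: A.lenm_fun)
  define h where "h = 1/2 * (\<Sum>j<l. measure \<mu> (Ipart p l n j) * ln (real p ^ n j))"
  have mu_ln: "measure \<mu> (Ipart p l n j) * ln (real p ^ n j) = ln p * (real (n j) * measure \<mu> (Ipart p l n j))" for j
    using p by (simp add: ln_realpow)
  have h: "h = 1/2 * ln p * (\<Sum>j<l. real (n j) * measure \<mu> (Ipart p l n j))"
    unfolding h_def mu_ln sum_distrib_left[symmetric] by simp
  \<comment> \<open>Valid for each \<open>m\<close> with the same constant, hence for the limsup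
    that defines the entropy rate.\<close>
  have ge: "h \<le> part_entropy \<mu> (dynref \<mu> (Tmap p l n) A.P (Suc m)) / real (Suc m)" for m
  proof -
    have "real (Suc m) * h = 1 / 2 * ln p * (\<Sum>c\<in>prefix_code.C p (Suc m * A.nmax) (A.lenm (Suc m)). real (length c) * measure \<mu> (cell p c))"
      unfolding A.sum_code_lenm[OF code code1] A.sum_code_len h by simp
    also have "\<dots> \<le> part_entropy \<mu> (dynref \<mu> (Tmap p l n) A.P (Suc m))"
      using semiclassical_code.entropy_bound[OF code] A.code_entropy_le_part_entropy[OF code] by (rule order_trans)
    finally show ?thesis by (simp add: pos_le_divide_eq mult.commute del: of_nat_Suc)
  qed
  have "ereal h \<le> ent_rate \<mu> (Tmap p l n) A.P"
    unfolding ent_rate_def by (rule le_Limsup[OF sequentially_bot]) (simp add: ge del: of_nat_Suc)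
  also have "\<dots> \<le> ks_entropy \<mu> (Tmap p l n)"
    unfolding ks_entropy_def using A.is_fpart_P[OF sets] by (intro SUP_upper) simp
  finally show ?thesis by (simp only: h_def)
qed

end
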